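(* Suppose $a=(1+\alpha y)^2$ and $c=(1+\beta x+\gamma y)^2$ with $\alpha>0$ and $\beta,\gamma\in\mathbb{R}$. Let $X=\frac{x+r}{2r}$ and $Z=\frac{z}{r^3}$. Then near $X=0$ the branch $D_1$ is a graph of the form $$Z=\frac{-2}{r^2\alpha^2}X^2+o(X^2).$$
   Context: On a neighbourhood of $0$ in $\mathbb{R}^3$ with coordinates $(x,y,z)$, let $D=\ker(dz-\frac{y^2}{2}dx)$ with metric $g=a\,dx^2+c\,dy^2$. Orthonormal frame: $F_1=\frac1{\sqrt a}(\partial_x+\frac{y^2}{2}\partial_z)$, $F_2=\frac1{\sqrt c}\partial_y$. Normal geodesics parametrized by arc-length starting from $0$ are the solutions with $q(0)=0$ of $$\dot x=\frac{\cos\theta}{\sqrt a},\quad \dot y=\frac{\sin\theta}{\sqrt c},\quad \dot z=\frac{y^2}{2}\frac{\cos\theta}{\sqrt a},\quad \dot\theta=-\frac{1}{\sqrt a\sqrt c}\left(\lambda y-\alpha\cos\theta+\beta\sin\theta\right),$$ where $\lambda=p_z$ is constant along the geodesic. The lines $t\mapsto(\pm t,0,0)$ are the abnormal geodesics through $0$. The length $r>0$ is fixed and small. Branch $D_1$: the curve in the Martinet plane $\{y=0\}$, ending at $(x,z)=(-r,0)$, formed by the end-points $(x(r),z(r))$ of the normal geodesics of length $r$ starting from $0$ such that $y(r)=0$ with $r$ the first positive zero of $y(\cdot)$ (first return), which correspond to $\lambda\to+\infty$ and converge in $C^1$-topology (that is, $\theta$ stays uniformly close to $\pi$ modulo $2\pi$)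 to the abnormal geodesic $t\mapsto(-t,0,0)$ as the end-point tends to $(-r,0)$. *)

theory Defs
  imports Complex_Main "HOL-Library.Landau_Symbols"
begin

text \<open>Coefficients of the metric \<open>g = a dx^2 + c dy^2\<close> on the Martinet distribution
  \<open>ker (dz - y^2/2 dx)\<close>.\<close>

definition metric_a :: "real \<Rightarrow> real \<Rightarrow> real \<Rightarrow> real" where
  "metric_a \<alpha> x y = (1 + \<alpha> * y)^2"

definition metric_c :: "real \<Rightarrow> real \<Rightarrow> real \<Rightarrow> real \<Rightarrow> real" where
  "metric_c \<beta> \<gamma> x y = (1 + \<beta> * x + \<gamma> * y)^2"

text \<open>Arc-length normal geodesics of length \<open>r\<close> starting from the origin, with constant
  \<open>pz\<close> (the paper's \<open>\<lambda>\<close>).  The angle \<open>\<theta>\<close> is a real-valued lift and its initial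
  value is free.  Positivity of \<open>a\<close> and \<open>c\<close> says that the curve stays in the region around the
  origin where \<open>g\<close> is a metric; without it the quotients would take the
  value \<open>x / 0 = 0\<close>.\<close>

definition normal_geodesic ::
  "real \<Rightarrow> real \<Rightarrow> real \<Rightarrow> real \<Rightarrow> real \<Rightarrow>
   (real \<Rightarrow> real) \<Rightarrow> (real \<Rightarrow> real) \<Rightarrow> (real \<Rightarrow> real) \<Rightarrow> (real \<Rightarrow> real) \<Rightarrow> bool" where
  "normal_geodesic \<alpha> \<beta> \<gamma> r pz x y z \<theta> \<longleftrightarrow>
     x 0 = 0 \<and> y 0 = 0 \<and> z 0 = 0 \<and>
     (\<forall>t\<in>{0..r}.
        let a = metric_a \<alpha> (x t) (y t); c = metric_c \<beta> \<gamma> (x t) (y t) in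
        a > 0 \<and> c > 0 \<and>
        (x has_real_derivative cos (\<theta> t) / sqrt a) (at t within {0..r}) \<and>
        (y has_real_derivative sin (\<theta> t) / sqrt c) (at t within {0..r}) \<and>
        (z has_real_derivative (y t)^2 / 2 * (cos (\<theta> t) / sqrt a)) (at t within {0..r}) \<and>
        (\<theta> has_real_derivative
           - (1 / (sqrt a * sqrt c)) * (pz * y t - \<alpha> * cos (\<theta> t) + \<beta> * sin (\<theta> t)))
          (at t within {0..r}))"

definition first_return :: "real \<Rightarrow> (real \<Rightarrow> real) \<Rightarrow> bool" where
  "first_return r y \<longleftrightarrow> y r = 0 \<and> (\<forall>t. 0 < t \<and> t < r \<longrightarrow> y t \<noteq> 0)"

text \<open>The branch \<open>D\<^sub>1\<close> is a germ of curve at \<open>(x, z) = (-r, 0)\<close>: it is carried by the geodesics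
  with \<open>pz \<longrightarrow> +\<infinity>\<close> whose angle converges uniformly to \<open>\<pi>\<close> modulo \<open>2\<pi>\<close>, i.e. which converge
  in \<open>C\<^sup>1\<close> to \<open>t \<mapsto> (-t, 0, 0)\<close>.  The sets below, for \<open>\<delta> > 0\<close> small and then \<open>\<Lambda>\<close> large, are its
  representatives.\<close>

definition branch_D1 ::
  "real \<Rightarrow> real \<Rightarrow> real \<Rightarrow> real \<Rightarrow> real \<Rightarrow> real \<Rightarrow> (real \<times> real) set" where
  "branch_D1 \<alpha> \<beta> \<gamma> r \<delta> \<Lambda> =
     {(x r, z r) | pz x y z \<theta>.
        normal_geodesic \<alpha> \<beta> \<gamma> r pz x y z \<theta> \<and> first_return r y \<and> pz > \<Lambda> \<and>
        (\<exists>k::int. \<forall>t\<in>{0..r}. \<bar>\<theta> t - (pi + 2 * pi * of_int k)\<bar> < \<delta>)}"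

definition rescale :: "real \<Rightarrow> real \<times> real \<Rightarrow> real \<times> real" where
  "rescale r = (\<lambda>(x, z). ((x + r) / (2 * r), z / r^3))"

end

theory Submission imports Defs "HOL-Analysis.Analysis" begin

text \<open>
  Write \<open>\<theta> = \<pi> + \<phi>\<close> modulo \<open>2 \<pi>\<close>, \<open>A = 1 + \<alpha> y\<close>, \<open>b = 1 + \<beta> x + \<gamma> y\<close> and \<open>h = pz^(-1/2)\<close>.  Near the
  abnormal geodesic the equations linearise to \<open>y'' = (pz y + \<alpha>) / b^2\<close>, which is hyperbolic:
  a geodesic that comes back to \<open>y = 0\<close> only at time \<open>r\<close> follows the saddle \<open>y = - \<alpha> h^2\<close>, except
  in two boundary layers of width of order \<open>h\<close>.  Integrating along it gives
  \<open>x(r) + r = - \<alpha>^2 h^2 r + O(h^3)\<close> and \<open>z(r) = - \<alpha>^2 h^4 r / 2 + O(h^5)\<close>, and eliminating \<open>h\<close>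
  yields \<open>Z = - 2 X^2 / (r^2 \<alpha>^2) + o(X^2)\<close> with \<open>X < 0\<close>.

  The asymptotics rest on a priori bounds.  At an interior extremum of \<open>y\<close> the sign of \<open>y''\<close> is that of
  \<open>pz y + \<alpha>\<close>, which gives \<open>- \<alpha> h^2 \<le> y \<le> 0\<close> (\<open>y_lower\<close>, \<open>y_neg\<close>).  The energy
  \<open>1 - A cos \<phi> - pz y^2 / 2\<close> varies only through \<open>\<beta> sin^2 \<phi>\<close>, which gives \<open>\<phi> = O(h)\<close>
  (\<open>cos_deviation\<close>).  The remaining terms are total derivatives of \<open>A b \<phi>\<close> and \<open>b y sin \<phi>\<close> up to higher
  order (\<open>endpoint_x_upper\<close>, \<open>endpoint_x_lower\<close>, \<open>endpoint_z\<close>).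

  That the branch is a graph does not come from a monotonicity of \<open>X\<close> in \<open>pz\<close>, but from convexity.  Written
  as a graph over the \<open>x\<close>-axis, a geodesic with multiplier \<open>pz\<close> is critical, for fixed endpoints, for
  the integral of \<open>y^2 / 2\<close> plus \<open>h^2\<close> times the length, and for small \<open>h\<close> the integrand is
  convex in \<open>(y, y')\<close> near the abnormal curve, so critical points minimise.  Two
  geodesics of length \<open>r\<close> with the same \<open>x(r)\<close> have the same length and the same endpoints in the plane,
  and each minimises its own functional; hence they have the same integral of \<open>y^2 / 2\<close>, which is \<open>- z(r)\<close>
  (\<open>endpoint_z_le\<close>).

  That the branch reaches every small \<open>X < 0\<close> is a boundary value problem \<open>y(0) = y(r) = 0\<close>.  In the
  variables \<open>U, V = y / h^2 \<plusminus> \<phi> / h\<close> and \<open>W = (x + t) / h\<close> it is a linear system with one decaying and one growing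
  direction, perturbed by terms with Lipschitz constant of order \<open>h\<close>, so the contraction principle solves
  it for all small \<open>h\<close> (\<open>nonlinear_exists\<close>, \<open>solution_family\<close>).  The same estimate makes the
  endpoint continuous in \<open>h\<close>, and the intermediate value theorem gives every \<open>X\<close> (\<open>endpoint_exists\<close>).
\<close>

section \<open>Calculus on an interval\<close>

lemma increment_le:
  fixes f g :: "real \<Rightarrow> real"
  assumes "a \<le> b"
    and "\<And>t. t \<in> {a..b} \<Longrightarrow> (f has_real_derivative f' t) (at t within {a..b})"
    and "\<And>t. t \<in> {a..b} \<Longrightarrow> (g has_real_derivative g' t) (at t within {a..b})"
    and "\<And>t. t \<in> {a..b} \<Longrightarrow> f' t \<le> g' t"
  shows "f b - f a \<le> g b - g a"
proof -
  have "((\<lambda>t. g t - f t) has_derivative (*) (g' t - f' t)) (at t within {a..b})"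
    if "a \<le> t" "t \<le> b" for t
    using DERIV_diff[OF assms(3) assms(2), of t] that
    by (simp add: has_field_derivative_def)
  from mvt_very_simple[OF \<open>a \<le> b\<close> this]
  obtain t where "t \<in> {a..b}" "(g b - f b) - (g a - f a) = (g' t - f' t) * (b - a)"
    by blast
  moreover have "0 \<le> (g' t - f' t) * (b - a)"
    using assms(1) assms(4)[OF \<open>t \<in> {a..b}\<close>] by simp
  ultimately show ?thesis by linarith
qed

text \<open>Used with \<open>p = \<phi>\<close> or \<open>p = - \<phi>\<close>: the sign of \<open>p\<close> controls the sign of \<open>f'\<close>, so a zero of \<open>p\<close> with \<open>p' > 0\<close>
  cannot be a maximum of \<open>f\<close>.  This is a second derivative test phrased through \<open>p\<close>.\<close>

lemma increases_right_of_convex_critical_point: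
  fixes f p :: "real \<Rightarrow> real"
  assumes t: "a \<le> t" "t < b"
    and f: "\<And>s. s \<in> {a..b} \<Longrightarrow> (f has_real_derivative f' s) (at s within {a..b})"
    and p: "(p has_real_derivative d) (at t within {a..b})" "p t = 0" "d > 0"
    and pos: "\<And>s. s \<in> {a..b} \<Longrightarrow> p s > 0 \<Longrightarrow> f' s > 0"
  obtains s where "t < s" "s < b" "f t < f s"
proof -
  from has_real_derivative_pos_inc_right[OF p(1) p(3)]
  obtain e where e: "e > 0" "\<And>h. \<lbrakk>0 < h; t + h \<in> {a..b}; h < e\<rbrakk> \<Longrightarrow> p t < p (t + h)"
    by auto
  define s where "s = t + min (e / 2) ((b - t) / 2)"
  have s: "t < s" "s < b" "s < t + e"
    using e(1) t by (auto simp: s_def min_def field_simps)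
  have fder: "(f has_derivative (*) (f' u)) (at u within {t..s})" if "t \<le> u" "u \<le> s" for u
  proof -
    have "(f has_real_derivative f' u) (at u within {t..s})"
      using f[of u] that s t by (auto intro: DERIV_subset)
    then show ?thesis by (simp add: has_field_derivative_def)
  qed
  from mvt_simple[OF s(1) fder] obtain u where u: "u \<in> {t<..<s}" "f s - f t = f' u * (s - t)"
    by blast
  have "p u > 0" using e(2)[of "u - t"] u(1) s t p(2) by auto
  then have "f' u > 0" using pos u(1) s t by auto
  then have "f t < f s" using u s by (metis diff_gt_0_iff_gt mult_pos_pos)
  with s that show thesis by blast
qed

lemma interior_max_critical:
  fixes f :: "real \<Rightarrow> real"
  assumes "a < t" "t < b" "(f has_real_derivative d) (at t within {a..b})"
    and "\<And>s. s \<in> {a..b} \<Longrightarrow> f s \<le> f t"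
  shows "d = 0"
proof -
  have "(f has_real_derivative d) (at t)"
    using assms(1-3) at_within_interior[of t "{a..b}"] by (simp add: interior_atLeastAtMost_real)
  moreover have "\<forall>y. \<bar>t - y\<bar> < min (t - a) (b - t) \<longrightarrow> f y \<le> f t"
    using assms(4) by (auto simp: abs_less_iff)
  ultimately show ?thesis
    using DERIV_local_max[of f d t "min (t - a) (b - t)"] assms(1,2) by auto
qed

lemma one_minus_cos_ge:
  fixes u :: real
  assumes "\<bar>u\<bar> \<le> 1"
  shows "u^2 / 4 \<le> 1 - cos u"
proof -
  have "cos u \<le> 1 - u^2/2 + u^4/24"
  proof -
    obtain t where "cos u = (\<Sum>m<4. cos_coeff m * u ^ m) + (cos (t + 1/2 * real 4 * pi) / fact 4) * u ^ 4"
      using Maclaurin_cos_expansion[of u 4] by blast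
    then have "cos u = 1 - u^2/2 + (cos t / 24) * u ^ 4"
      by (simp add: cos_coeff_def lessThan_nat_numeral fact_numeral)
    moreover have "(cos t / 24) * u ^ 4 \<le> 1/24 * u ^ 4"
      by (rule mult_right_mono) (auto simp: cos_le_one)
    ultimately show ?thesis by simp
  qed
  moreover have "u^4 \<le> u^2"
    using assms abs_square_le_1[of u] mult_left_le[of "u^2" "u^2"] by (simp add: power4_eq_xxxx power2_eq_square mult.assoc)
  moreover have "u^2 \<ge> 0" by simp
  ultimately show ?thesis by linarith
qed

lemma one_minus_cos_le:
  fixes u :: real
  shows "1 - cos u \<le> u^2 / 2"
proof -
  have "1 - cos u = 2 * (sin (u/2))^2" using cos_double_sin[of "u/2"] by simp
  moreover have "(sin (u/2))^2 \<le> (u/2)^2"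
    using abs_sin_x_le_abs_x[of "u/2"] by (simp only: abs_le_square_iff)
  ultimately show ?thesis by (simp add: power_divide)
qed

lemma cos_ge_half:
  fixes u :: real
  assumes "\<bar>u\<bar> \<le> 1"
  shows "1/2 \<le> cos u"
proof -
  have "u^2 \<le> 1" using assms by (simp add: abs_square_le_1)
  then show ?thesis using one_minus_cos_le[of u] by linarith
qed

section \<open>A priori bounds for geodesics near the abnormal one\<close>

text \<open>The geodesic equations in the angle \<open>\<phi> = \<theta> - \<pi>\<close> measured from the abnormal direction, with the square
  roots of the metric coefficients resolved into \<open>A\<close> and \<open>b\<close>.\<close>

locale reflected_geodesic =
  fixes \<alpha> \<beta> \<gamma> r lam :: real and x y z \<phi> :: "real \<Rightarrow> real"
  assumes alpha_pos: "\<alpha> > 0" and r_pos: "r > 0" and lam_pos: "lam > 0"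
    and start: "x 0 = 0" "y 0 = 0" "z 0 = 0" and return: "y r = 0"
    and A_pos: "\<And>t. t \<in> {0..r} \<Longrightarrow> 1 + \<alpha> * y t > 0"
    and b_pos: "\<And>t. t \<in> {0..r} \<Longrightarrow> 1 + \<beta> * x t + \<gamma> * y t > 0"
    and dx: "\<And>t. t \<in> {0..r} \<Longrightarrow>
      (x has_real_derivative - (cos (\<phi> t) / (1 + \<alpha> * y t))) (at t within {0..r})"
    and dy: "\<And>t. t \<in> {0..r} \<Longrightarrow>
      (y has_real_derivative - (sin (\<phi> t) / (1 + \<beta> * x t + \<gamma> * y t))) (at t within {0..r})"
    and dz: "\<And>t. t \<in> {0..r} \<Longrightarrow>
      (z has_real_derivative - ((y t)^2 / 2 * (cos (\<phi> t) / (1 + \<alpha> * y t)))) (at t within {0..r})"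
    and dphi: "\<And>t. t \<in> {0..r} \<Longrightarrow>
      (\<phi> has_real_derivative - ((lam * y t + \<alpha> * cos (\<phi> t) - \<beta> * sin (\<phi> t)) /
         ((1 + \<alpha> * y t) * (1 + \<beta> * x t + \<gamma> * y t)))) (at t within {0..r})"
    and phi_small: "\<And>t. t \<in> {0..r} \<Longrightarrow> \<bar>\<phi> t\<bar> < 1"
begin

abbreviation A where "A t \<equiv> 1 + \<alpha> * y t"
abbreviation b where "b t \<equiv> 1 + \<beta> * x t + \<gamma> * y t"

lemma cont: "continuous_on {0..r} x" "continuous_on {0..r} y"
  "continuous_on {0..r} z" "continuous_on {0..r} \<phi>"
  by (auto intro!: DERIV_continuous_on dx dy dz dphi)

lemma sin_sign:
  assumes "t \<in> {0..r}"
  shows "\<phi> t > 0 \<Longrightarrow> sin (\<phi> t) > 0" "\<phi> t < 0 \<Longrightarrow> sin (\<phi> t) < 0"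
    "sin (\<phi> t) = 0 \<Longrightarrow> \<phi> t = 0"
proof -
  have pi: "pi > 1" using pi_gt3 by simp
  have b: "\<bar>\<phi> t\<bar> < 1" by (rule phi_small[OF assms])
  show 1: "sin (\<phi> t) > 0" if "\<phi> t > 0"
    using that b pi by (intro sin_gt_zero) auto
  show 2: "sin (\<phi> t) < 0" if "\<phi> t < 0"
    using sin_gt_zero[of "- \<phi> t"] that b pi by auto
  show "\<phi> t = 0" if "sin (\<phi> t) = 0"
    using 1 2 that by (cases "\<phi> t" "0::real" rule: linorder_cases) auto
qed

lemma phi_zero_at_extremum:
  assumes "0 < t" "t < r"
    and "(\<forall>s\<in>{0..r}. y s \<le> y t) \<or> (\<forall>s\<in>{0..r}. y t \<le> y s)"
  shows "\<phi> t = 0"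
proof -
  have tr: "t \<in> {0..r}" using assms by auto
  have "sin (\<phi> t) / b t = 0"
    using assms(3)
  proof
    assume "\<forall>s\<in>{0..r}. y s \<le> y t"
    then show ?thesis
      using interior_max_critical[OF assms(1,2) dy[OF tr]] by simp
  next
    assume "\<forall>s\<in>{0..r}. y t \<le> y s"
    then show ?thesis
      using interior_max_critical[OF assms(1,2) DERIV_minus[OF dy[OF tr]]] by simp
  qed
  then show ?thesis
    using b_pos[OF tr] sin_sign(3)[OF tr] by simp
qed

text \<open>At an interior maximum with \<open>y \<ge> 0\<close> one has \<open>\<phi> = 0\<close> and \<open>\<phi>' < 0\<close>, so \<open>y\<close> increases just afterwards.\<close>

lemma y_neg:
  assumes "0 < t" "t < r"
  shows "y t < 0"
proof (rule ccontr)
  assume "\<not> y t < 0"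
  obtain m where m: "m \<in> {0..r}" "\<And>s. s \<in> {0..r} \<Longrightarrow> y s \<le> y m"
    using continuous_attains_sup[of "{0..r}" y] cont(2) r_pos by auto
  obtain t0 where t0: "0 < t0" "t0 < r" "y t0 \<ge> 0" "\<And>s. s \<in> {0..r} \<Longrightarrow> y s \<le> y t0"
  proof (cases "m = 0 \<or> m = r")
    case True
    then have "y m = 0" using start return by auto
    then show thesis using that[of t] m assms \<open>\<not> y t < 0\<close> by (smt (verit) atLeastAtMost_iff)
  next
    case False
    then show thesis using that[of m] m assms \<open>\<not> y t < 0\<close> by (smt (verit) atLeastAtMost_iff)
  qed
  have tr: "t0 \<in> {0..r}" using t0 by auto
  have p0: "\<phi> t0 = 0" using phi_zero_at_extremum[of t0] t0 by auto
  have dd: "((\<lambda>s. - \<phi> s) has_real_derivative (lam * y t0 + \<alpha>) / (A t0 * b t0)) (at t0 within {0..r})"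
    using DERIV_minus[OF dphi[OF tr]] p0 by simp
  have "(lam * y t0 + \<alpha>) / (A t0 * b t0) > 0"
    using A_pos[OF tr] b_pos[OF tr] alpha_pos lam_pos t0 by (auto intro!: divide_pos_pos add_nonneg_pos)
  moreover have "0 < - (sin (\<phi> s) / b s)" if "s \<in> {0..r}" "0 < - \<phi> s" for s
    using sin_sign(2)[OF that(1)] b_pos[OF that(1)] that(2) by (simp add: divide_neg_pos)
  ultimately obtain s where "t0 < s" "s < r" "y t0 < y s"
    using increases_right_of_convex_critical_point[of 0 t0 r y, OF _ _ dy dd] t0 p0
    by (metis neg_equal_0_iff_equal less_imp_le)
  then show False using t0(4)[of s] t0(1) by auto
qed

lemma y_nonpos: "t \<in> {0..r} \<Longrightarrow> y t \<le> 0"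
  using y_neg[of t] start return by (cases "t = 0 \<or> t = r") auto

text \<open>The same argument at a minimum: below the saddle \<open>y = - \<alpha> / lam\<close> the angle turns the other way.\<close>

lemma y_lower:
  assumes "t \<in> {0..r}"
  shows "- \<alpha> \<le> lam * y t"
proof (rule ccontr)
  assume "\<not> - \<alpha> \<le> lam * y t"
  obtain t0 where t0: "t0 \<in> {0..r}" "\<And>s. s \<in> {0..r} \<Longrightarrow> y t0 \<le> y s"
    using continuous_attains_inf[of "{0..r}" y] cont(2) r_pos by auto
  have neg: "lam * y t0 + \<alpha> < 0"
    using mult_left_mono[OF t0(2)[OF assms] less_imp_le[OF lam_pos]] \<open>\<not> - \<alpha> \<le> lam * y t\<close>
    by linarith
  then have "t0 \<noteq> 0" "t0 \<noteq> r" using start return alpha_pos by auto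
  then have t0': "0 < t0" "t0 < r" using t0(1) by auto
  have p0: "\<phi> t0 = 0" using phi_zero_at_extremum[of t0] t0 t0' by auto
  have dd: "(\<phi> has_real_derivative - ((lam * y t0 + \<alpha>) / (A t0 * b t0))) (at t0 within {0..r})"
    using dphi[OF t0(1)] p0 by simp
  have "0 < - ((lam * y t0 + \<alpha>) / (A t0 * b t0))"
    using A_pos[OF t0(1)] b_pos[OF t0(1)] neg by (simp add: divide_neg_pos)
  moreover have dy': "((\<lambda>s. - y s) has_real_derivative sin (\<phi> s) / b s) (at s within {0..r})"
    if "s \<in> {0..r}" for s
    using DERIV_minus[OF dy[OF that]] by simp
  moreover have "0 < sin (\<phi> s) / b s" if "s \<in> {0..r}" "0 < \<phi> s" for s
    using sin_sign(1)[OF that(1)] b_pos[OF that(1)] that(2) by simp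
  ultimately obtain s where "t0 < s" "s < r" "- y t0 < - y s"
    using increases_right_of_convex_critical_point[of 0 t0 r "\<lambda>s. - y s", OF _ _ dy' dd] t0' p0
    by (metis less_imp_le)
  then show False using t0(2)[of s] t0'(1) by auto
qed

lemma cos_pos: "t \<in> {0..r} \<Longrightarrow> cos (\<phi> t) \<ge> 1/2"
  using cos_ge_half[of "\<phi> t"] phi_small[of t] by simp

end

text \<open>The number \<open>m\<close> dominates all coefficients, and \<open>h\<close>, the inverse square root of the multiplier, is the small
  parameter of all expansions.  The bound on \<open>h\<close> serves the convexity argument, the bound on \<open>r\<close> keeps
  \<open>b\<close> near \<open>1\<close> and lets the energy estimate close.\<close>

locale thin_geodesic = reflected_geodesic +
  fixes m h :: real
  assumes m_def: "m = 1 + \<alpha> + \<bar>\<beta>\<bar> + \<bar>\<gamma>\<bar>"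
    and h_pos: "h > 0" and lam_h: "lam * h^2 = 1"
    and h_small: "12 * m * h \<le> 1"
    and r_small: "64 * m * r \<le> 1"
begin

lemma m_ge: "1 \<le> m" "\<alpha> \<le> m" "\<bar>\<beta>\<bar> \<le> m" "\<bar>\<gamma>\<bar> \<le> m"
  using m_def alpha_pos by auto

lemma mh2: "m^2 * h^2 \<le> 1/16"
proof -
  have "(4*m*h)^2 \<le> 1" using h_small mult_pos_pos[of m h] m_ge h_pos by (intro power_le_one) auto
  then show ?thesis by (simp add: power_mult_distrib)
qed

lemma y_eq: "y t = h^2 * (lam * y t)"
  using lam_h by (metis mult.commute mult.left_commute mult_1)

lemma y_ge: "t \<in> {0..r} \<Longrightarrow> - (\<alpha> * h^2) \<le> y t"
  using mult_left_mono[OF y_lower, of t "h^2"] unfolding y_eq[of t, symmetric]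
  by (simp add: mult.commute)

lemma abs_y: "t \<in> {0..r} \<Longrightarrow> \<bar>y t\<bar> \<le> \<alpha> * h^2"
  using y_ge[of t] y_nonpos[of t] by auto

lemma coeff_y: 
  assumes "t \<in> {0..r}" "\<bar>c\<bar> \<le> m" shows "\<bar>c * y t\<bar> \<le> 1/16"
proof -
  have "\<bar>c * y t\<bar> \<le> m * (m * h^2)"
    unfolding abs_mult using abs_y[OF assms(1)] m_ge assms(2) 
    by (intro mult_mono order_trans[OF abs_y[OF assms(1)]]) (auto intro!: mult_right_mono)
  then show ?thesis using mh2 by (simp add: power2_eq_square mult.assoc)
qed

lemma A_bounds: "t \<in> {0..r} \<Longrightarrow> 15/16 \<le> A t" "t \<in> {0..r} \<Longrightarrow> A t \<le> 1"
  using coeff_y[of t \<alpha>] m_ge alpha_pos y_nonpos[of t] mult_nonneg_nonpos[of \<alpha> "y t"] by auto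

lemma abs_beta_x: 
  assumes t: "t \<in> {0..r}" shows "\<bar>\<beta> * x t\<bar> \<le> 1/32"
proof -
  have d: "\<bar>cos (\<phi> s) / A s\<bar> \<le> 2" if "s \<in> {0..r}" for s
  proof -
    have "1 \<le> 2 * A s" using A_bounds[OF that] by simp
    then have "\<bar>cos (\<phi> s)\<bar> \<le> 2 * A s" using abs_cos_le_one[of "\<phi> s"] by (rule order_trans[rotated])
    then show ?thesis using A_pos[OF that] by (simp add: abs_divide pos_divide_le_eq)
  qed
  have sub: "{0..t} \<subseteq> {0..r}" using t by auto
  have dx': "(x has_real_derivative - (cos (\<phi> s) / A s)) (at s within {0..t})" if "s \<in> {0..t}" for s
    using dx[of s] sub that by (blast intro: DERIV_subset)
  have 1: "x t - x 0 \<le> 2 * t - 2 * 0"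
  proof (rule increment_le[OF _ dx'])
    show "((\<lambda>s. 2 * s) has_real_derivative 2) (at s within {0..t})" for s
      by (auto intro!: derivative_eq_intros)
  qed (use t abs_le_D1[OF d] abs_le_D2[OF d] in auto)
  have 2: "- 2 * t - - 2 * 0 \<le> x t - x 0"
  proof (rule increment_le[OF _ _ dx'])
    show "((\<lambda>s. - 2 * s) has_real_derivative - 2) (at s within {0..t})" for s
      by (auto intro!: derivative_eq_intros)
  qed (use t abs_le_D1[OF d] abs_le_D2[OF d] in auto)
  have "\<bar>x t\<bar> \<le> 2 * r" using 1 2 start t by auto
  then have "\<bar>\<beta> * x t\<bar> \<le> m * (2 * r)"
    unfolding abs_mult using m_ge by (intro mult_mono) auto
  then show ?thesis using r_small by simp
qed

lemma b_bounds: 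
  assumes "t \<in> {0..r}" shows "7/8 \<le> b t" "b t \<le> 9/8"
  using abs_beta_x[OF assms] coeff_y[OF assms m_ge(4)] by (auto simp: abs_le_iff)

text \<open>The energy \<open>E\<close> dominates \<open>A (1 - cos \<phi>)\<close>, since the remaining part \<open>\<alpha> y + lam y^2 / 2\<close> is nonpositive.  It
  is at most \<open>\<alpha>^2 h^2 / 2\<close> at the minimum of \<open>y\<close>, where \<open>\<phi> = 0\<close>, and \<open>E'\<close> is itself controlled by the maximum \<open>M\<close>
  of \<open>1 - cos \<phi>\<close>.  As \<open>r\<close> is small, this bounds \<open>M\<close> by itself times a small factor plus \<open>O(h^2)\<close>.\<close>

lemma cos_deviation:
  assumes t: "t \<in> {0..r}"
  shows "1 - cos (\<phi> t) \<le> \<alpha>^2 * h^2"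
proof -
  define E where "E s = 1 - A s * cos (\<phi> s) - lam * (y s)^2 / 2" for s
  have dE: "(E has_real_derivative \<beta> * (sin (\<phi> s))^2 / b s) (at s within {0..r})"
    if s: "s \<in> {0..r}" for s
  proof -
    define a' b' where "a' = A s" and "b' = b s"
    have pos: "a' > 0" "b' > 0" using A_pos[OF s] b_pos[OF s] by (simp_all add: a'_def b'_def)
    have dy': "(y has_real_derivative - (sin (\<phi> s) / b')) (at s within {0..r})"
      and dphi': "(\<phi> has_real_derivative
         - ((lam * y s + \<alpha> * cos (\<phi> s) - \<beta> * sin (\<phi> s)) / (a' * b'))) (at s within {0..r})"
      using dy[OF s] dphi[OF s] by (simp_all add: a'_def b'_def)
    define k where "k = lam / 2"
    have E_k: "E = (\<lambda>s. 1 - A s * cos (\<phi> s) - k * (y s)^2)"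
      by (simp add: fun_eq_iff E_def k_def)
    show ?thesis
      unfolding E_k
      by (rule DERIV_cong, (rule derivative_eq_intros dy' dphi' refl)+)
         (use pos in \<open>unfold a'_def[symmetric] b'_def[symmetric], simp add: k_def field_simps power2_eq_square\<close>)
  qed
  obtain s1 where s1: "s1 \<in> {0..r}" "\<And>s. s \<in> {0..r} \<Longrightarrow> 1 - cos (\<phi> s) \<le> 1 - cos (\<phi> s1)"
    using continuous_attains_sup[OF compact_Icc _ continuous_on_diff[OF continuous_on_const continuous_on_cos[OF cont(4)]], of 1] r_pos
    by auto
  define M where "M = 1 - cos (\<phi> s1)"
  have M0: "M \<ge> 0" by (simp add: M_def)
  have dEb: "\<bar>\<beta> * (sin (\<phi> s))^2 / b s\<bar> \<le> 3 * m * M" if s: "s \<in> {0..r}" for s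
  proof -
    have "(sin (\<phi> s))^2 = (1 - cos (\<phi> s)) * (1 + cos (\<phi> s))"
      using sin_squared_eq[of "\<phi> s"] by (simp add: algebra_simps power2_eq_square)
    also have "\<dots> \<le> M * 2"
      using s1(2)[OF s] cos_pos[OF s] M0 by (intro mult_mono) (auto simp: M_def)
    finally have "\<bar>\<beta>\<bar> * (sin (\<phi> s))^2 \<le> m * (M * 2)"
      using m_ge by (intro mult_mono) auto
    also have "\<dots> \<le> (3 * m * M) * b s"
      using mult_left_mono[OF b_bounds(1)[OF s], of "3 * m * M"] m_ge M0 by simp
    finally show ?thesis using b_pos[OF s] by (simp add: abs_mult divide_le_eq)
  qed
  \<comment> \<open>The minimum of \<open>y\<close> is interior.\<close>
  obtain s0 where s0: "s0 \<in> {0..r}" "\<phi> s0 = 0"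
  proof -
    obtain c where c: "c \<in> {0..r}" "\<And>s. s \<in> {0..r} \<Longrightarrow> y c \<le> y s"
      using continuous_attains_inf[of "{0..r}" y] cont(2) r_pos by auto
    have "y c < 0" using c(2)[of "r/2"] y_neg[of "r/2"] r_pos by auto
    then have "c \<noteq> 0" "c \<noteq> r" using start return by auto
    then show thesis using phi_zero_at_extremum[of c] c that[of c] by auto
  qed
  have var: "E s1 - E s0 \<le> 3 * m * M * r"
  proof (cases "s0 \<le> s1")
    case True
    have sub: "{s0..s1} \<subseteq> {0..r}" using s0 s1 by auto
    have "E s1 - E s0 \<le> 3 * m * M * s1 - 3 * m * M * s0"
      by (rule increment_le[of s0 s1 E "\<lambda>s. \<beta> * (sin (\<phi> s))^2 / b s" "\<lambda>s. 3 * m * M * s" "\<lambda>s. 3 * m * M"])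
         (use sub abs_le_D1[OF dEb] True in \<open>auto intro!: derivative_eq_intros DERIV_subset[OF dE sub]\<close>)
    also have "\<dots> \<le> 3 * m * M * r"
      using s0 s1 m_ge M0 by (simp add: right_diff_distrib[symmetric] mult_left_mono)
    finally show ?thesis .
  next
    case False
    have sub: "{s1..s0} \<subseteq> {0..r}" using s0 s1 by auto
    have "(- (3 * m * M)) * s0 - (- (3 * m * M)) * s1 \<le> E s0 - E s1"
      by (rule increment_le[of s1 s0 "\<lambda>s. (- (3 * m * M)) * s" "\<lambda>s. - (3 * m * M)" E "\<lambda>s. \<beta> * (sin (\<phi> s))^2 / b s"])
         (use sub abs_le_D2[OF dEb] False in \<open>auto intro!: derivative_eq_intros DERIV_subset[OF dE sub] simp: minus_le_iff\<close>)
    then have "E s1 - E s0 \<le> 3 * m * M * (s0 - s1)" by (simp add: algebra_simps)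
    also have "\<dots> \<le> 3 * m * M * r"
      using s0 s1 m_ge M0 by (intro mult_left_mono) auto
    finally show ?thesis .
  qed
  have E0: "E s0 \<le> \<alpha>^2 * h^2 / 2"
  proof -
    \<comment> \<open>Completing the square in \<open>lam y\<close> gives the maximum over all possible values.\<close>
    have "E s0 = h^2 * (- \<alpha> * (lam * y s0) - (lam * y s0)^2 / 2)"
      using lam_h unfolding E_def s0(2) power2_eq_square by simp algebra
    also have "\<dots> = h^2 * (\<alpha>^2 / 2 - (lam * y s0 + \<alpha>)^2 / 2)"
      by (simp add: power2_eq_square algebra_simps)
    also have "\<dots> \<le> h^2 * (\<alpha>^2 / 2)" by (intro mult_left_mono) auto
    finally show ?thesis by (simp add: mult.commute)
  qed
  have "A s1 * M = (\<alpha> * y s1 + lam * (y s1)^2 / 2) + E s1"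
    by (simp add: E_def M_def algebra_simps)
  also have "\<alpha> * y s1 + lam * (y s1)^2 / 2 = (- y s1) * (- (\<alpha> + lam * y s1 / 2))"
    by (simp add: power2_eq_square algebra_simps)
  also have "(- y s1) * (- (\<alpha> + lam * y s1 / 2)) \<le> 0"
    using y_nonpos[OF s1(1)] y_lower[OF s1(1)] alpha_pos by (intro mult_nonneg_nonpos) auto
  finally have "A s1 * M \<le> E s1" by simp
  moreover have "15/16 * M \<le> A s1 * M" using A_bounds[OF s1(1)] M0 by (intro mult_right_mono)
  moreover have "3 * m * M * r \<le> 3/64 * M" using mult_right_mono[OF r_small M0] by (simp add: algebra_simps)
  ultimately have "M \<le> \<alpha>^2 * h^2" using var E0 M0 by linarith
  then show ?thesis using s1(2)[OF t] by (simp add: M_def)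
qed

lemma abs_phi: 
  assumes "t \<in> {0..r}" shows "\<bar>\<phi> t\<bar> \<le> 2 * \<alpha> * h"
proof -
  have "(\<phi> t)^2 \<le> (2 * \<alpha> * h)^2"
    using one_minus_cos_ge[of "\<phi> t"] phi_small[OF assms] cos_deviation[OF assms]
    by (simp add: power_mult_distrib)
  then show ?thesis
    using abs_le_square_iff[of "\<phi> t" "2 * \<alpha> * h"] alpha_pos h_pos by simp
qed

end

section \<open>Expansion of the endpoint\<close>

context thin_geodesic
begin

abbreviation v where "v t \<equiv> lam * y t + \<alpha>"
abbreviation s where "s t \<equiv> sin (\<phi> t)"
abbreviation c where "c t \<equiv> cos (\<phi> t)"

text \<open>Primitive of \<open>- v\<close> up to \<open>O(h)\<close>; the weight \<open>A b\<close> clears the denominator of \<open>\<phi>'\<close>.\<close>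

definition scaled_angle where "scaled_angle t = A t * b t * \<phi> t"
text \<open>Primitive of \<open>- sin^2 \<phi>\<close> up to \<open>h^2 v\<close>; it vanishes where \<open>y\<close> does.\<close>

definition slope_moment where "slope_moment t = b t * y t * s t"

lemma v_bounds: "t \<in> {0..r} \<Longrightarrow> 0 \<le> v t" "t \<in> {0..r} \<Longrightarrow> v t \<le> \<alpha>"
  using y_lower[of t] mult_nonneg_nonpos[OF less_imp_le[OF lam_pos] y_nonpos[of t]] by auto

lemma alpha_y_eq: "\<alpha> * y t = \<alpha> * h^2 * v t - \<alpha>^2 * h^2"
proof -
  have "\<alpha> * y t = \<alpha> * (h^2 * (lam * y t))" using y_eq[of t] by simp
  then show ?thesis by (simp add: algebra_simps power2_eq_square)
qed

lemma abs_phi_m: "t \<in> {0..r} \<Longrightarrow> \<bar>\<phi> t\<bar> \<le> 2 * (m * h)"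
  using abs_phi[of t] mult_right_mono[OF m_ge(2), of h] h_pos by linarith

lemma abs_sin_phi: "t \<in> {0..r} \<Longrightarrow> \<bar>s t\<bar> \<le> 2 * (m * h)"
  using abs_phi_m[of t] abs_sin_x_le_abs_x[of "\<phi> t"] by linarith

lemma mh_small: "0 < m * h" "m * h \<le> 1/4" 
  using m_ge h_pos h_small by (auto simp: mult.assoc)

lemma ratio_bounds:
  assumes t: "t \<in> {0..r}"
  shows "0 \<le> c t / A t" "c t / A t \<le> 2" "0 \<le> A t / b t" "A t / b t \<le> 2" "\<bar>c t\<bar> \<le> 1"
    "0 \<le> 1 - c t" "1 - c t \<le> \<bar>\<phi> t\<bar>"
proof -
  note ab = A_bounds[OF t] b_bounds[OF t] cos_pos[OF t]
  have "c t \<le> 1" by simp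
  moreover have "1 \<le> 2 * A t" using ab(1) by simp
  ultimately have "c t \<le> 2 * A t" by (rule order_trans)
  then show "c t / A t \<le> 2" using A_pos[OF t] by (simp only: pos_divide_le_eq)
  show "0 \<le> c t / A t" "0 \<le> A t / b t" using ab by auto
  show "A t / b t \<le> 2" using ab by (simp add: divide_le_eq)
  show "\<bar>c t\<bar> \<le> 1" "0 \<le> 1 - c t" by auto
  have "(\<phi> t)^2 = \<bar>\<phi> t\<bar> * \<bar>\<phi> t\<bar>" by (simp add: power2_eq_square)
  also have "\<dots> \<le> \<bar>\<phi> t\<bar> * 1" using phi_small[OF t] by (intro mult_left_mono) auto
  finally show "1 - c t \<le> \<bar>\<phi> t\<bar>" using one_minus_cos_le[of "\<phi> t"] by simp
qed

lemma b_derivative: "t \<in> {0..r} \<Longrightarrow> (b has_real_derivative - (\<beta> * (c t / A t)) - \<gamma> * (s t / b t)) (at t within {0..r})"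
  by (rule DERIV_cong, (rule derivative_eq_intros dx dy refl | assumption)+) (simp add: mult.commute)

lemma abs_b_derivative:
  assumes t: "t \<in> {0..r}"
  shows "\<bar>- (\<beta> * (c t / A t)) - \<gamma> * (s t / b t)\<bar> \<le> 4 * m"
proof -
  have "\<bar>\<beta> * (c t / A t)\<bar> \<le> m * 2"
    unfolding abs_mult abs_of_nonneg[OF ratio_bounds(1)[OF t]]
    using ratio_bounds[OF t] m_ge by (intro mult_mono) auto
  moreover have "1 \<le> 2 * b t" using b_bounds(1)[OF t] by simp
  then have "\<bar>s t\<bar> \<le> 2 * b t" using abs_sin_le_one[of "\<phi> t"] by (rule order_trans[rotated])
  then have "\<bar>s t / b t\<bar> \<le> 2" using b_pos[OF t] by (simp add: abs_divide pos_divide_le_eq)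
  then have "\<bar>\<gamma> * (s t / b t)\<bar> \<le> m * 2"
    unfolding abs_mult using m_ge by (intro mult_mono) auto
  ultimately show ?thesis by linarith
qed

text \<open>The deviation \<open>v\<close> from the saddle has size of order \<open>1\<close> inside the boundary layers, but it is a
  total derivative up to \<open>O(h)\<close>, so its integral is small.\<close>

lemma scaled_angle_derivative:
  assumes t: "t \<in> {0..r}"
  obtains p where "(scaled_angle has_real_derivative p) (at t within {0..r})" "\<bar>p + v t\<bar> \<le> 4 * m^2 * h"
proof
  have A0: "A t \<noteq> 0" and b0: "b t \<noteq> 0" using A_pos[OF t] b_pos[OF t] by auto
  let ?p = "- \<alpha> * (s t * \<phi> t) - \<beta> * (c t * \<phi> t) - \<gamma> * ((A t / b t) * (s t * \<phi> t))
    - (lam * y t + \<alpha> * c t - \<beta> * s t)"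
  have product_algebra: "((0 + (0 * yt + - (st / b') * \<alpha>)) * b' + (- (\<beta> * (ct / a')) - \<gamma> * (st / b')) * a') * p
      + - (w / (a' * b')) * (a' * b')
      = - \<alpha> * (st * p) - \<beta> * (ct * p) - \<gamma> * (a' / b' * (st * p)) - w"
    if "a' \<noteq> 0" "b' \<noteq> 0" for a' b' yt st ct p w :: real
    using that by (simp add: field_simps)
  note db1 = b_derivative[OF t]
  show "(scaled_angle has_real_derivative ?p) (at t within {0..r})"
    unfolding scaled_angle_def
    by (rule DERIV_cong, (rule db1 derivative_eq_intros dy[OF t] dphi[OF t] refl)+)
       (rule product_algebra[OF A0 b0])
  have s\<phi>: "\<bar>s t * \<phi> t\<bar> \<le> \<bar>\<phi> t\<bar>" "\<bar>c t * \<phi> t\<bar> \<le> \<bar>\<phi> t\<bar>"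
    using mult_right_mono[OF abs_sin_le_one, of "\<bar>\<phi> t\<bar>" "\<phi> t"]
      mult_right_mono[OF abs_cos_le_one, of "\<bar>\<phi> t\<bar>" "\<phi> t"] by (auto simp: abs_mult)
  have ss: "\<bar>s t\<bar> \<le> \<bar>\<phi> t\<bar>" by (rule abs_sin_x_le_abs_x)
  have e: "?p + v t = - \<alpha> * (s t * \<phi> t) + (- \<beta> * (c t * \<phi> t)) + (- \<gamma> * ((A t / b t) * (s t * \<phi> t)))
     + \<alpha> * (1 - c t) + \<beta> * s t"
    by (simp add: right_diff_distrib)
  have 1: "\<bar>- \<alpha> * (s t * \<phi> t)\<bar> \<le> \<alpha> * \<bar>\<phi> t\<bar>"
    using s\<phi> alpha_pos unfolding abs_mult[of "-\<alpha>"] by (intro mult_mono) auto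
  have 2: "\<bar>- \<beta> * (c t * \<phi> t)\<bar> \<le> \<bar>\<beta>\<bar> * \<bar>\<phi> t\<bar>"
    using s\<phi> unfolding abs_mult[of "-\<beta>"] by (intro mult_mono) auto
  have "\<bar>(A t / b t) * (s t * \<phi> t)\<bar> \<le> 2 * \<bar>\<phi> t\<bar>"
    unfolding abs_mult[of "A t / b t"] abs_of_nonneg[OF ratio_bounds(3)[OF t]] using ratio_bounds[OF t] s\<phi> by (intro mult_mono) auto
  then have 3: "\<bar>- \<gamma> * ((A t / b t) * (s t * \<phi> t))\<bar> \<le> \<bar>\<gamma>\<bar> * (2 * \<bar>\<phi> t\<bar>)"
    unfolding abs_mult[of "-\<gamma>"] by (intro mult_mono) auto
  have 4: "\<bar>\<alpha> * (1 - c t)\<bar> \<le> \<alpha> * \<bar>\<phi> t\<bar>"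
    unfolding abs_mult using ratio_bounds[OF t] alpha_pos by (intro mult_mono) auto
  have 5: "\<bar>\<beta> * s t\<bar> \<le> \<bar>\<beta>\<bar> * \<bar>\<phi> t\<bar>"
    unfolding abs_mult using ss by (intro mult_mono) auto
  have "\<bar>?p + v t\<bar> \<le> \<alpha> * \<bar>\<phi> t\<bar> + \<bar>\<beta>\<bar> * \<bar>\<phi> t\<bar> + \<bar>\<gamma>\<bar> * (2 * \<bar>\<phi> t\<bar>) + \<alpha> * \<bar>\<phi> t\<bar> + \<bar>\<beta>\<bar> * \<bar>\<phi> t\<bar>"
    unfolding e using 1 2 3 4 5 by (intro order_trans[OF abs_triangle_ineq] add_mono)
  also have "\<dots> \<le> 2 * m * \<bar>\<phi> t\<bar>" unfolding m_def by (simp add: algebra_simps)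
  also have "\<dots> \<le> 2 * m * (2 * (m * h))" using abs_phi_m[OF t] m_ge by (intro mult_left_mono) auto
  finally show "\<bar>?p + v t\<bar> \<le> 4 * m^2 * h" by (simp add: power2_eq_square)
qed

lemma scaled_angle_bound: "t \<in> {0..r} \<Longrightarrow> \<bar>scaled_angle t\<bar> \<le> 4 * (m * h)"
proof -
  assume t: "t \<in> {0..r}"
  have "\<bar>A t * b t\<bar> \<le> 1 * 2" unfolding abs_mult
    using A_bounds[OF t] b_bounds[OF t] by (intro mult_mono) auto
  then have "\<bar>scaled_angle t\<bar> \<le> 2 * (2 * (m * h))"
    unfolding scaled_angle_def abs_mult[of "A t * b t"] using abs_phi_m[OF t] by (intro mult_mono) auto
  then show ?thesis by simp
qed

text \<open>Pointwise \<open>sin^2 \<phi>\<close> is only \<open>O(h^2)\<close>, the order of the main term.  Its integral is smaller, because up to the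
  derivative of a function that vanishes at both ends it is bounded by a multiple of \<open>h^2 v\<close> plus \<open>O(h^3)\<close>, and
  the integral of \<open>v\<close> is \<open>O(h)\<close>.\<close>

lemma slope_moment_derivative:
  assumes t: "t \<in> {0..r}"
  obtains q where "(slope_moment has_real_derivative q) (at t within {0..r})"
    "q + (s t)^2 \<le> 2 * \<alpha> * h^2 * v t + 12 * (m * h)^3"
proof
  define a' where "a' = A t"
  define b' where "b' = b t"
  define b_derivative' where "b_derivative' = - (\<beta> * (c t / A t)) - \<gamma> * (s t / b t)"
  have nz: "a' \<noteq> 0" "b' \<noteq> 0" using A_pos[OF t] b_pos[OF t] by (auto simp: a'_def b'_def)
  let ?w = "lam * y t + \<alpha> * c t - \<beta> * s t"
  let ?q = "b_derivative' * (y t * s t) - (s t)^2 + (- y t) * (c t / A t) * ?w"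
  have db1: "(b has_real_derivative b_derivative') (at t within {0..r})" using b_derivative[OF t] by (simp add: b_derivative'_def)
  show "(slope_moment has_real_derivative ?q) (at t within {0..r})"
    unfolding slope_moment_def
    by (rule DERIV_cong, (rule db1 derivative_eq_intros dy[OF t] dphi[OF t] refl)+)
       (use nz in \<open>unfold a'_def[symmetric] b'_def[symmetric], simp add: field_simps power2_eq_square\<close>)
  have "\<bar>y t * s t\<bar> \<le> (\<alpha> * h^2) * (2 * (m * h))"
    unfolding abs_mult using abs_y[OF t] abs_sin_phi[OF t] alpha_pos by (intro mult_mono) auto
  also have "\<dots> \<le> (m * h^2) * (2 * (m * h))"
    using m_ge mh_small by (intro mult_right_mono) auto
  finally have ys: "\<bar>y t * s t\<bar> \<le> (m * h^2) * (2 * (m * h))" .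
  have "\<bar>b_derivative' * (y t * s t)\<bar> \<le> (4 * m) * ((m * h^2) * (2 * (m * h)))"
    unfolding abs_mult[of b_derivative'] using abs_b_derivative[OF t, folded b_derivative'_def] ys m_ge by (intro mult_mono) auto
  then have 1: "b_derivative' * (y t * s t) \<le> 8 * (m * h)^3"
    by (simp add: power3_eq_cube power2_eq_square algebra_simps abs_le_iff)
  have bs: "\<bar>\<beta> * s t\<bar> \<le> m * (2 * (m * h))"
    unfolding abs_mult using abs_sin_phi[OF t] m_ge by (intro mult_mono) auto
  have "\<alpha> * c t \<le> \<alpha>" using alpha_pos by simp
  then have w: "?w \<le> v t + 2 * m^2 * h" using bs by (simp add: power2_eq_square abs_le_iff)
  have "(- y t) * (c t / A t) \<le> (\<alpha> * h^2) * 2"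
    using abs_y[OF t] y_nonpos[OF t] ratio_bounds[OF t] alpha_pos by (intro mult_mono) auto
  moreover have "0 \<le> (- y t) * (c t / A t)" using y_nonpos[OF t] ratio_bounds[OF t] by (intro mult_nonneg_nonneg) auto
  moreover have "0 \<le> v t + 2 * m^2 * h" using v_bounds[OF t] h_pos by simp
  ultimately have "(- y t) * (c t / A t) * ?w \<le> ((\<alpha> * h^2) * 2) * (v t + 2 * m^2 * h)"
    using w by (meson mult_left_mono mult_right_mono order_trans)
  also have "\<dots> = 2 * \<alpha> * h^2 * v t + 4 * \<alpha> * (m^2 * h^3)" by (simp add: algebra_simps power2_eq_square power3_eq_cube)
  also have "4 * \<alpha> * (m^2 * h^3) \<le> 4 * m * (m^2 * h^3)" using m_ge h_pos by (intro mult_right_mono) auto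
  also have "4 * m * (m^2 * h^3) = 4 * (m * h)^3" by (simp add: power_mult_distrib power2_eq_square power3_eq_cube)
  finally show "?q + (s t)^2 \<le> 2 * \<alpha> * h^2 * v t + 12 * (m * h)^3" using 1 by linarith
qed


lemma mh_powers: "m^2 * h^2 \<le> m * h" "m^4 * h^4 \<le> (m * h)^3"
proof -
  show "m^2 * h^2 \<le> m * h"
    using mult_left_mono[of "m * h" 1 "m * h"] mh_small by (simp add: power2_eq_square mult_ac)
  have "(m * h)^3 * (m * h) \<le> (m * h)^3 * 1" using mh_small by (intro mult_left_mono) auto
  then show "m^4 * h^4 \<le> (m * h)^3" by (simp add: power_mult_distrib power4_eq_xxxx power3_eq_cube mult_ac)
qed

lemma alpha_y_sq: 
  assumes t: "t \<in> {0..r}" shows "(\<alpha> * y t)^2 \<le> (m * h)^3"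
proof -
  have "\<bar>\<alpha> * y t\<bar> \<le> m * (m * h^2)"
    unfolding abs_mult using m_ge alpha_pos
    by (intro mult_mono order_trans[OF abs_y[OF t] mult_right_mono]) auto
  then have "\<bar>\<alpha> * y t\<bar>^2 \<le> (m * (m * h^2))^2" by (intro power_mono) auto
  also have "\<dots> = m^4 * h^4" by (simp add: power_mult_distrib power4_eq_xxxx power2_eq_square mult_ac)
  finally show ?thesis using mh_powers(2) by simp
qed

lemma linear_derivative: "((\<lambda>t. k * t) has_real_derivative k) (at t within S)"
  by (auto intro!: derivative_eq_intros)

lemma increment_le_rate:
  assumes "\<And>t. t \<in> {0..r} \<Longrightarrow> \<exists>d. (f has_real_derivative d) (at t within {0..r}) \<and> d \<le> k"
  shows "f r - f 0 \<le> k * r"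
proof -
  obtain d where d: "\<And>t. t \<in> {0..r} \<Longrightarrow> (f has_real_derivative d t) (at t within {0..r}) \<and> d t \<le> k"
    using bchoice[of "{0..r}" "\<lambda>t d. (f has_real_derivative d) (at t within {0..r}) \<and> d \<le> k"] assms
    by blast
  have "f r - f 0 \<le> k * r - k * 0"
    by (rule increment_le[of 0 r f d _ "\<lambda>_. k"]) (use d r_pos linear_derivative in auto)
  then show ?thesis by simp
qed

lemma r_le_1: "r \<le> 1"
  using r_small r_pos mult_right_mono[OF m_ge(1) less_imp_le[OF r_pos]] by linarith

lemma alpha_h_powers: "\<alpha> * h^2 * (4 * m^2 * h) \<le> 4 * (m * h)^3" "\<alpha> * h^2 * (4 * (m * h)) \<le> 4 * (m * h)^3"
  "\<alpha> * h^2 \<ge> 0"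
proof -
  have "\<alpha> * h^2 * (4 * m^2 * h) = \<alpha> * (4 * (m^2 * h^3))" by (simp add: power2_eq_square power3_eq_cube mult_ac)
  also have "\<dots> \<le> m * (4 * (m^2 * h^3))" using m_ge h_pos by (intro mult_right_mono) auto
  also have "\<dots> = 4 * (m * h)^3" by (simp add: power2_eq_square power3_eq_cube mult_ac)
  finally show 1: "\<alpha> * h^2 * (4 * m^2 * h) \<le> 4 * (m * h)^3" .
  show nn: "\<alpha> * h^2 \<ge> 0" using alpha_pos by simp
  have "m * h \<le> m^2 * h" using m_ge h_pos by (simp add: power2_eq_square)
  then have "\<alpha> * h^2 * (4 * (m * h)) \<le> \<alpha> * h^2 * (4 * m^2 * h)"
    using nn by (intro mult_left_mono) auto
  with 1 show "\<alpha> * h^2 * (4 * (m * h)) \<le> 4 * (m * h)^3" by linarith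
qed

lemma quotient_split:
  fixes u w :: real
  assumes "1 + u \<noteq> 0"
  shows "(u + w) / (1 + u) = u - u * u / (1 + u) + w / (1 + u)"
proof -
  have "u = u * (1 + u) / (1 + u)" using assms by simp
  then have "u - u * u / (1 + u) = u / (1 + u)"
    unfolding diff_divide_distrib[symmetric] by (simp add: distrib_left add_divide_distrib)
  then show ?thesis by (simp add: add_divide_distrib)
qed

text \<open>The function \<open>P\<close> corrects \<open>x + t\<close> by the two total derivatives above, with weights that cancel all
  terms of order \<open>h^2\<close>; the corrections themselves are \<open>O(h^3)\<close> at the ends.\<close>

lemma endpoint_x_upper: "x r + r + \<alpha>^2 * h^2 * r \<le> 84 * (m * h)^3"
proof -
  define e where "e = (m * h)^3"
  have e0: "e \<ge> 0" using mh_small by (simp add: e_def)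
  define k where "k = \<alpha> * h^2"
  have k0: "k \<ge> 0" using alpha_h_powers by (simp add: k_def)
  define P where "P t = x t + (1 + \<alpha>^2 * h^2) * t + 5 * k * scaled_angle t + 2 * slope_moment t" for t
  have "\<exists>d. (P has_real_derivative d) (at t within {0..r}) \<and> d \<le> 44 * e" if t: "t \<in> {0..r}" for t
  proof -
    obtain p where p: "(scaled_angle has_real_derivative p) (at t within {0..r})" "\<bar>p + v t\<bar> \<le> 4 * m^2 * h"
      using scaled_angle_derivative[OF t] .
    obtain q where q: "(slope_moment has_real_derivative q) (at t within {0..r})"
      "q + (s t)^2 \<le> 2 * k * v t + 12 * e"
      using slope_moment_derivative[OF t] unfolding k_def e_def by (metis mult.assoc)
    have "(P has_real_derivative - (c t / A t) + (1 + \<alpha>^2 * h^2) + 5 * k * p + 2 * q) (at t within {0..r})"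
      unfolding P_def by (intro DERIV_add DERIV_cmult dx[OF t] linear_derivative p q)
    moreover have "- (c t / A t) + (1 + \<alpha>^2 * h^2) + 5 * k * p + 2 * q \<le> 44 * e"
    proof -
      have "1 - c t / A t = (\<alpha> * y t + (1 - c t)) / A t" using A_pos[OF t] by (simp add: field_simps)
      also have "\<dots> = \<alpha> * y t - \<alpha> * y t * (\<alpha> * y t) / A t + (1 - c t) / A t"
        using A_pos[OF t] quotient_split[of "\<alpha> * y t" "1 - c t"] by simp
      also have "\<dots> \<le> \<alpha> * y t + (1 - c t) / A t" using A_pos[OF t] by simp
      also have "(1 - c t) / A t \<le> 2 * (s t)^2"
      proof -
        have "1 - c t = (1 - c t) * 1" by simp
        also have "\<dots> \<le> (1 - c t) * (1 + c t)" 
          using ratio_bounds[OF t] cos_pos[OF t] by (intro mult_left_mono) auto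
        also have "\<dots> = (s t)^2" using sin_squared_eq[of "\<phi> t"] by (simp add: algebra_simps power2_eq_square)
        finally have 1: "1 - c t \<le> (s t)^2" .
        have "1 \<le> 2 * A t" using A_bounds(1)[OF t] by simp
        then have "(s t)^2 * 1 \<le> (s t)^2 * (2 * A t)" by (intro mult_left_mono) auto
        with 1 have "1 - c t \<le> 2 * (s t)^2 * A t" by (simp only: mult_ac)
        then show ?thesis using A_pos[OF t] by (simp only: pos_divide_le_eq)
      qed
      finally have "1 - c t / A t \<le> \<alpha> * y t + 2 * (s t)^2" by simp
      moreover have "\<alpha> * y t = k * v t - \<alpha>^2 * h^2" unfolding k_def by (rule alpha_y_eq)
      ultimately have "1 - c t / A t \<le> k * v t - \<alpha>^2 * h^2 + 2 * (s t)^2" by linarith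
      then have "- (c t / A t) + (1 + \<alpha>^2 * h^2) + 5 * k * p + 2 * q \<le> 5 * (k * (p + v t)) + 24 * e"
        using q(2) by (simp add: algebra_simps)
      also have "k * (p + v t) \<le> k * (4 * m^2 * h)" using p(2) k0 by (intro mult_left_mono) auto
      also have "\<dots> \<le> 4 * e" using alpha_h_powers by (simp add: k_def e_def)
      finally show ?thesis by simp
    qed
    ultimately show ?thesis by blast
  qed
  then have "P r - P 0 \<le> 44 * e * r" by (rule increment_le_rate)
  also have "\<dots> \<le> 44 * e * 1" using e0 r_le_1 by (intro mult_left_mono) auto
  finally have 1: "P r - P 0 \<le> 44 * e" by simp
  have "P r - P 0 = x r + r + \<alpha>^2 * h^2 * r + 5 * k * (scaled_angle r - scaled_angle 0)"
    using start return by (simp add: P_def slope_moment_def algebra_simps)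
  moreover have "k * (scaled_angle 0 - scaled_angle r) \<le> k * (2 * (4 * (m * h)))"
    using scaled_angle_bound[of 0] scaled_angle_bound[of r] r_pos k0 by (intro mult_left_mono) auto
  then have "k * (scaled_angle 0 - scaled_angle r) \<le> 8 * e" using alpha_h_powers by (simp add: k_def e_def)
  then have "5 * k * (scaled_angle r - scaled_angle 0) \<ge> - 40 * e" by (simp add: algebra_simps)
  ultimately show ?thesis using 1 by (simp add: e_def)
qed

text \<open>Here \<open>1 - cos \<phi> \<ge> 0\<close> has the favourable sign, so only the correction by \<open>A b \<phi>\<close> is present.\<close>

lemma endpoint_x_lower: "- 84 * (m * h)^3 \<le> x r + r + \<alpha>^2 * h^2 * r"
proof -
  define e where "e = (m * h)^3"
  have e0: "e \<ge> 0" using mh_small by (simp add: e_def)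
  define k where "k = \<alpha> * h^2"
  have k0: "k \<ge> 0" using alpha_h_powers by (simp add: k_def)
  define P where "P t = - x t + (- (1 + \<alpha>^2 * h^2)) * t + (- k) * scaled_angle t" for t
  have "\<exists>d. (P has_real_derivative d) (at t within {0..r}) \<and> d \<le> 6 * e" if t: "t \<in> {0..r}" for t
  proof -
    obtain p where p: "(scaled_angle has_real_derivative p) (at t within {0..r})" "\<bar>p + v t\<bar> \<le> 4 * m^2 * h"
      using scaled_angle_derivative[OF t] .
    have "(P has_real_derivative - (- (c t / A t)) + (- (1 + \<alpha>^2 * h^2)) + (- k) * p) (at t within {0..r})"
      unfolding P_def by (intro DERIV_add DERIV_minus DERIV_cmult dx[OF t] linear_derivative p)
    moreover have "- (- (c t / A t)) + (- (1 + \<alpha>^2 * h^2)) + (- k) * p \<le> 6 * e"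
    proof -
      have "c t / A t - 1 = - ((\<alpha> * y t + (1 - c t)) / A t)" using A_pos[OF t] by (simp add: field_simps)
      also have "\<dots> = - (\<alpha> * y t) + (\<alpha> * y t)^2 * (1 / A t) - (1 - c t) / A t"
        using A_pos[OF t] quotient_split[of "\<alpha> * y t" "1 - c t"] by (simp add: power2_eq_square)
      also have "\<dots> \<le> - (\<alpha> * y t) + (\<alpha> * y t)^2 * (1 / A t)" using A_pos[OF t] by simp
      also have "(\<alpha> * y t)^2 * (1 / A t) \<le> e * 2"
      proof (intro mult_mono)
        have "1 \<le> 2 * A t" using A_bounds(1)[OF t] by simp
        then show "1 / A t \<le> 2" using A_pos[OF t] by (simp only: pos_divide_le_eq)
      qed (use alpha_y_sq[OF t] e0 A_pos[OF t] in \<open>auto simp: e_def\<close>)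
      finally have "c t / A t - 1 \<le> - (\<alpha> * y t) + e * 2" by simp
      moreover have "\<alpha> * y t = k * v t - \<alpha>^2 * h^2" unfolding k_def by (rule alpha_y_eq)
      moreover have "k * (- (p + v t)) = - (k * p) - k * v t" by (simp add: algebra_simps)
      ultimately have "- (- (c t / A t)) + (- (1 + \<alpha>^2 * h^2)) + (- k) * p \<le> k * (- (p + v t)) + 2 * e"
        by linarith
      also have "k * (- (p + v t)) \<le> k * (4 * m^2 * h)" using p(2) k0 by (intro mult_left_mono) auto
      also have "\<dots> \<le> 4 * e" using alpha_h_powers by (simp add: k_def e_def)
      finally show ?thesis by simp
    qed
    ultimately show ?thesis by blast
  qed
  then have "P r - P 0 \<le> 6 * e * r" by (rule increment_le_rate)
  also have "\<dots> \<le> 6 * e * 1" using e0 r_le_1 by (intro mult_left_mono) auto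
  finally have 1: "P r - P 0 \<le> 6 * e" by simp
  have "P r - P 0 = - (x r + r + \<alpha>^2 * h^2 * r) + k * (scaled_angle 0 - scaled_angle r)"
    using start return by (simp add: P_def algebra_simps)
  moreover have "k * (scaled_angle r - scaled_angle 0) \<le> k * (2 * (4 * (m * h)))"
    using scaled_angle_bound[of 0] scaled_angle_bound[of r] r_pos k0 by (intro mult_left_mono) auto
  then have "k * (scaled_angle r - scaled_angle 0) \<le> 8 * e" using alpha_h_powers by (simp add: k_def e_def)
  then have "k * (scaled_angle 0 - scaled_angle r) \<ge> - 8 * e" by (simp add: algebra_simps)
  ultimately have "- 84 * e \<le> x r + r + \<alpha>^2 * h^2 * r" using 1 e0 by linarith
  then show ?thesis by (simp add: e_def)
qed

text \<open>To the order considered, \<open>z' = - y^2 / 2\<close>, and \<open>y = h^2 (v - \<alpha>)\<close>.\<close>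

lemma dz_approx:
  assumes t: "t \<in> {0..r}"
  shows "\<bar>(y t)^2 / 2 - (y t)^2 / 2 * (c t / A t)\<bar> \<le> h^2 * (m * h)^3 * 2"
    "(y t)^2 / 2 = h^4 * (\<alpha>^2 / 2 - \<alpha> * v t + (v t)^2 / 2)"
proof -
  have y2: "(y t)^2 \<le> (m * h^2)^2"
  proof -
    have "\<bar>y t\<bar> \<le> m * h^2" using abs_y[OF t] mult_right_mono[OF m_ge(2), of "h^2"] by simp
    then have "\<bar>y t\<bar>^2 \<le> (m * h^2)^2" by (intro power_mono) auto
    then show ?thesis by simp
  qed
  have "1 - c t / A t = (\<alpha> * y t + (1 - c t)) / A t" using A_pos[OF t] by (simp add: field_simps)
  moreover have "\<bar>\<alpha> * y t + (1 - c t)\<bar> \<le> (\<alpha> * (\<alpha> * h^2) + \<alpha>^2 * h^2)"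
  proof -
    have "\<bar>\<alpha> * y t\<bar> \<le> \<alpha> * (\<alpha> * h^2)" using abs_y[OF t] alpha_pos by (simp add: abs_mult)
    then show ?thesis using cos_deviation[OF t] ratio_bounds[OF t] by linarith
  qed
  then have "\<bar>\<alpha> * y t + (1 - c t)\<bar> \<le> 2 * (m^2 * h^2)"
    using mult_right_mono[of "\<alpha>^2" "m^2" "h^2"] power_mono[OF m_ge(2), of 2] alpha_pos
    by (simp add: power2_eq_square mult_ac)
  moreover have "2 * (m^2 * h^2) \<le> 4 * (m^2 * h^2) * A t"
  proof -
    have "1 \<le> 2 * A t" using A_bounds(1)[OF t] by simp
    then have "2 * (m^2 * h^2) * 1 \<le> 2 * (m^2 * h^2) * (2 * A t)" by (rule mult_left_mono) simp
    moreover have "2 * (m^2 * h^2) * (2 * A t) = 4 * (m^2 * h^2) * A t" by (simp add: algebra_simps)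
    ultimately show ?thesis by linarith
  qed
  ultimately have "1 - c t / A t = (\<alpha> * y t + (1 - c t)) / A t"
    "\<bar>\<alpha> * y t + (1 - c t)\<bar> \<le> 4 * (m^2 * h^2) * A t" by (simp_all only: order_trans)
  then have "\<bar>1 - c t / A t\<bar> \<le> 4 * (m^2 * h^2)"
    using A_pos[OF t] by (simp only: abs_divide abs_of_pos pos_divide_le_eq)
  then have "(y t)^2 / 2 * \<bar>1 - c t / A t\<bar> \<le> (m * h^2)^2 / 2 * (4 * (m^2 * h^2))"
    using y2 by (intro mult_mono) auto
  also have "\<dots> = 2 * h^2 * (m^4 * h^4)"
    by (simp add: power2_eq_square power4_eq_xxxx mult_ac)
  also have "\<dots> \<le> 2 * h^2 * (m * h)^3" using mh_powers(2) by (intro mult_left_mono) auto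
  also have "(y t)^2 / 2 * \<bar>1 - c t / A t\<bar> = \<bar>(y t)^2 / 2 * (1 - c t / A t)\<bar>" by (simp add: abs_mult)
  finally show "\<bar>(y t)^2 / 2 - (y t)^2 / 2 * (c t / A t)\<bar> \<le> h^2 * (m * h)^3 * 2"
    by (simp add: right_diff_distrib mult_ac)
  have "(y t)^2 = (h^2 * (lam * y t))^2"
    using arg_cong[OF y_eq[of t], of "\<lambda>w. w^2"] .
  moreover have "(h^2 * w)^2 / 2 = h^4 * (\<alpha>^2 / 2 - \<alpha> * (w + \<alpha>) + (w + \<alpha>)^2 / 2)" for w
    by (simp add: power2_eq_square power4_eq_xxxx algebra_simps)
  ultimately show "(y t)^2 / 2 = h^4 * (\<alpha>^2 / 2 - \<alpha> * v t + (v t)^2 / 2)"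
    by simp
qed

lemma endpoint_z: "\<bar>z r + \<alpha>^2 * h^4 * r / 2\<bar> \<le> 14 * h^2 * (m * h)^3"
proof -
  define e where "e = h^2 * (m * h)^3"
  have e0: "e \<ge> 0" using mh_small by (simp add: e_def)
  define k where "k = \<alpha> * h^4"
  have k0: "k \<ge> 0" using alpha_pos by (simp add: k_def)
  have ke: "k * (4 * m^2 * h) \<le> 4 * e" "k * (4 * (m * h)) \<le> 4 * e"
    using mult_left_mono[OF alpha_h_powers(1), of "h^2"] mult_left_mono[OF alpha_h_powers(2), of "h^2"]
    by (simp_all add: k_def e_def power4_eq_xxxx power2_eq_square mult_ac)
  define P where "P t = z t + (\<alpha>^2 * h^4 / 2) * t + k * scaled_angle t" for t
  have "\<exists>d. (P has_real_derivative d) (at t within {0..r}) \<and> d \<le> 6 * e" if t: "t \<in> {0..r}" for t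
  proof -
    obtain p where p: "(scaled_angle has_real_derivative p) (at t within {0..r})" "\<bar>p + v t\<bar> \<le> 4 * m^2 * h"
      using scaled_angle_derivative[OF t] .
    have "(P has_real_derivative - ((y t)^2 / 2 * (c t / A t)) + (\<alpha>^2 * h^4 / 2) + k * p) (at t within {0..r})"
      unfolding P_def by (intro DERIV_add DERIV_cmult dz[OF t] linear_derivative p)
    moreover have "- ((y t)^2 / 2 * (c t / A t)) + (\<alpha>^2 * h^4 / 2) + k * p \<le> 6 * e"
    proof -
      have "- ((y t)^2 / 2 * (c t / A t)) \<le> 2 * e - (y t)^2 / 2"
        using dz_approx(1)[OF t] unfolding e_def by linarith
      also have "\<dots> = 2 * e - \<alpha>^2 * h^4 / 2 + k * v t - h^4 * ((v t)^2 / 2)"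
        unfolding dz_approx(2)[OF t] k_def by (simp add: algebra_simps)
      also have "\<dots> \<le> 2 * e - \<alpha>^2 * h^4 / 2 + k * v t" by simp
      finally have "- ((y t)^2 / 2 * (c t / A t)) + (\<alpha>^2 * h^4 / 2) + k * p \<le> k * (p + v t) + 2 * e"
        by (simp add: algebra_simps)
      also have "k * (p + v t) \<le> k * (4 * m^2 * h)" using p(2) k0 by (intro mult_left_mono) auto
      finally show ?thesis using ke by simp
    qed
    ultimately show ?thesis by blast
  qed
  then have "P r - P 0 \<le> 6 * e * r" by (rule increment_le_rate)
  also have "\<dots> \<le> 6 * e * 1" using e0 r_le_1 by (intro mult_left_mono) auto
  finally have 1: "P r - P 0 \<le> 6 * e" by simp
  have "P r - P 0 = z r + \<alpha>^2 * h^4 * r / 2 + k * (scaled_angle r - scaled_angle 0)"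
    using start by (simp add: P_def algebra_simps)
  moreover have "k * (scaled_angle 0 - scaled_angle r) \<le> k * (2 * (4 * (m * h)))"
    using scaled_angle_bound[of 0] scaled_angle_bound[of r] r_pos k0 by (intro mult_left_mono) auto
  then have "k * (scaled_angle r - scaled_angle 0) \<ge> - 8 * e" using ke by (simp add: algebra_simps)
  ultimately have upper: "z r + \<alpha>^2 * h^4 * r / 2 \<le> 14 * e" using 1 by simp
  define Q where "Q t = - z t + (- (\<alpha>^2 * h^4 / 2)) * t" for t
  have "\<exists>d. (Q has_real_derivative d) (at t within {0..r}) \<and> d \<le> 2 * e" if t: "t \<in> {0..r}" for t
  proof -
    have "(Q has_real_derivative - (- ((y t)^2 / 2 * (c t / A t))) + (- (\<alpha>^2 * h^4 / 2))) (at t within {0..r})"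
      unfolding Q_def by (intro DERIV_add DERIV_minus DERIV_cmult dz[OF t] linear_derivative)
    moreover have "- (- ((y t)^2 / 2 * (c t / A t))) + (- (\<alpha>^2 * h^4 / 2)) \<le> 2 * e"
    proof -
      have "v t * v t \<le> \<alpha> * v t" using v_bounds[OF t] by (intro mult_right_mono)
      moreover have "0 \<le> \<alpha> * v t" using v_bounds[OF t] alpha_pos by simp
      ultimately have "\<alpha>^2 / 2 - \<alpha> * v t + (v t)^2 / 2 \<le> \<alpha>^2 / 2" unfolding power2_eq_square[of "v t"] by linarith
      then have "(y t)^2 / 2 \<le> h^4 * (\<alpha>^2 / 2)"
        unfolding dz_approx(2)[OF t] by (intro mult_left_mono) auto
      then show ?thesis using dz_approx(1)[OF t] by (simp add: e_def mult_ac)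
    qed
    ultimately show ?thesis by blast
  qed
  then have "Q r - Q 0 \<le> 2 * e * r" by (rule increment_le_rate)
  also have "\<dots> \<le> 2 * e * 1" using e0 r_le_1 by (intro mult_left_mono) auto
  finally have "Q r - Q 0 \<le> 2 * e" by simp
  then have "- (z r + \<alpha>^2 * h^4 * r / 2) \<le> 2 * e"
    using start by (simp add: Q_def algebra_simps)
  with upper e0 have "\<bar>z r + \<alpha>^2 * h^4 * r / 2\<bar> \<le> 14 * e" by linarith
  then show ?thesis by (simp add: e_def mult_ac)
qed

end

section \<open>Geodesics with the same length and the same abscissa end at the same height\<close>

text \<open>Compares two curves at points with equal abscissa, by the inverse function of \<open>f2\<close> applied to
  \<open>f1\<close>.\<close>

lemma matching_reparametrization:
  fixes f1 f2 u1 u2 :: "real \<Rightarrow> real"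
  assumes r: "r > 0"
    and f1: "\<And>t. t \<in> {0..r} \<Longrightarrow> (f1 has_real_derivative u1 t) (at t within {0..r})" "\<And>t. t \<in> {0..r} \<Longrightarrow> u1 t > 0"
    and f2: "\<And>t. t \<in> {0..r} \<Longrightarrow> (f2 has_real_derivative u2 t) (at t within {0..r})" "\<And>t. t \<in> {0..r} \<Longrightarrow> u2 t > 0"
    and ends: "f1 0 = f2 0" "f1 r = f2 r"
  obtains g where "g 0 = 0" "g r = r" "continuous_on {0..r} g"
    "\<And>t. t \<in> {0..r} \<Longrightarrow> g t \<in> {0..r} \<and> f2 (g t) = f1 t"
    "\<And>t. t \<in> {0<..<r} \<Longrightarrow> g t \<in> {0<..<r} \<and> (g has_real_derivative u1 t / u2 (g t)) (at t)"
proof -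
  have mono: "f s < f t" if fd: "\<And>t. t \<in> {0..r} \<Longrightarrow> (f has_real_derivative u t) (at t within {0..r})"
      "\<And>t. t \<in> {0..r} \<Longrightarrow> u t > 0" and st: "0 \<le> s" "s < t" "t \<le> r" for f u :: "real \<Rightarrow> real" and s t
  proof (rule DERIV_pos_imp_increasing_open[OF st(2)])
    show "\<exists>y. (f has_real_derivative y) (at w) \<and> y > 0" if "s < w" "w < t" for w
      using fd[of w] that st at_within_Icc_at[of 0 w r] by auto
    show "continuous_on {s..t} f"
      by (rule continuous_on_subset[OF DERIV_continuous_on[OF fd(1)]]) (use st in auto)
  qed
  note mono1 = mono[OF f1] and mono2 = mono[OF f2]
  have c1: "continuous_on {0..r} f1" and c2: "continuous_on {0..r} f2"
    by (auto intro: DERIV_continuous_on[OF f1(1)] DERIV_continuous_on[OF f2(1)])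
  have inj: "inj_on f2 {0..r}"
    by (rule linorder_inj_onI) (use mono2 in \<open>auto simp: less_imp_neq\<close>)
  define i2 where "i2 = the_inv_into {0..r} f2"
  have i2: "i2 (f2 t) = t" if "t \<in> {0..r}" for t
    using the_inv_into_f_f[OF inj that] by (simp add: i2_def)
  have i2c: "continuous_on (f2 ` {0..r}) i2"
    by (rule continuous_on_inv[OF c2]) (auto simp: i2)
  have range: "f1 t \<in> f2 ` {0..r}" if t: "t \<in> {0..r}" for t
  proof -
    have "f1 0 \<le> f1 t" "f1 t \<le> f1 r"
      using mono1[of 0 t] mono1[of t r] t by (cases "t = 0"; cases "t = r"; auto)+
    then obtain w where "0 \<le> w" "w \<le> r" "f2 w = f1 t"
      using IVT'[of f2 0 "f1 t" r] c2 ends r by auto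
    then show ?thesis by (metis atLeastAtMost_iff imageI)
  qed
  define g where "g t = i2 (f1 t)" for t
  have g: "g t \<in> {0..r} \<and> f2 (g t) = f1 t" if "t \<in> {0..r}" for t
    using range[OF that] i2 by (auto simp: g_def)
  have g0: "g 0 = 0" and gr: "g r = r" using i2[of 0] i2[of r] ends r by (auto simp: g_def)
  have gc: "continuous_on {0..r} g"
    unfolding g_def
    by (rule continuous_on_compose2[OF i2c c1]) (use range in auto)
  have gi: "g t \<in> {0<..<r} \<and> (g has_real_derivative u1 t / u2 (g t)) (at t)" if t: "t \<in> {0<..<r}" for t
  proof -
    have tr: "t \<in> {0..r}" using t by auto
    have "f1 0 < f1 t" "f1 t < f1 r" using mono1 t by auto
    then have "g t \<noteq> 0" "g t \<noteq> r" using g[OF tr] ends by auto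
    with g[OF tr] have gt: "g t \<in> {0<..<r}" by auto
    have fd: "(f2 has_real_derivative u2 (g t)) (at (i2 (f1 t)))"
      using f2(1)[of "g t"] gt at_within_Icc_at[of 0 "g t" r] by (auto simp: g_def)
    have inv: "f2 (i2 w) = w" if w: "f2 0 < w" "w < f2 r" for w
    proof -
      obtain q where "0 \<le> q" "q \<le> r" "f2 q = w"
        using IVT'[OF less_imp_le[OF w(1)] less_imp_le[OF w(2)] less_imp_le[OF r] c2] by blast
      then show ?thesis using i2[of q] by auto
    qed
    have ic: "isCont i2 (f1 t)"
    proof -
      have "{f2 0<..<f2 r} \<subseteq> f2 ` {0..r}"
      proof
        fix w assume w: "w \<in> {f2 0<..<f2 r}"
        then obtain q where "0 \<le> q" "q \<le> r" "f2 q = w" using IVT'[of f2 0 w r] c2 r by fastforce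
        then show "w \<in> f2 ` {0..r}" by auto
      qed
      then have "continuous_on {f2 0<..<f2 r} i2" using i2c continuous_on_subset by blast
      moreover have "f1 t \<in> {f2 0<..<f2 r}" using \<open>f1 0 < f1 t\<close> \<open>f1 t < f1 r\<close> ends by auto
      ultimately show ?thesis by (simp add: continuous_on_eq_continuous_at)
    qed
    have "(i2 has_real_derivative inverse (u2 (g t))) (at (f1 t))"
      by (rule DERIV_inverse_function[OF fd _ _ _ inv ic])
         (use f2(2)[of "g t"] gt \<open>f1 0 < f1 t\<close> \<open>f1 t < f1 r\<close> ends in auto)
    moreover have "(f1 has_real_derivative u1 t) (at t)"
      using f1(1)[OF tr] t at_within_Icc_at[of 0 t r] by auto
    ultimately have "(g has_real_derivative inverse (u2 (g t)) * u1 t) (at t)"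
      unfolding g_def using DERIV_chain2 by blast
    then show ?thesis using gt by (simp add: divide_inverse mult.commute)
  qed
  show thesis by (rule that[OF g0 gr gc g gi])
qed

text \<open>The excess of the integrand \<open>y^2 / 2 + \<mu> sqrt (A^2 + (b y')^2)\<close> at the second curve over its first order
  expansion in \<open>(y, y')\<close> at the first curve, where \<open>d = y2 - y1\<close> and \<open>y'\<close> is expressed by the angle as \<open>- (A / b) tan \<phi>\<close>.  For \<open>\<gamma> = 0\<close> the length integrand is the norm of an affine function of \<open>(y, y')\<close>, hence
  convex, and its excess is \<open>(A2 / cos \<phi>2) (1 - cos (\<phi>2 - \<phi>1))\<close>.  For \<open>\<gamma> \<noteq> 0\<close> the product \<open>\<gamma> y y'\<close> adds a mixed
  term, which is absorbed by that excess and by the quadratic term \<open>d^2 / 2\<close> when \<open>\<mu>\<close> is small.\<close>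

lemma excess_nonneg:
  fixes \<alpha> \<gamma> m \<mu> d A1 A2 b1 b2 c1 c2 s1 s2 :: real
  assumes al: "\<bar>\<alpha>\<bar> \<le> m" and ga: "\<bar>\<gamma>\<bar> \<le> m" and m: "1 \<le> m" and mu: "0 \<le> \<mu>" "144 * (m^2 * \<mu>) \<le> 1"
    and A: "1/2 \<le> A1" "A1 \<le> 1" "1/2 \<le> A2" "A2 \<le> 1" and A2: "A2 = A1 + \<alpha> * d"
    and b: "7/8 \<le> b1" "b1 \<le> 9/8" "7/8 \<le> b2" and b2: "b2 = b1 + \<gamma> * d"
    and c: "1/2 \<le> c1" "1/2 \<le> c2" and cs: "s1^2 + c1^2 = 1" "s2^2 + c2^2 = 1"
  shows "0 \<le> d^2 / 2 + \<mu> * (A2 / c2 * (1 - (c1 * c2 + s1 * s2)) -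
           \<gamma> * s1 * d * (- (A2 / b2 * (s2 / c2)) - - (A1 / b1 * (s1 / c1))))"
proof -
  \<comment> \<open>\<open>\<sigma>\<close> and \<open>C\<close> are the sine and cosine of the difference of the two angles.\<close>
  define \<sigma> where "\<sigma> = s2 * c1 - c2 * s1"
  define C where "C = c1 * c2 + s1 * s2"
  have sC: "\<sigma>^2 + C^2 = 1" using cs unfolding \<sigma>_def C_def by algebra
  then have "C^2 \<le> 1" using zero_le_power2[of \<sigma>] by linarith
  then have C1: "\<bar>C\<bar> \<le> 1" by (simp add: abs_square_le_1)
  have "\<sigma>^2 = (1 - C) * (1 + C)" using sC by (simp add: algebra_simps power2_eq_square)
  also have "\<dots> \<le> (1 - C) * 2" using C1 by (intro mult_left_mono) auto
  finally have sC2: "\<sigma>^2 / 2 \<le> 1 - C" by simp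
  have "c2^2 \<le> 1" "s1^2 \<le> 1" using cs zero_le_power2[of c1] zero_le_power2[of s2] by linarith+
  then have c21: "c2 \<le> 1" "\<bar>s1\<bar> \<le> 1" by (simp_all add: abs_square_le_1)
  have "1/2 * 1 \<le> A2 * (1 / c2)" using A c c21 by (intro mult_mono) auto
  then have "1/2 * (\<sigma>^2 / 2) \<le> A2 / c2 * (1 - C)"
    using sC2 C1 A c by (intro mult_mono) auto
  then have gain: "\<sigma>^2 / 4 \<le> A2 / c2 * (1 - C)" by simp
  have tan_diff: "\<bar>s2 / c2 - s1 / c1\<bar> \<le> 4 * \<bar>\<sigma>\<bar>"
  proof -
    have "s2 / c2 - s1 / c1 = \<sigma> * (1 / (c1 * c2))" using c by (simp add: \<sigma>_def field_simps)
    moreover have "1/2 * (1/2) \<le> c1 * c2" using c by (intro mult_mono) auto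
    then have "\<bar>1 / (c1 * c2)\<bar> \<le> 4" by (simp add: abs_divide divide_le_eq)
    then have "\<bar>\<sigma>\<bar> * \<bar>1 / (c1 * c2)\<bar> \<le> \<bar>\<sigma>\<bar> * 4" by (rule mult_left_mono) simp
    ultimately show ?thesis by (simp add: abs_mult)
  qed
  have t1: "\<bar>s1 / c1\<bar> \<le> 2" using c c21 by (simp add: abs_divide divide_le_eq)
  have r2: "\<bar>A2 / b2\<bar> \<le> 2" using A b by (simp add: abs_divide divide_le_eq)
  have ratio_diff: "\<bar>A2 / b2 - A1 / b1\<bar> \<le> 4 * m * \<bar>d\<bar>"
  proof -
    have "A2 / b2 - A1 / b1 = (d * (\<alpha> * b1 - \<gamma> * A1)) * (1 / (b1 * b2))"
    proof -
      have "A2 / b2 - A1 / b1 = (A2 * b1 - A1 * b2) / (b1 * b2)" using b by (simp add: diff_frac_eq mult.commute)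
      moreover have "A2 * b1 - A1 * b2 = d * (\<alpha> * b1 - \<gamma> * A1)"
        unfolding A2 b2 by (simp add: algebra_simps)
      ultimately show ?thesis by simp
    qed
    moreover have "7/8 * (7/8) \<le> b1 * b2" using b by (intro mult_mono) auto
    then have "\<bar>1 / (b1 * b2)\<bar> \<le> 64/49" by (simp add: divide_le_eq)
    moreover have "\<bar>\<alpha> * b1\<bar> \<le> m * (9/8)" "\<bar>\<gamma> * A1\<bar> \<le> m * 1"
      unfolding abs_mult using al ga A b m by (intro mult_mono; simp)+
    then have "\<bar>\<alpha> * b1 - \<gamma> * A1\<bar> \<le> m * (17/8)" by linarith
    then have "\<bar>d * (\<alpha> * b1 - \<gamma> * A1)\<bar> \<le> \<bar>d\<bar> * (m * (17/8))"
      unfolding abs_mult by (rule mult_left_mono) simp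
    then have "\<bar>d * (\<alpha> * b1 - \<gamma> * A1)\<bar> * \<bar>1 / (b1 * b2)\<bar> \<le> (\<bar>d\<bar> * (m * (17/8))) * (64/49)"
      using m \<open>\<bar>1 / (b1 * b2)\<bar> \<le> 64/49\<close> by (intro mult_mono) auto
    ultimately have "\<bar>A2 / b2 - A1 / b1\<bar> \<le> (\<bar>d\<bar> * (m * (17/8))) * (64/49)"
      by (metis abs_mult)
    moreover have "0 \<le> m * \<bar>d\<bar>" using m by simp
    ultimately show ?thesis by (simp add: mult_ac)
  qed
  define q where "q = - (A2 / b2 * (s2 / c2)) - - (A1 / b1 * (s1 / c1))"
  have "q = - (A2 / b2 * (s2 / c2 - s1 / c1) + (A2 / b2 - A1 / b1) * (s1 / c1))"
    by (simp add: q_def algebra_simps)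
  then have "\<bar>q\<bar> = \<bar>A2 / b2 * (s2 / c2 - s1 / c1) + (A2 / b2 - A1 / b1) * (s1 / c1)\<bar>"
    by (metis abs_minus_cancel)
  also have "\<dots> \<le> \<bar>A2 / b2 * (s2 / c2 - s1 / c1)\<bar> + \<bar>(A2 / b2 - A1 / b1) * (s1 / c1)\<bar>"
    by (rule abs_triangle_ineq)
  also have "\<dots> \<le> 2 * (4 * \<bar>\<sigma>\<bar>) + (4 * m * \<bar>d\<bar>) * 2"
    unfolding abs_mult using tan_diff t1 r2 ratio_diff m
    by (intro add_mono mult_mono) auto
  finally have q: "\<bar>q\<bar> \<le> 8 * \<bar>\<sigma>\<bar> + 8 * m * \<bar>d\<bar>" by simp
  have "\<bar>\<gamma> * s1 * d\<bar> \<le> m * 1 * \<bar>d\<bar>" unfolding abs_mult using ga c21 by (intro mult_mono) auto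
  then have "\<bar>\<gamma> * s1 * d * q\<bar> \<le> (m * 1 * \<bar>d\<bar>) * (8 * \<bar>\<sigma>\<bar> + 8 * m * \<bar>d\<bar>)"
    unfolding abs_mult[of "\<gamma> * s1 * d"] using q m by (intro mult_mono) auto
  then have "\<gamma> * s1 * d * q \<le> 8 * m * \<bar>d\<bar> * \<bar>\<sigma>\<bar> + 8 * m^2 * d^2"
  proof -
    have "(m * 1 * a) * (8 * \<bar>\<sigma>\<bar> + 8 * m * a) = 8 * m * a * \<bar>\<sigma>\<bar> + 8 * m^2 * a^2" for a
      by (simp add: algebra_simps power2_eq_square)
    from this[of "\<bar>d\<bar>"] show ?thesis
      using \<open>\<bar>\<gamma> * s1 * d * q\<bar> \<le> (m * 1 * \<bar>d\<bar>) * (8 * \<bar>\<sigma>\<bar> + 8 * m * \<bar>d\<bar>)\<close> by (simp add: abs_le_iff)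
  qed
  also have "8 * m * \<bar>d\<bar> * \<bar>\<sigma>\<bar> \<le> \<sigma>^2 / 4 + 64 * m^2 * d^2"
  proof -
    \<comment> \<open>Young inequality with the part \<open>\<sigma>^2 / 4\<close> that the gain can pay for.\<close>
    have "0 \<le> (\<bar>\<sigma>\<bar> / 2 - 8 * (m * \<bar>d\<bar>))^2" by simp
    then show ?thesis by (simp add: power2_diff power_divide power_mult_distrib algebra_simps)
  qed
  finally have "A2 / c2 * (1 - C) - \<gamma> * s1 * d * q \<ge> - 72 * m^2 * d^2" using gain by linarith
  then have "\<mu> * (- 72 * m^2 * d^2) \<le> \<mu> * (A2 / c2 * (1 - C) - \<gamma> * s1 * d * q)" using mu by (intro mult_left_mono) auto
  moreover have "144 * (m^2 * \<mu>) * d^2 \<le> 1 * d^2" using mu by (intro mult_right_mono) auto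
  then have "d^2 / 2 + \<mu> * (- 72 * m^2 * d^2) \<ge> 0" by (simp add: algebra_simps)
  ultimately show ?thesis unfolding q_def[symmetric] C_def[symmetric] by linarith
qed

text \<open>On the left the derivative of the comparison function of \<open>endpoint_z_le\<close> as the chain rule produces it,
  on the right the excess times the speed \<open>k\<close> of the abscissa.  The Euler-Lagrange equation of the
  first geodesic is what makes the terms linear in \<open>y2 - y1\<close> cancel, through \<open>\<mu> lam = 1\<close>.\<close>

lemma comparison_derivative_algebra:
  fixes A1 A2 b1 b2 c1 c2 s1 s2 :: real
  assumes nz: "A1 \<noteq> 0" "A2 \<noteq> 0" "b1 \<noteq> 0" "b2 \<noteq> 0" "c1 \<noteq> 0" "c2 \<noteq> 0"
    and cs: "s1^2 + c1^2 = 1" and ml: "\<mu> * lam = 1"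
    and A2: "A2 = A1 + \<alpha> * (y2 - y1)" and b2: "b2 = b1 + \<gamma> * (y2 - y1)"
  defines "k \<equiv> c1 / A1"
  defines "g' \<equiv> k / (c2 / A2)"
  shows "(y2^2 / 2 * (c2 / A2)) * g' + (- (y1^2 / 2 * (c1 / A1))) + \<mu> * (g' - 1)
      + (\<mu> * (((- (\<beta> * (c1 / A1)) - \<gamma> * (s1 / b1)) * s1 +
           (c1 * - ((lam * y1 + \<alpha> * c1 - \<beta> * s1) / (A1 * b1))) * b1) * (y2 - y1)
         + (- (s2 / b2) * g' - - (s1 / b1)) * (b1 * s1)))
    = k * ((y2 - y1)^2 / 2 + \<mu> * (A2 / c2 * (1 - (c1 * c2 + s1 * s2)) -
           \<gamma> * s1 * (y2 - y1) * (- (A2 / b2 * (s2 / c2)) - - (A1 / b1 * (s1 / c1)))))"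
proof -
  \<comment> \<open>\<open>T\<close> is the length per unit of abscissa and \<open>p\<close> the slope of the graph.\<close>
  define T1 where "T1 = A1 / c1"
  define T2 where "T2 = A2 / c2"
  define p1 where "p1 = - (A1 / b1 * (s1 / c1))"
  define p2 where "p2 = - (A2 / b2 * (s2 / c2))"
  have k: "k * T1 = 1" "k * A1 = c1" using nz by (simp_all add: k_def T1_def)
  have T: "T1 * c1 = A1" "T2 * c2 = A2" using nz by (simp_all add: T1_def T2_def)
  have p: "b1 * p1 = - T1 * s1" "b2 * p2 = - T2 * s2" using nz by (simp_all add: p1_def p2_def T1_def T2_def)
  have g': "g' = k * T2" using nz by (simp add: g'_def T2_def)
  have 1: "(y2^2 / 2 * (c2 / A2)) * g' = y2^2 / 2 * k" using nz by (simp add: g'_def)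
  have 2: "- (s2 / b2) * g' = k * p2" using nz by (simp add: g' T2_def p2_def)
  have 3: "- (s1 / b1) = k * p1" using nz by (simp add: k_def p1_def)
  have 4: "(- (\<beta> * (c1 / A1)) - \<gamma> * (s1 / b1)) * s1 + (c1 * - ((lam * y1 + \<alpha> * c1 - \<beta> * s1) / (A1 * b1))) * b1
     = k * (\<gamma> * s1 * p1 - lam * y1 - \<alpha> * c1)"
    using nz by (simp add: k_def p1_def field_simps)
  have 5: "(T2 - T1) + (\<gamma> * s1 * p1 - \<alpha> * c1) * (y2 - y1) + b1 * s1 * (p2 - p1)
     = T2 * (1 - (c1 * c2 + s1 * s2)) - \<gamma> * s1 * (y2 - y1) * (p2 - p1)"
  proof -
    have "T1 + b1 * s1 * p1 = T1 * (s1^2 + c1^2) + (b1 * p1) * s1" unfolding cs by simp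
    also have "\<dots> = (T1 * c1) * c1" unfolding p by (simp add: power2_eq_square algebra_simps)
    finally have e1: "T1 + b1 * s1 * p1 = A1 * c1" unfolding T .
    have e2: "T2 * (c1 * c2) = A1 * c1 + \<alpha> * (y2 - y1) * c1"
      using arg_cong[OF T(2), of "\<lambda>w. w * c1"] unfolding A2 by (simp add: algebra_simps)
    have e3: "T2 * (s1 * s2) = - (b1 * s1 * p2) - \<gamma> * (y2 - y1) * p2 * s1"
      using arg_cong[OF p(2), of "\<lambda>w. - w * s1"] unfolding b2 by (simp add: algebra_simps)
    have "T2 * (1 - (c1 * c2 + s1 * s2)) = T2 - T2 * (c1 * c2) - T2 * (s1 * s2)" by (simp add: algebra_simps)
    then show ?thesis unfolding e2 e3 using e1 by (simp add: algebra_simps)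
  qed
  have "y2^2 / 2 * k + (- (y1^2 / 2 * k)) + \<mu> * (k * T2 - 1)
      + (\<mu> * (k * (\<gamma> * s1 * p1 - lam * y1 - \<alpha> * c1) * (y2 - y1) + (k * p2 - k * p1) * (b1 * s1)))
     = k * ((y2 - y1)^2 / 2 + \<mu> * ((T2 - T1) + (\<gamma> * s1 * p1 - \<alpha> * c1) * (y2 - y1) + b1 * s1 * (p2 - p1)))"
  proof -
    have "k * ((y2 - y1)^2 / 2) = y2^2 / 2 * k + (- (y1^2 / 2 * k)) - k * (\<mu> * lam * y1 * (y2 - y1))"
      unfolding ml by (simp add: power2_eq_square add_divide_distrib diff_divide_distrib algebra_simps)
    moreover have "\<mu> * (k * T2 - 1) = k * (\<mu> * (T2 - T1))" using k(1) by (simp add: algebra_simps)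
    ultimately show ?thesis by (simp add: algebra_simps)
  qed
  then show ?thesis
    unfolding 1 2 3 4 unfolding g' unfolding 5 
    by (simp only: k_def[symmetric] T2_def[symmetric] p1_def[symmetric] p2_def[symmetric])
qed


text \<open>The function \<open>D\<close> is the difference of the functionals \<open>- z + h1^2 t\<close> of the two curves, accumulated up to equal
  abscissa, minus the conjugate momentum \<open>- h1^2 b sin \<phi>1\<close> times \<open>y2 - y1\<close>.  Its derivative is the excess, so \<open>D\<close>
  increases; at the end the lengths agree and \<open>y1 = y2 = 0\<close>, so that only the heights remain.\<close>

lemma endpoint_z_le:
  assumes "thin_geodesic \<alpha> \<beta> \<gamma> r lam1 x1 y1 z1 \<phi>1 m h1"
    and "thin_geodesic \<alpha> \<beta> \<gamma> r lam2 x2 y2 z2 \<phi>2 m h2"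
    and xr: "x1 r = x2 r"
  shows "z2 r \<le> z1 r"
proof -
  interpret G1: thin_geodesic \<alpha> \<beta> \<gamma> r lam1 x1 y1 z1 \<phi>1 m h1 by fact
  interpret G2: thin_geodesic \<alpha> \<beta> \<gamma> r lam2 x2 y2 z2 \<phi>2 m h2 by fact
  have d1: "((\<lambda>t. - x1 t) has_real_derivative cos (\<phi>1 t) / G1.A t) (at t within {0..r})"
    and d2: "((\<lambda>t. - x2 t) has_real_derivative cos (\<phi>2 t) / G2.A t) (at t within {0..r})"
    and p1: "cos (\<phi>1 t) / G1.A t > 0" and p2: "cos (\<phi>2 t) / G2.A t > 0"
    if "t \<in> {0..r}" for t
    using DERIV_minus[OF G1.dx[OF that]] DERIV_minus[OF G2.dx[OF that]]
      G1.A_pos[OF that] G2.A_pos[OF that] G1.cos_pos[OF that] G2.cos_pos[OF that]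
    by (auto intro!: divide_pos_pos)
  obtain g where g0: "g 0 = 0" and gr: "g r = r" and gc: "continuous_on {0..r} g"
    and gx: "\<And>t. t \<in> {0..r} \<Longrightarrow> g t \<in> {0..r} \<and> - x2 (g t) = - x1 t"
    and gd: "\<And>t. t \<in> {0<..<r} \<Longrightarrow> g t \<in> {0<..<r} \<and>
      (g has_real_derivative (cos (\<phi>1 t) / G1.A t) / (cos (\<phi>2 (g t)) / G2.A (g t))) (at t)"
    using matching_reparametrization[OF G1.r_pos d1 p1 d2 p2] G1.start G2.start xr by auto
  define D where "D t = - z2 (g t) + z1 t + h1^2 * (g t - t)
    + h1^2 * ((G1.b t * sin (\<phi>1 t)) * (y2 (g t) - y1 t))" for t
  have "D 0 \<le> D r"
  proof (rule DERIV_nonneg_imp_increasing_open[of 0 r D])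
    show "0 \<le> r" using G1.r_pos by simp
    have g_in: "g ` {0..r} \<subseteq> {0..r}" using gx by auto
    show "continuous_on {0..r} D"
      unfolding D_def
      by (intro continuous_intros G1.cont gc continuous_on_compose2[OF G2.cont(3) gc g_in]
          continuous_on_compose2[OF G2.cont(2) gc g_in])
    fix t assume t: "0 < t" "t < r"
    then have tr: "t \<in> {0..r}" by auto
    define w where "w = g t"
    have w: "w \<in> {0<..<r}" and wr: "w \<in> {0..r}" using gd[of t] t by (auto simp: w_def)
    have inner1: "at t within {0..r} = at t" and inner2: "at w within {0..r} = at w"
      using t w by (auto intro: at_within_Icc_at)
    define A1 A2 b1 b2 c1 c2 s1 s2 where defs: "A1 = G1.A t" "A2 = G2.A w" "b1 = G1.b t" "b2 = G2.b w"
      "c1 = cos (\<phi>1 t)" "c2 = cos (\<phi>2 w)" "s1 = sin (\<phi>1 t)" "s2 = sin (\<phi>2 w)"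
    define g' where "g' = (c1 / A1) / (c2 / A2)"
    have dg: "(g has_real_derivative g') (at t)"
      using gd[of t] t by (simp add: g'_def defs w_def)
    have dz2: "((\<lambda>t. z2 (g t)) has_real_derivative - ((y2 w)^2 / 2 * (c2 / A2)) * g') (at t)"
      using DERIV_chain2[OF G2.dz[OF wr, unfolded inner2, unfolded w_def] dg] by (simp add: defs w_def)
    have dy2: "((\<lambda>t. y2 (g t)) has_real_derivative - (s2 / b2) * g') (at t)"
      using DERIV_chain2[OF G2.dy[OF wr, unfolded inner2, unfolded w_def] dg] by (simp add: defs w_def)
    have dz1: "(z1 has_real_derivative - ((y1 t)^2 / 2 * (c1 / A1))) (at t)"
      using G1.dz[OF tr, unfolded inner1] by (simp add: defs)
    have dy1: "(y1 has_real_derivative - (s1 / b1)) (at t)"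
      using G1.dy[OF tr, unfolded inner1] by (simp add: defs)
    have db1: "(G1.b has_real_derivative - (\<beta> * (c1 / A1)) - \<gamma> * (s1 / b1)) (at t)"
      using G1.b_derivative[OF tr, unfolded inner1] by (simp add: defs)
    have dsin: "((\<lambda>t. sin (\<phi>1 t)) has_real_derivative
        c1 * - ((lam1 * y1 t + \<alpha> * c1 - \<beta> * s1) / (A1 * b1))) (at t)"
      using DERIV_chain2[OF DERIV_sin G1.dphi[OF tr, unfolded inner1]] by (simp add: defs)
    have dbs: "((\<lambda>t. G1.b t * sin (\<phi>1 t)) has_real_derivative
        (- (\<beta> * (c1 / A1)) - \<gamma> * (s1 / b1)) * s1 +
           (c1 * - ((lam1 * y1 t + \<alpha> * c1 - \<beta> * s1) / (A1 * b1))) * b1) (at t)"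
      using DERIV_mult[OF db1 dsin] by (simp add: defs)
    have dprod: "((\<lambda>t. (G1.b t * sin (\<phi>1 t)) * (y2 (g t) - y1 t)) has_real_derivative
        ((- (\<beta> * (c1 / A1)) - \<gamma> * (s1 / b1)) * s1 +
           (c1 * - ((lam1 * y1 t + \<alpha> * c1 - \<beta> * s1) / (A1 * b1))) * b1) * (y2 w - y1 t)
         + (- (s2 / b2) * g' - - (s1 / b1)) * (b1 * s1)) (at t)"
      using DERIV_mult[OF dbs DERIV_diff[OF dy2 dy1]] by (simp only: defs w_def)
    have dD: "(D has_real_derivative
        - (- ((y2 w)^2 / 2 * (c2 / A2)) * g') + (- ((y1 t)^2 / 2 * (c1 / A1))) + h1^2 * (g' - 1)
      + h1^2 * (((- (\<beta> * (c1 / A1)) - \<gamma> * (s1 / b1)) * s1 +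
           (c1 * - ((lam1 * y1 t + \<alpha> * c1 - \<beta> * s1) / (A1 * b1))) * b1) * (y2 w - y1 t)
         + (- (s2 / b2) * g' - - (s1 / b1)) * (b1 * s1))) (at t)"
      unfolding D_def
      by (intro DERIV_add DERIV_minus DERIV_cmult DERIV_diff dz2 dz1 dg dprod DERIV_ident)
    have nz: "A1 \<noteq> 0" "A2 \<noteq> 0" "b1 \<noteq> 0" "b2 \<noteq> 0" "c1 \<noteq> 0" "c2 \<noteq> 0"
      using G1.A_pos[OF tr] G2.A_pos[OF wr] G1.b_pos[OF tr] G2.b_pos[OF wr] G1.cos_pos[OF tr] G2.cos_pos[OF wr]
      by (auto simp: defs)
    have cs: "s1^2 + c1^2 = 1" "s2^2 + c2^2 = 1" by (simp_all add: defs)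
    have A2: "A2 = A1 + \<alpha> * (y2 w - y1 t)" by (simp add: defs algebra_simps)
    have "x2 w = x1 t" using gx[OF tr] by (simp add: w_def)
    then have b2: "b2 = b1 + \<gamma> * (y2 w - y1 t)" by (simp add: defs algebra_simps)
    have mu: "h1^2 * lam1 = 1" using G1.lam_h by (simp add: mult.commute)
    have "144 * (m^2 * h1^2) = (12 * m * h1)^2" by (simp add: power_mult_distrib)
    also have "\<dots> \<le> 1" using G1.h_small G1.mh_small by (intro power_le_one) (auto simp: mult.assoc)
    finally have mu2: "144 * (m^2 * h1^2) \<le> 1" .
    have "0 \<le> (y2 w - y1 t)^2 / 2 + h1^2 * (A2 / c2 * (1 - (c1 * c2 + s1 * s2)) -
           \<gamma> * s1 * (y2 w - y1 t) * (- (A2 / b2 * (s2 / c2)) - - (A1 / b1 * (s1 / c1))))"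
    proof (rule excess_nonneg[of \<alpha> m \<gamma> "h1^2" A1 A2 "y2 w - y1 t" b1 b2 c1 c2 s1 s2])
      show "\<bar>\<alpha>\<bar> \<le> m" "\<bar>\<gamma>\<bar> \<le> m" "1 \<le> m" using G1.m_ge G1.alpha_pos by auto
      show "1/2 \<le> A1" "A1 \<le> 1" "1/2 \<le> A2" "A2 \<le> 1"
        using G1.A_bounds[OF tr] G2.A_bounds[OF wr] by (simp_all add: defs)
      show "7/8 \<le> b1" "b1 \<le> 9/8" "7/8 \<le> b2"
        using G1.b_bounds[OF tr] G2.b_bounds[OF wr] unfolding defs by blast+
      show "1/2 \<le> c1" "1/2 \<le> c2"
        using G1.cos_pos[OF tr] G2.cos_pos[OF wr] unfolding defs by blast+
    qed (use mu2 A2 b2 cs in auto)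
    moreover have "0 \<le> c1 / A1" using p1[OF tr] by (simp add: defs)
    ultimately have "0 \<le> (c1 / A1) * ((y2 w - y1 t)^2 / 2 + h1^2 * (A2 / c2 * (1 - (c1 * c2 + s1 * s2)) -
           \<gamma> * s1 * (y2 w - y1 t) * (- (A2 / b2 * (s2 / c2)) - - (A1 / b1 * (s1 / c1)))))"
      by (rule mult_nonneg_nonneg[rotated])
    also note comparison_derivative_algebra[OF nz cs(1) mu A2 b2, of \<beta>, folded g'_def, symmetric]
    finally show "\<exists>l. (D has_real_derivative l) (at t) \<and> 0 \<le> l"
      using dD by (intro exI conjI) (assumption, simp)
  qed
  then show ?thesis
    using g0 gr G1.start G2.start G1.return G2.return by (simp add: D_def)
qed

section \<open>Two-point boundary value problems with a dichotomy\<close>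

lemma antiderivative:
  fixes f :: "real \<Rightarrow> real"
  assumes "continuous_on {0..r} f"
  obtains F where "F 0 = 0"
    "\<And>t. t \<in> {0..r} \<Longrightarrow> (F has_real_derivative f t) (at t within {0..r})"
  by (rule that[of "\<lambda>t. integral {0..t} f"]) (auto intro: integral_has_real_derivative[OF assms])

locale positive_rate =
  fixes r \<kappa> :: real and \<omega> :: "real \<Rightarrow> real"
  assumes r_pos: "0 < r" and \<kappa>_pos: "0 < \<kappa>"
    and \<omega>_cont: "continuous_on {0..r} \<omega>"
    and \<omega>_ge: "\<And>t. t \<in> {0..r} \<Longrightarrow> \<kappa> \<le> \<omega> t"
begin

lemma accumulated_rate:
  obtains B where "B 0 = 0" "\<And>t. t \<in> {0..r} \<Longrightarrow> (B has_real_derivative \<omega> t) (at t within {0..r})"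
    "\<And>t. t \<in> {0..r} \<Longrightarrow> \<kappa> * t \<le> B t"
proof -
  obtain B where B: "B 0 = 0" "\<And>t. t \<in> {0..r} \<Longrightarrow> (B has_real_derivative \<omega> t) (at t within {0..r})"
    using antiderivative[OF \<omega>_cont] by blast
  have "\<kappa> * t - \<kappa> * 0 \<le> B t - B 0" if t: "t \<in> {0..r}" for t
  proof (rule increment_le)
    fix s assume s: "s \<in> {0..t}"
    show "((\<lambda>s. \<kappa> * s) has_real_derivative \<kappa>) (at s within {0..t})" by (auto intro!: derivative_eq_intros)
    show "(B has_real_derivative \<omega> s) (at s within {0..t})" using B(2)[of s] s t by (auto intro: DERIV_subset)
    show "\<kappa> \<le> \<omega> s" using \<omega>_ge s t by auto
  qed (use t in auto)
  then show thesis using that B by auto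
qed

text \<open>With \<open>B' = \<omega>\<close> one has \<open>(exp B U)' = exp B \<omega> F\<close>, which is dominated by \<open>M (exp B)'\<close>.  The bound is therefore
  independent of the size of the rate.\<close>

lemma forced_decay_bound:
  assumes U: "\<And>t. t \<in> {0..r} \<Longrightarrow> (U has_real_derivative \<omega> t * (- U t + F t)) (at t within {0..r})"
    and F: "\<And>t. t \<in> {0..r} \<Longrightarrow> \<bar>F t\<bar> \<le> M"
    and t: "t \<in> {0..r}"
  shows "\<bar>U t\<bar> \<le> \<bar>U 0\<bar> * exp (- (\<kappa> * t)) + M"
proof -
  obtain B where B: "B 0 = 0" "\<And>t. t \<in> {0..r} \<Longrightarrow> (B has_real_derivative \<omega> t) (at t within {0..r})"
    "\<And>t. t \<in> {0..r} \<Longrightarrow> \<kappa> * t \<le> B t" using accumulated_rate by blast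
  have upper: "exp (B t) * \<sigma> * U t - \<sigma> * U 0 \<le> M * exp (B t) - M" if \<sigma>: "\<bar>\<sigma>\<bar> = 1" for \<sigma>
  proof -
    have "exp (B t) * (\<sigma> * U t) - exp (B 0) * (\<sigma> * U 0) \<le> M * exp (B t) - M * exp (B 0)"
    proof (rule increment_le)
      fix s assume s: "s \<in> {0..t}"
      then have sr: "s \<in> {0..r}" and sub: "{0..t} \<subseteq> {0..r}" using t by auto
      note BD = DERIV_subset[OF B(2)[OF sr] sub]
      have eD: "((\<lambda>s. exp (B s)) has_real_derivative exp (B s) * \<omega> s) (at s within {0..t})"
        using DERIV_chain2[OF DERIV_exp BD] by simp
      show "((\<lambda>s. M * exp (B s)) has_real_derivative M * (exp (B s) * \<omega> s)) (at s within {0..t})"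
        by (intro DERIV_cmult eD)
      show "((\<lambda>s. exp (B s) * (\<sigma> * U s)) has_real_derivative \<sigma> * F s * (exp (B s) * \<omega> s)) (at s within {0..t})"
        by (rule DERIV_cong[OF DERIV_mult[OF eD DERIV_cmult[OF DERIV_subset[OF U[OF sr] sub]]]])
           (simp add: algebra_simps)
      have "\<bar>\<sigma> * F s\<bar> \<le> M" using F[OF sr] \<sigma> by (simp add: abs_mult)
      then show "\<sigma> * F s * (exp (B s) * \<omega> s) \<le> M * (exp (B s) * \<omega> s)"
        using \<omega>_ge[OF sr] \<kappa>_pos by (intro mult_right_mono) auto
    qed (use t in auto)
    then show ?thesis using B(1) by (simp add: mult.assoc)
  qed
  have M: "0 \<le> M" using F[of 0] r_pos by fastforce
  have "exp (B t) * \<bar>U t\<bar> \<le> \<bar>U 0\<bar> + M * exp (B t)"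
    using upper[of 1] upper[of "-1"] M by (auto simp: abs_if)
  then have "exp (B t) * \<bar>U t\<bar> * exp (- B t) \<le> (\<bar>U 0\<bar> + M * exp (B t)) * exp (- B t)"
    by (intro mult_right_mono) auto
  then have "\<bar>U t\<bar> \<le> \<bar>U 0\<bar> * exp (- B t) + M"
    by (simp add: distrib_right exp_minus field_simps)
  also have "\<bar>U 0\<bar> * exp (- B t) \<le> \<bar>U 0\<bar> * exp (- (\<kappa> * t))" using B(3)[OF t] by (intro mult_left_mono) auto
  finally show ?thesis by simp
qed

end

text \<open>One direction decays at rate \<open>\<omega>\<close> and the other grows at the same rate.  The interval is so long that decay
  over it is at least by the factor \<open>exp (- 1) < 1/2\<close>, which decouples the two boundary conditions.\<close>

locale dichotomy = positive_rate +
  assumes long: "1 \<le> \<kappa> * r" and r_le: "r \<le> 1"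
begin

lemma linear_exists:
  assumes F: "continuous_on {0..r} F" and G: "continuous_on {0..r} G"
  obtains U V where
    "\<And>t. t \<in> {0..r} \<Longrightarrow> (U has_real_derivative \<omega> t * (- U t + F t)) (at t within {0..r})"
    "\<And>t. t \<in> {0..r} \<Longrightarrow> (V has_real_derivative \<omega> t * (V t + G t)) (at t within {0..r})"
    "U 0 + V 0 = 0" "U r + V r = 0"
proof -
  obtain B where B: "B 0 = 0" "\<And>t. t \<in> {0..r} \<Longrightarrow> (B has_real_derivative \<omega> t) (at t within {0..r})"
    "\<And>t. t \<in> {0..r} \<Longrightarrow> \<kappa> * t \<le> B t" using accumulated_rate by blast
  have Bc: "continuous_on {0..r} B" by (rule DERIV_continuous_on[OF B(2)])
  obtain I where I: "I 0 = 0" "\<And>t. t \<in> {0..r} \<Longrightarrow> (I has_real_derivative exp (B t) * (\<omega> t * F t)) (at t within {0..r})"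
    using antiderivative[OF continuous_on_mult[OF continuous_on_exp[OF Bc] continuous_on_mult[OF \<omega>_cont F]]]
    by blast
  obtain J where J: "J 0 = 0" "\<And>t. t \<in> {0..r} \<Longrightarrow> (J has_real_derivative exp (- B t) * (\<omega> t * G t)) (at t within {0..r})"
    using antiderivative[OF continuous_on_mult[OF continuous_on_exp[OF continuous_on_minus[OF Bc]] continuous_on_mult[OF \<omega>_cont G]]]
    by blast
  \<comment> \<open>The free constant of the decaying component, minus that of the growing one by the condition at \<open>0\<close>, solved for from the condition at \<open>r\<close>.\<close>
  define c where "c = (exp (- B r) * I r + exp (B r) * J r) / (exp (B r) - exp (- B r))"
  have "B r > 0" using B(3)[of r] long r_pos by auto
  then have nz: "exp (B r) - exp (- B r) \<noteq> 0" by simp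
  define U where "U t = exp (- B t) * (c + I t)" for t
  define V where "V t = exp (B t) * (- c + J t)" for t
  have ee: "exp (- B t) * exp (B t) = 1" "exp (B t) * exp (- B t) = 1" for t by (simp_all add: exp_minus)
  show thesis
  proof (rule that[of U V])
    fix t assume t: "t \<in> {0..r}"
    have e1: "((\<lambda>t. exp (- B t)) has_real_derivative exp (- B t) * - \<omega> t) (at t within {0..r})"
      by (rule DERIV_chain2[OF DERIV_exp DERIV_minus[OF B(2)[OF t]]])
    have e2: "((\<lambda>t. exp (B t)) has_real_derivative exp (B t) * \<omega> t) (at t within {0..r})"
      by (rule DERIV_chain2[OF DERIV_exp B(2)[OF t]])
    show "(U has_real_derivative \<omega> t * (- U t + F t)) (at t within {0..r})"
      unfolding U_def
      by (rule DERIV_cong[OF DERIV_mult[OF e1 DERIV_add[OF DERIV_const I(2)[OF t]]]])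
         (use ee[of t] in \<open>simp add: algebra_simps\<close>)
    show "(V has_real_derivative \<omega> t * (V t + G t)) (at t within {0..r})"
      unfolding V_def
      by (rule DERIV_cong[OF DERIV_mult[OF e2 DERIV_add[OF DERIV_const J(2)[OF t]]]])
         (use ee[of t] in \<open>simp add: algebra_simps\<close>)
  next
    show "U 0 + V 0 = 0" using B(1) I(1) J(1) by (simp add: U_def V_def)
    have "U r + V r = exp (- B r) * I r + exp (B r) * J r - c * (exp (B r) - exp (- B r))"
      by (simp add: U_def V_def algebra_simps)
    also have "\<dots> = 0" using nz by (simp add: c_def)
    finally show "U r + V r = 0" .
  qed
qed

text \<open>The growing direction \<open>V\<close> decays when time runs backwards, so both directions obey
  \<open>forced_decay_bound\<close>, one from each end.  The boundary conditions feed each bound into the other with a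
  factor at most \<open>1/2\<close>.\<close>

lemma linear_bound:
  assumes U: "\<And>t. t \<in> {0..r} \<Longrightarrow> (U has_real_derivative \<omega> t * (- U t + F t)) (at t within {0..r})"
    and V: "\<And>t. t \<in> {0..r} \<Longrightarrow> (V has_real_derivative \<omega> t * (V t + G t)) (at t within {0..r})"
    and W: "\<And>t. t \<in> {0..r} \<Longrightarrow> (W has_real_derivative H t) (at t within {0..r})"
    and bc: "U 0 + V 0 = 0" "U r + V r = 0" "W 0 = 0"
    and F: "\<And>t. t \<in> {0..r} \<Longrightarrow> \<bar>F t\<bar> \<le> M" and G: "\<And>t. t \<in> {0..r} \<Longrightarrow> \<bar>G t\<bar> \<le> M"
    and H: "\<And>t. t \<in> {0..r} \<Longrightarrow> \<bar>H t\<bar> \<le> M"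
    and t: "t \<in> {0..r}"
  shows "norm (U t, V t, W t) \<le> 7 * M"
proof -
  have M: "0 \<le> M" using F[of 0] r_pos by fastforce
  have Ub: "\<bar>U t\<bar> \<le> \<bar>U 0\<bar> * exp (- (\<kappa> * t)) + M" if "t \<in> {0..r}" for t
    by (rule forced_decay_bound[OF U F that])
  \<comment> \<open>Time reversal turns growth into decay.\<close>
  define V' where "V' = (\<lambda>t. V (r - t))"
  interpret rev: positive_rate r \<kappa> "\<lambda>t. \<omega> (r - t)"
  proof
    show "continuous_on {0..r} (\<lambda>t. \<omega> (r - t))"
      by (rule continuous_on_compose2[OF \<omega>_cont]) (auto intro!: continuous_intros)
  qed (use r_pos \<kappa>_pos \<omega>_ge in auto)
  have Vb: "\<bar>V' t\<bar> \<le> \<bar>V' 0\<bar> * exp (- (\<kappa> * t)) + M" if "t \<in> {0..r}" for t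
  proof (rule rev.forced_decay_bound[of _ "\<lambda>t. - G (r - t)", OF _ _ that])
    fix s assume s: "s \<in> {0..r}"
    then have rs: "r - s \<in> {0..r}" by auto
    have im: "(\<lambda>t. r - t) ` {0..r} = {0..r}" by (rule set_eqI) (auto simp: image_iff intro: bexI[of _ "r - _"])
    have "((\<lambda>t. r - t) has_real_derivative - 1) (at s within {0..r})" by (auto intro!: derivative_eq_intros)
    from DERIV_image_chain[OF _ this, of V] V[OF rs]
    have "((V \<circ> (\<lambda>t. r - t)) has_real_derivative (\<omega> (r - s) * (V (r - s) + G (r - s))) * - 1) (at s within {0..r})"
      by (simp add: im)
    then show "(V' has_real_derivative \<omega> (r - s) * (- V' s + - G (r - s))) (at s within {0..r})"
      by (simp add: V'_def o_def algebra_simps)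
    show "\<bar>- G (r - s)\<bar> \<le> M" using G[OF rs] by simp
  qed
  define q where "q = exp (- (\<kappa> * r))"
  have q: "0 < q" "q \<le> 1/2"
  proof -
    have "1 + 1 \<le> exp (\<kappa> * r)" using exp_ge_add_one_self[of "\<kappa> * r"] long by linarith
    then show "q \<le> 1/2" unfolding q_def exp_minus by (simp add: inverse_eq_divide divide_le_eq)
  qed (simp add: q_def)
  have ends: "\<bar>V 0\<bar> = \<bar>U 0\<bar>" "\<bar>V r\<bar> = \<bar>U r\<bar>" using bc by auto
  have "\<bar>U r\<bar> \<le> \<bar>U 0\<bar> * q + M" using Ub[of r] r_pos by (simp add: q_def)
  moreover have "\<bar>V 0\<bar> \<le> \<bar>V r\<bar> * q + M" using Vb[of r] r_pos by (simp add: q_def V'_def)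
  moreover have "\<bar>U 0\<bar> * q \<le> \<bar>U 0\<bar> * (1/2)" "\<bar>V r\<bar> * q \<le> \<bar>V r\<bar> * (1/2)" using q by (intro mult_left_mono; simp)+
  ultimately have U0: "\<bar>U 0\<bar> \<le> 2 * M" and Vr: "\<bar>V r\<bar> \<le> 2 * M" using ends by linarith+
  have e1: "exp (- (\<kappa> * s)) \<le> 1" if "0 \<le> s" for s using that \<kappa>_pos by simp
  have "\<bar>U 0\<bar> * exp (- (\<kappa> * t)) \<le> (2 * M) * 1" using U0 e1[of t] t by (intro mult_mono) auto
  then have Ut: "\<bar>U t\<bar> \<le> 3 * M" using Ub[OF t] by simp
  have "\<bar>V' 0\<bar> * exp (- (\<kappa> * (r - t))) \<le> (2 * M) * 1"
    using Vr e1[of "r - t"] t by (intro mult_mono) (auto simp: V'_def)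
  then have Vt: "\<bar>V t\<bar> \<le> 3 * M" using Vb[of "r - t"] t by (simp add: V'_def)
  have sub: "{0..t} \<subseteq> {0..r}" using t by auto
  have WD: "(W has_real_derivative H s) (at s within {0..t})" if "s \<in> {0..t}" for s
    using DERIV_subset[OF W sub] that sub by auto
  have "W t - W 0 \<le> M * t - M * 0"
    by (rule increment_le[OF _ WD]) (use t H in \<open>auto intro!: derivative_eq_intros simp: abs_le_iff\<close>)
  moreover have "- M * t - - M * 0 \<le> W t - W 0"
    by (rule increment_le[OF _ _ WD]) (use t H in \<open>auto intro!: derivative_eq_intros simp: abs_le_iff minus_le_iff\<close>)
  moreover have "M * t \<le> M * 1" using t r_le M by (intro mult_left_mono) auto
  ultimately have Wt: "\<bar>W t\<bar> \<le> M" using bc by simp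
  have "norm (U t, V t, W t) \<le> norm (U t) + norm (V t, W t)" by (rule norm_Pair_le)
  also have "norm (V t, W t) \<le> norm (V t) + norm (W t)" by (rule norm_Pair_le)
  finally show ?thesis using Ut Vt Wt by simp
qed


text \<open>The linear problem with sources \<open>F\<close>, \<open>G\<close>, \<open>H\<close> for the triple of the decaying component, the growing
  component and a third component that is a plain primitive.\<close>

definition solves :: "(real \<Rightarrow> real) \<Rightarrow> (real \<Rightarrow> real) \<Rightarrow> (real \<Rightarrow> real) \<Rightarrow> (real \<Rightarrow> real \<times> real \<times> real) \<Rightarrow> bool" where
  "solves F G H w \<longleftrightarrow>
     (\<forall>t\<in>{0..r}. ((\<lambda>t. fst (w t)) has_real_derivative \<omega> t * (- fst (w t) + F t)) (at t within {0..r}) \<and>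
        ((\<lambda>t. fst (snd (w t))) has_real_derivative \<omega> t * (fst (snd (w t)) + G t)) (at t within {0..r}) \<and>
        ((\<lambda>t. snd (snd (w t))) has_real_derivative H t) (at t within {0..r})) \<and>
     fst (w 0) + fst (snd (w 0)) = 0 \<and> fst (w r) + fst (snd (w r)) = 0 \<and> snd (snd (w 0)) = 0"

lemma solves_continuous:
  assumes "solves F G H w"
  shows "continuous_on {0..r} w"
proof -
  have "continuous_on {0..r} (\<lambda>t. fst (w t))" "continuous_on {0..r} (\<lambda>t. fst (snd (w t)))"
    "continuous_on {0..r} (\<lambda>t. snd (snd (w t)))"
    using assms by (auto simp: solves_def intro!: DERIV_continuous_on)
  then have "continuous_on {0..r} (\<lambda>t. (fst (w t), fst (snd (w t)), snd (snd (w t))))"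
    by (intro continuous_on_Pair)
  then show ?thesis by simp
qed

lemma solves_exists:
  assumes "continuous_on {0..r} F" "continuous_on {0..r} G" "continuous_on {0..r} H"
  shows "\<exists>w. solves F G H w"
proof -
  obtain U V where "\<And>t. t \<in> {0..r} \<Longrightarrow> (U has_real_derivative \<omega> t * (- U t + F t)) (at t within {0..r})"
    "\<And>t. t \<in> {0..r} \<Longrightarrow> (V has_real_derivative \<omega> t * (V t + G t)) (at t within {0..r})"
    "U 0 + V 0 = 0" "U r + V r = 0"
    using linear_exists[OF assms(1,2)] by blast
  moreover obtain W where "W 0 = 0" "\<And>t. t \<in> {0..r} \<Longrightarrow> (W has_real_derivative H t) (at t within {0..r})"
    using antiderivative[OF assms(3)] by blast
  ultimately have "solves F G H (\<lambda>t. (U t, V t, W t))" by (simp add: solves_def)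
  then show ?thesis by blast
qed

lemma solves_bound:
  assumes "solves F G H w"
    and "\<And>t. t \<in> {0..r} \<Longrightarrow> \<bar>F t\<bar> \<le> M \<and> \<bar>G t\<bar> \<le> M \<and> \<bar>H t\<bar> \<le> M" and t: "t \<in> {0..r}"
  shows "norm (w t) \<le> 7 * M"
  using linear_bound[of "\<lambda>t. fst (w t)" F "\<lambda>t. fst (snd (w t))" G "\<lambda>t. snd (snd (w t))" H M t] assms
  by (simp add: solves_def)

lemma solves_diff:
  assumes "solves F1 G1 H1 w1" "solves F2 G2 H2 w2"
  shows "solves (\<lambda>t. F1 t - F2 t) (\<lambda>t. G1 t - G2 t) (\<lambda>t. H1 t - H2 t) (\<lambda>t. w1 t - w2 t)"
  unfolding solves_def
proof (intro conjI ballI)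
  fix t assume t: "t \<in> {0..r}"
  show "((\<lambda>t. fst (w1 t - w2 t)) has_real_derivative \<omega> t * (- fst (w1 t - w2 t) + (F1 t - F2 t))) (at t within {0..r})"
    using DERIV_diff[of "\<lambda>t. fst (w1 t)" _ t "{0..r}" "\<lambda>t. fst (w2 t)"] assms t
    unfolding solves_def fst_diff by (auto intro!: DERIV_cong[OF DERIV_diff] simp: algebra_simps)
  show "((\<lambda>t. fst (snd (w1 t - w2 t))) has_real_derivative \<omega> t * (fst (snd (w1 t - w2 t)) + (G1 t - G2 t))) (at t within {0..r})"
    using assms t
    unfolding solves_def fst_diff snd_diff by (auto intro!: DERIV_cong[OF DERIV_diff] simp: algebra_simps)
  show "((\<lambda>t. snd (snd (w1 t - w2 t))) has_real_derivative (H1 t - H2 t)) (at t within {0..r})"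
    using assms t unfolding solves_def snd_diff by (auto intro!: DERIV_diff)
qed (use assms in \<open>auto simp: solves_def algebra_simps\<close>)

text \<open>The solution operator of the linear problem has norm at most \<open>7\<close> whatever the rate, so composition with sources of
  Lipschitz constant \<open>L \<le> 1/14\<close> is a contraction with factor \<open>1/2\<close> on the ball of radius \<open>R\<close>.\<close>

lemma nonlinear_exists:
  fixes N1 N2 N3 :: "real \<Rightarrow> real \<times> real \<times> real \<Rightarrow> real"
  assumes cont: "\<And>N w. \<lbrakk>N \<in> {N1, N2, N3}; continuous_on {0..r} w; \<And>t. t \<in> {0..r} \<Longrightarrow> norm (w t) \<le> R\<rbrakk>
      \<Longrightarrow> continuous_on {0..r} (\<lambda>t. N t (w t))"
    and bound: "\<And>N t w. \<lbrakk>N \<in> {N1, N2, N3}; t \<in> {0..r}; norm w \<le> R\<rbrakk> \<Longrightarrow> \<bar>N t w\<bar> \<le> M"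
    and lip: "\<And>N t w w'. \<lbrakk>N \<in> {N1, N2, N3}; t \<in> {0..r}; norm w \<le> R; norm w' \<le> R\<rbrakk>
      \<Longrightarrow> \<bar>N t w - N t w'\<bar> \<le> L * dist w w'"
    and R: "0 \<le> M" "7 * M \<le> R" and L: "0 \<le> L" "14 * L \<le> 1" 
  shows "\<exists>w. (\<forall>t\<in>{0..r}. norm (w t) \<le> R) \<and>
    solves (\<lambda>t. N1 t (w t)) (\<lambda>t. N2 t (w t)) (\<lambda>t. N3 t (w t)) w"
proof -
  \<comment> \<open>Curves on \<open>[0, r]\<close> become bounded continuous functions on the line by freezing them outside, which gives a complete space to iterate in.\<close>
  define cl where "cl t = max 0 (min r t)" for t :: real
  have cl_in: "cl t \<in> {0..r}" for t using r_pos by (auto simp: cl_def)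
  have cl_id: "cl t = t" if "t \<in> {0..r}" for t using that by (auto simp: cl_def)
  have cl_cont: "continuous_on UNIV cl" unfolding cl_def by (intro continuous_intros)
  define S where "S = {w :: real \<Rightarrow>\<^sub>C (real \<times> real \<times> real). \<forall>t. norm (w t) \<le> R}"
  define P where "P w w' \<longleftrightarrow> (\<exists>v. solves (\<lambda>t. N1 t (apply_bcontfun w t)) (\<lambda>t. N2 t (apply_bcontfun w t)) (\<lambda>t. N3 t (apply_bcontfun w t)) v \<and> (\<forall>t. apply_bcontfun w' t = v (cl t)))"
    for w w' :: "real \<Rightarrow>\<^sub>C (real \<times> real \<times> real)"
  have "\<exists>w'. w' \<in> S \<and> P w w'" if w: "w \<in> S" for w
  proof -
    have wR: "norm (w t) \<le> R" for t using w by (simp add: S_def)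
    obtain v where v: "solves (\<lambda>t. N1 t (w t)) (\<lambda>t. N2 t (w t)) (\<lambda>t. N3 t (w t)) v"
      using solves_exists cont[OF _ _ wR] by (meson continuous_on_apply_bcontfun insertCI)
    have vR: "norm (v (cl t)) \<le> R" for t
      using solves_bound[OF v _ cl_in, of M t] bound[OF _ _ wR] R by fastforce
    have "continuous_on UNIV (\<lambda>t. v (cl t))"
      by (rule continuous_on_compose2[OF solves_continuous[OF v] cl_cont]) (use cl_in in auto)
    then have "(\<lambda>t. v (cl t)) \<in> bcontfun"
      using vR by (auto simp: bcontfun_def bounded_iff)
    then obtain w' where w': "(\<lambda>t. v (cl t)) = apply_bcontfun w'" by (rule bcontfunE)
    then have "apply_bcontfun w' t = v (cl t)" for t by metis
    then show ?thesis using v vR by (auto simp: S_def P_def intro!: exI[of _ w'])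
  qed
  then obtain T where T: "\<And>w. w \<in> S \<Longrightarrow> T w \<in> S \<and> P w (T w)" by metis
  have contr: "dist (T w1) (T w2) \<le> 1/2 * dist w1 w2" if w: "w1 \<in> S" "w2 \<in> S" for w1 w2
  proof (rule dist_bound)
    fix t
    have wR: "norm (w1 t) \<le> R" "norm (w2 t) \<le> R" for t using w by (simp_all add: S_def)
    obtain v1 where v1: "solves (\<lambda>t. N1 t (w1 t)) (\<lambda>t. N2 t (w1 t)) (\<lambda>t. N3 t (w1 t)) v1"
      "\<And>t. T w1 t = v1 (cl t)" using T[OF w(1)] by (auto simp: P_def)
    obtain v2 where v2: "solves (\<lambda>t. N1 t (w2 t)) (\<lambda>t. N2 t (w2 t)) (\<lambda>t. N3 t (w2 t)) v2"
      "\<And>t. T w2 t = v2 (cl t)" using T[OF w(2)] by (auto simp: P_def)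
    have "\<bar>N t (w1 t) - N t (w2 t)\<bar> \<le> L * dist w1 w2" if "N \<in> {N1, N2, N3}" "t \<in> {0..r}" for N t
      using lip[OF that wR[of t]] mult_left_mono[OF dist_bounded[of w1 t w2] L(1)] by linarith
    then have "norm (v1 (cl t) - v2 (cl t)) \<le> 7 * (L * dist w1 w2)"
      by (intro solves_bound[OF solves_diff[OF v1(1) v2(1)] _ cl_in]) auto
    also have "\<dots> \<le> 1/2 * dist w1 w2"
      using mult_right_mono[OF L(2), of "dist w1 w2"] by simp
    finally show "dist (T w1 t) (T w2 t) \<le> 1/2 * dist w1 w2" unfolding v1(2) v2(2) by (simp add: dist_norm)
  qed
  have R0: "0 \<le> R" using R by linarith
  have "complete S"
  proof -
    have eq: "S = (\<Inter>t. {w. norm (apply_bcontfun w t) \<le> R})" by (auto simp: S_def)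
    have "closed {w :: real \<Rightarrow>\<^sub>C (real \<times> real \<times> real). norm (apply_bcontfun w t) \<le> R}" for t
    proof -
      have "continuous_on UNIV (\<lambda>w :: real \<Rightarrow>\<^sub>C (real \<times> real \<times> real). apply_bcontfun w t)"
        by (rule continuous_onI) (meson dist_fun_lt_imp_dist_val_lt less_imp_le)
      then show ?thesis by (intro closed_Collect_le continuous_intros)
    qed
    then show ?thesis unfolding eq complete_eq_closed by auto
  qed
  moreover have "S \<noteq> {}"
  proof -
    have "const_bcontfun 0 \<in> S" using R0 by (simp add: S_def)
    then show ?thesis by blast
  qed
  ultimately obtain w where w: "w \<in> S" "T w = w"
    using Banach_fix[of S "1/2" T] T contr by auto
  then obtain v where v: "solves (\<lambda>t. N1 t (w t)) (\<lambda>t. N2 t (w t)) (\<lambda>t. N3 t (w t)) v"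
    "\<And>t. w t = v (cl t)" using T[OF w(1)] by (auto simp: P_def)
  have wv: "w t = v t" if "t \<in> {0..r}" for t using v(2)[of t] cl_id[OF that] by simp
  have "solves (\<lambda>t. N1 t (v t)) (\<lambda>t. N2 t (v t)) (\<lambda>t. N3 t (v t)) v"
    using v(1) wv unfolding solves_def by simp
  moreover have "\<forall>t\<in>{0..r}. norm (v t) \<le> R" using w(1) wv by (metis (mono_tags, lifting) S_def mem_Collect_eq)
  ultimately show ?thesis by blast
qed

end

section \<open>Functions that are small and Lipschitz at a given order in the parameter\<close>

text \<open>The mean value theorem, as the derivative \<open>1 - cos\<close> is at most \<open>c^2 / 2\<close> on the interval.\<close>

lemma x_minus_sin_lipschitz:
  fixes a b c :: real
  assumes "\<bar>a\<bar> \<le> c" "\<bar>b\<bar> \<le> c"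
  shows "\<bar>(a - sin a) - (b - sin b)\<bar> \<le> c^2 / 2 * \<bar>a - b\<bar>"
proof -
  have *: "\<bar>(a - sin a) - (b - sin b)\<bar> \<le> c^2 / 2 * \<bar>a - b\<bar>" if ab: "b < a" "\<bar>a\<bar> \<le> c" "\<bar>b\<bar> \<le> c" for a b
  proof -
    have "\<And>z. DERIV (\<lambda>z. z - sin z) z :> 1 - cos z" by (auto intro!: derivative_eq_intros)
    from MVT2[OF ab(1) this] obtain z where z: "b < z" "z < a" "(a - sin a) - (b - sin b) = (a - b) * (1 - cos z)"
      by blast
    have "\<bar>z\<bar> \<le> c" using z ab by auto
    then have "\<bar>z\<bar>^2 \<le> c^2" by (intro power_mono) auto
    then have "\<bar>1 - cos z\<bar> \<le> c^2 / 2" using one_minus_cos_le[of z] by simp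
    then have "\<bar>a - b\<bar> * \<bar>1 - cos z\<bar> \<le> \<bar>a - b\<bar> * (c^2 / 2)" by (intro mult_left_mono) auto
    then show ?thesis unfolding z(3) by (simp add: abs_mult mult.commute)
  qed
  show ?thesis
  proof (cases a b rule: linorder_cases)
    case less
    then show ?thesis using *[of a b] assms by (simp add: abs_minus_commute)
  next
    case greater
    then show ?thesis using *[of b a] assms by simp
  qed simp
qed

type_synonym state = "real \<times> real \<times> real"

locale lip_region =
  fixes R h1 r :: real
  assumes R_nonneg: "0 \<le> R" and h1: "0 < h1" "h1 \<le> 1" and r_unit: "0 \<le> r" "r \<le> 1"
begin

text \<open>Size and Lipschitz constant are of the same order \<open>h^n\<close>, uniformly on the ball.  Keeping them together makes the
  class closed under products, with orders adding up.\<close>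

definition lip_bound :: "real \<Rightarrow> nat \<Rightarrow> (real \<Rightarrow> real \<Rightarrow> state \<Rightarrow> real) \<Rightarrow> bool" where
  "lip_bound K n F \<longleftrightarrow> (\<forall>h t w w'. 0 < h \<longrightarrow> h \<le> h1 \<longrightarrow> t \<in> {0..r} \<longrightarrow> norm w \<le> R \<longrightarrow> norm w' \<le> R \<longrightarrow>
     \<bar>F h t w\<bar> \<le> K * h ^ n \<and> \<bar>F h t w - F h t w'\<bar> \<le> K * h ^ n * dist w w')"

definition lip_order :: "nat \<Rightarrow> (real \<Rightarrow> real \<Rightarrow> state \<Rightarrow> real) \<Rightarrow> bool" where
  "lip_order n F \<longleftrightarrow> (\<exists>K\<ge>0. lip_bound K n F)"

lemma lip_boundD:
  assumes "lip_bound K n F" "0 < h" "h \<le> h1" "t \<in> {0..r}" "norm w \<le> R"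
  shows "\<bar>F h t w\<bar> \<le> K * h ^ n"
    "norm w' \<le> R \<Longrightarrow> \<bar>F h t w - F h t w'\<bar> \<le> K * h ^ n * dist w w'"
  using assms unfolding lip_bound_def by blast+

lemma lip_orderI:
  assumes "0 \<le> K" "\<And>h t w w'. \<lbrakk>0 < h; h \<le> h1; t \<in> {0..r}; norm w \<le> R; norm w' \<le> R\<rbrakk> \<Longrightarrow>
     \<bar>F h t w\<bar> \<le> K * h ^ n \<and> \<bar>F h t w - F h t w'\<bar> \<le> K * h ^ n * dist w w'"
  shows "lip_order n F"
  using assms unfolding lip_order_def lip_bound_def by blast

lemma lip_orderE:
  assumes "lip_order n F"
  obtains K where "0 \<le> K" "lip_bound K n F"
  using assms unfolding lip_order_def by blast

lemma lip_order_add: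
  assumes "lip_order n F" "lip_order n G"
  shows "lip_order n (\<lambda>h t w. F h t w + G h t w)"
proof -
  obtain K where K: "0 \<le> K" "lip_bound K n F" by (rule lip_orderE[OF assms(1)])
  note K = K(1) lip_boundD[OF K(2)]
  obtain L where L: "0 \<le> L" "lip_bound L n G" by (rule lip_orderE[OF assms(2)])
  note L = L(1) lip_boundD[OF L(2)]
  show ?thesis
  proof (rule lip_orderI[of "K + L"])
    fix h t :: real and w w' :: state
    assume a: "0 < h" "h \<le> h1" "t \<in> {0..r}" "norm w \<le> R" "norm w' \<le> R"
    have "\<bar>F h t w + G h t w - (F h t w' + G h t w')\<bar> \<le> K * h ^ n * dist w w' + L * h ^ n * dist w w'"
      using K(3)[OF a] L(3)[OF a] by linarith
    moreover have "\<bar>F h t w + G h t w\<bar> \<le> K * h ^ n + L * h ^ n"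
      using K(2)[OF a(1-4)] L(2)[OF a(1-4)] by linarith
    ultimately show "\<bar>F h t w + G h t w\<bar> \<le> (K + L) * h ^ n \<and>
        \<bar>F h t w + G h t w - (F h t w' + G h t w')\<bar> \<le> (K + L) * h ^ n * dist w w'"
      by (simp add: algebra_simps)
  qed (use K L in simp)
qed

lemma lip_order_mult:
  assumes "lip_order n F" "lip_order k G"
  shows "lip_order (n + k) (\<lambda>h t w. F h t w * G h t w)"
proof -
  obtain K where K: "0 \<le> K" "lip_bound K n F" by (rule lip_orderE[OF assms(1)])
  note K = K(1) lip_boundD[OF K(2)]
  obtain L where L: "0 \<le> L" "lip_bound L k G" by (rule lip_orderE[OF assms(2)])
  note L = L(1) lip_boundD[OF L(2)]
  show ?thesis
  proof (rule lip_orderI[of "2 * (K * L)"])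
    fix h t :: real and w w' :: state
    assume a: "0 < h" "h \<le> h1" "t \<in> {0..r}" "norm w \<le> R" "norm w' \<le> R"
    have "F h t w * G h t w - F h t w' * G h t w'
        = F h t w * (G h t w - G h t w') + (F h t w - F h t w') * G h t w'"
      by (simp add: algebra_simps)
    then have "\<bar>F h t w * G h t w - F h t w' * G h t w'\<bar>
        \<le> \<bar>F h t w\<bar> * \<bar>G h t w - G h t w'\<bar> + \<bar>F h t w - F h t w'\<bar> * \<bar>G h t w'\<bar>"
      by (simp only: abs_mult[symmetric] abs_triangle_ineq)
    also have "\<dots> \<le> (K * h ^ n) * (L * h ^ k * dist w w') + (K * h ^ n * dist w w') * (L * h ^ k)"
      using K L K(2)[OF a(1-4)] L(2)[OF a(1-3,5)] K(3)[OF a] L(3)[OF a] a(1)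
      by (intro add_mono mult_mono) auto
    finally have "\<bar>F h t w * G h t w - F h t w' * G h t w'\<bar> \<le> 2 * (K * L) * h ^ (n + k) * dist w w'"
      by (simp add: power_add algebra_simps)
    moreover have "\<bar>F h t w * G h t w\<bar> \<le> (K * h ^ n) * (L * h ^ k)"
      unfolding abs_mult using K L K(2)[OF a(1-4)] L(2)[OF a(1-4)] a(1) by (intro mult_mono) auto
    then have "\<bar>F h t w * G h t w\<bar> \<le> 1 * ((K * L) * h ^ (n + k))" by (simp add: power_add algebra_simps)
    moreover have "1 * ((K * L) * h ^ (n + k)) \<le> 2 * ((K * L) * h ^ (n + k))"
      using K L a(1) by (intro mult_right_mono) auto
    ultimately show "\<bar>F h t w * G h t w\<bar> \<le> 2 * (K * L) * h ^ (n + k) \<and>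
        \<bar>F h t w * G h t w - F h t w' * G h t w'\<bar> \<le> 2 * (K * L) * h ^ (n + k) * dist w w'"
      by (simp add: mult.assoc)
  qed (use K L in simp)
qed

lemma lip_order_const: "(\<And>t. t \<in> {0..r} \<Longrightarrow> \<bar>g t\<bar> \<le> K) \<Longrightarrow> lip_order 0 (\<lambda>h t w. g t)"
proof (rule lip_orderI[of "max 0 K"])
  fix h t :: real and w w' :: state
  assume "t \<in> {0..r}" "\<And>t. t \<in> {0..r} \<Longrightarrow> \<bar>g t\<bar> \<le> K"
  then show "\<bar>g t\<bar> \<le> max 0 K * h ^ 0 \<and> \<bar>g t - g t\<bar> \<le> max 0 K * h ^ 0 * dist w w'"
    by (simp add: le_max_iff_disj)
qed simp

lemma lip_order_h: "lip_order 1 (\<lambda>h t w. h)"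
  by (rule lip_orderI[of 1]) auto

lemma lip_order_div_h:
  assumes "lip_order (Suc n) F" shows "lip_order n (\<lambda>h t w. F h t w / h)"
proof -
  obtain K where K: "0 \<le> K" "lip_bound K (Suc n) F" by (rule lip_orderE[OF assms(1)])
  note K = K(1) lip_boundD[OF K(2)]
  show ?thesis
  proof (rule lip_orderI[OF K(1)])
    fix h t :: real and w w' :: state
    assume a: "0 < h" "h \<le> h1" "t \<in> {0..r}" "norm w \<le> R" "norm w' \<le> R"
    show "\<bar>F h t w / h\<bar> \<le> K * h ^ n \<and> \<bar>F h t w / h - F h t w' / h\<bar> \<le> K * h ^ n * dist w w'"
      using K(2)[OF a(1-4)] K(3)[OF a] a(1)
      by (simp add: diff_divide_distrib[symmetric] abs_divide divide_le_eq mult_ac)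
  qed
qed

lemma lip_order_Suc: "lip_order (Suc n) F \<Longrightarrow> lip_order n F"
proof -
  assume "lip_order (Suc n) F"
  then obtain K where K: "0 \<le> K" "lip_bound K (Suc n) F" by (rule lip_orderE)
  note K = K(1) lip_boundD[OF K(2)]
  show ?thesis
  proof (rule lip_orderI[OF K(1)])
    fix h t :: real and w w' :: state
    assume a: "0 < h" "h \<le> h1" "t \<in> {0..r}" "norm w \<le> R" "norm w' \<le> R"
    have "K * h ^ Suc n \<le> K * h ^ n"
      using a(1,2) h1 K(1) power_decreasing[of n "Suc n" h] by (intro mult_left_mono) auto
    moreover from this have "K * h ^ Suc n * dist w w' \<le> K * h ^ n * dist w w'" by (rule mult_right_mono) simp
    ultimately show "\<bar>F h t w\<bar> \<le> K * h ^ n \<and> \<bar>F h t w - F h t w'\<bar> \<le> K * h ^ n * dist w w'"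
      using K(2)[OF a(1-4)] K(3)[OF a] by linarith
  qed
qed

lemma lip_order_weaken: "lip_order n F \<Longrightarrow> k \<le> n \<Longrightarrow> lip_order k F"
  by (induction n) (auto simp: le_Suc_eq dest: lip_order_Suc)

lemma lip_order_mult_eq: "lip_order n F \<Longrightarrow> lip_order k G \<Longrightarrow> j = n + k \<Longrightarrow> lip_order j (\<lambda>h t w. F h t w * G h t w)"
  using lip_order_mult by simp

lemma lip_order_cmult: "lip_order n F \<Longrightarrow> lip_order n (\<lambda>h t w. c * F h t w)"
  using lip_order_mult[OF lip_order_const[of "\<lambda>_. c" "\<bar>c\<bar>"], of n F] by simp

lemma lip_order_hmult: "lip_order n F \<Longrightarrow> lip_order (Suc n) (\<lambda>h t w. h * F h t w)"
  using lip_order_mult[OF lip_order_h, of n F] by simp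

lemma lip_order_inverse:
  assumes "lip_order 0 F" and low: "\<And>h t w. \<lbrakk>0 < h; h \<le> h1; t \<in> {0..r}; norm w \<le> R\<rbrakk> \<Longrightarrow> 1/4 \<le> F h t w"
  shows "lip_order 0 (\<lambda>h t w. 1 / F h t w)"
proof -
  obtain K where K: "0 \<le> K" "lip_bound K 0 F" by (rule lip_orderE[OF assms(1)])
  note K = K(1) lip_boundD[OF K(2), unfolded power_0 mult_1_right]
  show ?thesis
  proof (rule lip_orderI[of "4 + 16 * K"])
    fix h t :: real and w w' :: state
    assume a: "0 < h" "h \<le> h1" "t \<in> {0..r}" "norm w \<le> R" "norm w' \<le> R"
    note l = low[OF a(1-4)] low[OF a(1-3,5)]
    have b: "\<bar>1 / F h t w\<bar> \<le> 4" "\<bar>1 / F h t w'\<bar> \<le> 4" using l by (simp_all add: abs_divide divide_le_eq)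
    have "1 / F h t w - 1 / F h t w' = (F h t w' - F h t w) * ((1 / F h t w) * (1 / F h t w'))"
      using l by (simp add: field_simps)
    then have "\<bar>1 / F h t w - 1 / F h t w'\<bar> = \<bar>F h t w - F h t w'\<bar> * (\<bar>1 / F h t w\<bar> * \<bar>1 / F h t w'\<bar>)"
      by (simp only: abs_mult abs_minus_commute)
    also have "\<dots> \<le> (K * dist w w') * (4 * 4)"
      using K(1) b K(3)[OF a] by (intro mult_mono) auto
    also have "\<dots> \<le> (4 + 16 * K) * dist w w'" by (simp add: distrib_right)
    finally show "\<bar>1 / F h t w\<bar> \<le> (4 + 16 * K) * h ^ 0 \<and> \<bar>1 / F h t w - 1 / F h t w'\<bar> \<le> (4 + 16 * K) * h ^ 0 * dist w w'"
      using b K(1) by simp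
  qed (use K in simp)
qed

lemma lip_order_linear:
  assumes "\<And>w. \<bar>f w\<bar> \<le> norm w" "\<And>w w'. f w - f w' = f (w - w')"
  shows "lip_order 0 (\<lambda>h t w. f w)"
proof (rule lip_orderI[of "1 + R"])
  fix h t :: real and w w' :: state
  assume "norm w \<le> R"
  moreover have "\<bar>f w - f w'\<bar> \<le> 1 * dist w w'" using assms(1)[of "w - w'"] assms(2)[of w w'] by (simp add: dist_norm)
  moreover have "1 * dist w w' \<le> (1 + R) * dist w w'" using R_nonneg by (intro mult_right_mono) auto
  ultimately show "\<bar>f w\<bar> \<le> (1 + R) * h ^ 0 \<and> \<bar>f w - f w'\<bar> \<le> (1 + R) * h ^ 0 * dist w w'"
    using assms(1)[of w] by simp
qed (use R_nonneg in simp)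

lemma lip_order_sin:
  assumes "lip_order n F" shows "lip_order n (\<lambda>h t w. sin (F h t w))"
proof -
  obtain K where K: "0 \<le> K" "lip_bound K n F" by (rule lip_orderE[OF assms(1)])
  note K = K(1) lip_boundD[OF K(2)]
  have sl: "\<bar>sin a - sin b\<bar> \<le> \<bar>a - b\<bar>" for a b :: real
  proof -
    have "\<bar>sin a - sin b\<bar> = 2 * \<bar>sin ((a - b) / 2)\<bar> * \<bar>cos ((a + b) / 2)\<bar>"
      by (simp add: sin_diff_sin abs_mult)
    also have "\<dots> \<le> 2 * \<bar>(a - b) / 2\<bar> * 1"
      using abs_sin_x_le_abs_x[of "(a - b) / 2"] by (intro mult_mono) auto
    finally show ?thesis by simp
  qed
  show ?thesis
    by (rule lip_orderI[OF K(1)]) (meson K(2,3) sl abs_sin_x_le_abs_x order_trans)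
qed

lemma lip_order_x_minus_sin:
  assumes "lip_order 1 F" shows "lip_order 2 (\<lambda>h t w. F h t w - sin (F h t w))"
proof -
  obtain K where K: "0 \<le> K" "lip_bound K 1 F" by (rule lip_orderE[OF assms(1)])
  note K = K(1) lip_boundD[OF K(2), unfolded power_one_right]
  have K3: "0 \<le> K^3" using K(1) by simp
  show ?thesis
  proof (rule lip_orderI[OF K3])
    fix h t :: real and w w' :: state
    assume a: "0 < h" "h \<le> h1" "t \<in> {0..r}" "norm w \<le> R" "norm w' \<le> R"
    have h3: "K^3 * h^3 \<le> K^3 * h^2"
      using a(1,2) h1 K3 power_decreasing[of 2 3 h] by (intro mult_left_mono) auto
    have nn: "0 \<le> K^3 * h^3" using K3 a(1) by simp
    have lip: "\<bar>(u - sin u) - (v - sin v)\<bar> \<le> (K * h)^2 / 2 * \<bar>u - v\<bar>" if "\<bar>u\<bar> \<le> K * h" "\<bar>v\<bar> \<le> K * h" for u v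
      by (rule x_minus_sin_lipschitz[OF that])
    have "\<bar>F h t w - sin (F h t w)\<bar> \<le> (K * h)^2 / 2 * (K * h)"
      using lip[of "F h t w" 0] K(1) K(2)[OF a(1-4)] a(1) 
      by (fastforce intro: order_trans mult_left_mono)
    also have "\<dots> = K^3 * h^3 / 2" by (simp add: power2_eq_square power3_eq_cube)
    also have "\<dots> \<le> K^3 * h^2" using h3 nn by simp
    finally have 1: "\<bar>F h t w - sin (F h t w)\<bar> \<le> K^3 * h^2" .
    have "\<bar>(F h t w - sin (F h t w)) - (F h t w' - sin (F h t w'))\<bar> \<le> (K * h)^2 / 2 * \<bar>F h t w - F h t w'\<bar>"
      by (rule lip[OF K(2)[OF a(1-4)] K(2)[OF a(1-3,5)]])
    also have "\<dots> \<le> (K * h)^2 / 2 * (K * h * dist w w')" using K(3)[OF a] by (intro mult_left_mono) auto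
    also have "\<dots> = (K^3 * h^3 / 2) * dist w w'" by (simp add: power2_eq_square power3_eq_cube)
    also have "\<dots> \<le> K^3 * h^2 * dist w w'" using h3 nn by (intro mult_right_mono) auto
    finally show "\<bar>F h t w - sin (F h t w)\<bar> \<le> K ^ 3 * h^2 \<and>
       \<bar>F h t w - sin (F h t w) - (F h t w' - sin (F h t w'))\<bar> \<le> K ^ 3 * h^2 * dist w w'" using 1 by simp
  qed
qed

lemma lip_order_cong: 
  assumes "lip_order n F" "\<And>h t w. \<lbrakk>0 < h; h \<le> h1; t \<in> {0..r}; norm w \<le> R\<rbrakk> \<Longrightarrow> F h t w = G h t w"
  shows "lip_order n G"
  using assms unfolding lip_order_def lip_bound_def by (metis (no_types, lifting))

lemma lip_order_1_minus_cos:
  assumes "lip_order 1 F" shows "lip_order 2 (\<lambda>h t w. 1 - cos (F h t w))"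
proof -
  have "lip_order 1 (\<lambda>h t w. sin ((1/2) * F h t w))" by (rule lip_order_sin[OF lip_order_cmult[OF assms]])
  from lip_order_cmult[OF lip_order_mult[OF this this], of 2]
  have "lip_order 2 (\<lambda>h t w. 2 * (sin ((1/2) * F h t w) * sin ((1/2) * F h t w)))" by (simp add: numeral_2_eq_2)
  then show ?thesis
  proof (rule lip_order_cong)
    fix h t w
    show "2 * (sin ((1/2) * F h t w) * sin ((1/2) * F h t w)) = 1 - cos (F h t w)"
      using cos_double_sin[of "(1/2) * F h t w"] by (simp add: power2_eq_square)
  qed
qed

end

section \<open>The scaled geodesic equations\<close>

locale scaled_system =
  fixes \<alpha> \<beta> \<gamma> r m :: real
  assumes alpha_pos: "\<alpha> > 0" and r_pos: "r > 0"
    and m_def: "m = 1 + \<alpha> + \<bar>\<beta>\<bar> + \<bar>\<gamma>\<bar>"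
    and r_small: "64 * m * r \<le> 1"
begin

text \<open>Up to \<open>O(h)\<close> the sources of the scaled system are \<open>\<plusminus> \<alpha>\<close> and \<open>0\<close>, so for small \<open>h\<close> they are bounded by \<open>\<alpha> + 1\<close>, and the solution
  operator has norm \<open>7\<close>.\<close>

definition R where "R = 7 * (\<alpha> + 1)"
definition h1 where "h1 = 1 / (8 * m * (R + 1))"

text \<open>A state is \<open>(U, V, W)\<close> with \<open>U = Y + \<Phi>\<close> and \<open>V = Y - \<Phi>\<close>, where \<open>y = h^2 Y\<close>, \<open>\<phi> = h \<Phi>\<close> and \<open>x = h W - t\<close>.\<close>

abbreviation Y :: "state \<Rightarrow> real" where "Y w \<equiv> (fst w + fst (snd w)) / 2"
abbreviation \<Phi> :: "state \<Rightarrow> real" where "\<Phi> w \<equiv> (fst w - fst (snd w)) / 2"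
abbreviation W :: "state \<Rightarrow> real" where "W w \<equiv> snd (snd w)"

definition A where "A h w = 1 + \<alpha> * (h^2 * Y w)"
definition b where "b h t w = 1 + \<beta> * (h * W w - t) + \<gamma> * (h^2 * Y w)"
definition b0 where "b0 t = 1 - \<beta> * t"

text \<open>The sources left over when the linear part \<open>Y' = - \<Phi> / (h b0)\<close>, \<open>\<Phi>' = - Y / (h b0)\<close> is split off from the geodesic
  equations: \<open>P\<close> and \<open>Q\<close> belong to \<open>Y\<close> and \<open>\<Phi>\<close>, and \<open>N3\<close> is the derivative of \<open>W\<close>.  The coefficient \<open>b0\<close> of
  the linear part is \<open>b\<close> along the abnormal geodesic.\<close>

definition P where "P h t w = \<Phi> w - b0 t * (sin (h * \<Phi> w) / h) / b h t w"
definition Q where "Q h t w = Y w - b0 t * (Y w + \<alpha> * cos (h * \<Phi> w) - \<beta> * sin (h * \<Phi> w)) / (A h w * b h t w)"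
definition N3 where "N3 h t w = (1 - cos (h * \<Phi> w) / A h w) / h"

lemma m_ge: "1 \<le> m" "\<alpha> \<le> m" "\<bar>\<beta>\<bar> \<le> m" "\<bar>\<gamma>\<bar> \<le> m"
  using m_def alpha_pos by auto

lemma R_pos: "0 < R" "7 \<le> R" using alpha_pos by (simp_all add: R_def)

lemma r_le_1: "r \<le> 1"
  using r_small r_pos mult_right_mono[OF m_ge(1) less_imp_le[OF r_pos]] by linarith

lemma h1_bounds: "0 < h1" "h1 \<le> 1" "m * h1 * (R + 1) = 1/8"
proof -
  have "0 < m * (R + 1)" using m_ge R_pos by (intro mult_pos_pos) auto
  then show "0 < h1" "m * h1 * (R + 1) = 1/8" by (simp_all add: h1_def field_simps)
  have "1 * 1 \<le> m * (R + 1)" using m_ge R_pos by (intro mult_mono) auto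
  then show "h1 \<le> 1" by (simp add: h1_def divide_le_eq)
qed

sublocale lip_region R h1 r
  using R_pos h1_bounds r_pos r_le_1 by unfold_locales auto

lemma component_bounds:
  fixes w :: state
  shows "\<bar>Y w\<bar> \<le> norm w" "\<bar>\<Phi> w\<bar> \<le> norm w" "\<bar>W w\<bar> \<le> norm w"
proof -
  have 1: "\<bar>fst w\<bar> \<le> norm w" using norm_fst_le[of "fst w" "snd w"] by simp
  have s: "norm (snd w) \<le> norm w" using norm_snd_le[of "snd w" "fst w"] by simp
  have 2: "\<bar>fst (snd w)\<bar> \<le> norm w" using norm_fst_le[of "fst (snd w)" "snd (snd w)"] s by simp
  show "\<bar>W w\<bar> \<le> norm w" using norm_snd_le[of "snd (snd w)" "fst (snd w)"] s by simp
  show "\<bar>Y w\<bar> \<le> norm w" "\<bar>\<Phi> w\<bar> \<le> norm w" using 1 2 by (auto simp: abs_le_iff)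
qed

lemma small_terms:
  assumes "0 < h" "h \<le> h1" "norm w \<le> R" "\<bar>c\<bar> \<le> m" "\<bar>u\<bar> \<le> norm w"
  shows "\<bar>c * (h * u)\<bar> \<le> 1/8" "\<bar>c * (h^2 * u)\<bar> \<le> 1/8"
proof -
  have "\<bar>c\<bar> * (\<bar>h\<bar> * \<bar>u\<bar>) \<le> m * (h1 * (R + 1))"
    using assms m_ge h1_bounds R_pos by (intro mult_mono) auto
  then show 1: "\<bar>c * (h * u)\<bar> \<le> 1/8" using h1_bounds(3) by (simp only: abs_mult mult.assoc)
  have "\<bar>c * (h^2 * u)\<bar> = h * \<bar>c * (h * u)\<bar>" using assms(1) by (simp add: abs_mult power2_eq_square)
  also have "\<dots> \<le> 1 * (1/8)" using 1 assms h1_bounds by (intro mult_mono) auto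
  finally show "\<bar>c * (h^2 * u)\<bar> \<le> 1/8" by simp
qed

lemma beta_t: "t \<in> {0..r} \<Longrightarrow> \<bar>\<beta> * t\<bar> \<le> 1/8"
proof -
  assume t: "t \<in> {0..r}"
  then have "\<bar>\<beta>\<bar> * \<bar>t\<bar> \<le> m * r" using m_ge by (intro mult_mono) auto
  then show ?thesis using r_small by (simp add: abs_mult)
qed

lemma A_bounds:
  assumes "0 < h" "h \<le> h1" "norm w \<le> R"
  shows "1/2 \<le> A h w" 
  using small_terms(2)[OF assms _ component_bounds(1), of \<alpha>] m_ge alpha_pos by (simp add: A_def abs_le_iff)

lemma b_bounds:
  assumes "0 < h" "h \<le> h1" "t \<in> {0..r}" "norm w \<le> R"
  shows "1/2 \<le> b h t w"
proof -
  have "b h t w = 1 + \<beta> * (h * W w) - \<beta> * t + \<gamma> * (h^2 * Y w)" by (simp add: b_def right_diff_distrib)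
  then show ?thesis
    using small_terms(1)[OF assms(1,2,4) m_ge(3) component_bounds(3)]
      small_terms(2)[OF assms(1,2,4) m_ge(4) component_bounds(1)] beta_t[OF assms(3)] by linarith
qed

lemma Ab_bounds:
  assumes "0 < h" "h \<le> h1" "t \<in> {0..r}" "norm w \<le> R"
  shows "1/4 \<le> A h w * b h t w"
proof -
  have "1/2 * (1/2) \<le> A h w * b h t w"
    using A_bounds[OF assms(1,2,4)] b_bounds[OF assms] by (intro mult_mono) auto
  then show ?thesis by simp
qed

lemma b0_bounds: "t \<in> {0..r} \<Longrightarrow> 7/8 \<le> b0 t" "t \<in> {0..r} \<Longrightarrow> b0 t \<le> 2"
  using beta_t[of t] by (auto simp: b0_def abs_le_iff)

lemma lip_order_Y: "lip_order 0 (\<lambda>h t w. Y w)" and lip_order_\<Phi>: "lip_order 0 (\<lambda>h t w. \<Phi> w)" and lip_order_W: "lip_order 0 (\<lambda>h t w. W w)"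
  by (rule lip_order_linear; use component_bounds in \<open>simp add: field_simps\<close>)+

lemma lip_order_b0: "lip_order 0 (\<lambda>h t w. b0 t)"
  by (rule lip_order_const[of _ 2]) (use b0_bounds in fastforce)

lemma lip_order_A_minus_1: "lip_order 2 (\<lambda>h t w. A h w - 1)"
  using lip_order_cmult[OF lip_order_hmult[OF lip_order_hmult[OF lip_order_Y]], of \<alpha>]
  by (simp add: A_def power2_eq_square numeral_2_eq_2 mult.assoc)

lemma lip_order_1: "lip_order 0 (\<lambda>h t w. 1)" by (rule lip_order_const[of "\<lambda>_. 1" 1]) simp

lemma lip_order_A: "lip_order 0 (\<lambda>h t w. A h w)"
  using lip_order_add[OF lip_order_1 lip_order_weaken[OF lip_order_A_minus_1, of 0]] by simp

lemma lip_order_b_minus: "lip_order 1 (\<lambda>h t w. b h t w - b0 t)"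
proof -
  have 1: "lip_order 1 (\<lambda>h t w. \<beta> * (h * W w))" using lip_order_cmult[OF lip_order_hmult[OF lip_order_W]] by simp
  have 2: "lip_order 1 (\<lambda>h t w. \<gamma> * (h * (h * Y w)))"
    by (rule lip_order_weaken[OF lip_order_cmult[OF lip_order_hmult[OF lip_order_hmult[OF lip_order_Y]]]]) simp
  show ?thesis
    by (rule lip_order_cong[OF lip_order_add[OF 1 2]]) (simp add: b_def b0_def power2_eq_square algebra_simps)
qed

lemma lip_order_b: "lip_order 0 (\<lambda>h t w. b h t w)"
  using lip_order_add[OF lip_order_weaken[OF lip_order_b_minus, of 0] lip_order_b0] by simp

lemma lip_order_h\<Phi>: "lip_order 1 (\<lambda>h t w. h * \<Phi> w)"
  using lip_order_hmult[OF lip_order_\<Phi>] by simp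

lemma lip_order_cos: "lip_order 2 (\<lambda>h t w. 1 - cos (h * \<Phi> w))"
  by (rule lip_order_1_minus_cos[OF lip_order_h\<Phi>])

text \<open>The differences \<open>h \<Phi> - sin (h \<Phi>)\<close> and \<open>b - b0\<close> have order \<open>2\<close> and \<open>1\<close>, and the first is divided by \<open>h\<close>.\<close>

lemma lip_order_P: "lip_order 1 P"
proof -
  have 1: "lip_order 1 (\<lambda>h t w. (h * \<Phi> w - sin (h * \<Phi> w)) / h)"
    by (rule lip_order_div_h, rule lip_order_weaken[OF lip_order_x_minus_sin[OF lip_order_h\<Phi>]]) simp
  have 2: "lip_order 0 (\<lambda>h t w. sin (h * \<Phi> w) / h)"
    by (rule lip_order_div_h, rule lip_order_weaken[OF lip_order_sin[OF lip_order_h\<Phi>]]) simp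
  have 3: "lip_order 0 (\<lambda>h t w. 1 / b h t w)"
    by (rule lip_order_inverse[OF lip_order_b]) (use b_bounds in force)
  have 4: "lip_order 1 (\<lambda>h t w. (b h t w - b0 t) * (1 / b h t w))"
    by (rule lip_order_mult_eq[OF lip_order_b_minus 3]) simp
  have 5: "lip_order 1 (\<lambda>h t w. sin (h * \<Phi> w) / h * ((b h t w - b0 t) * (1 / b h t w)))"
    by (rule lip_order_mult_eq[OF 2 4]) simp
  show ?thesis
  proof (rule lip_order_cong[OF lip_order_add[OF 1 5]])
    fix h t and w :: state assume a: "0 < h" "h \<le> h1" "t \<in> {0..r}" "norm w \<le> R"
    define bb S where "bb = b h t w" and "S = sin (h * \<Phi> w)"
    have bb: "bb \<noteq> 0" using b_bounds[OF a] by (simp add: bb_def)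
    have "(h * f - S) / h + S / h * ((bb - c) * (1 / bb)) = f - c * (S / h) / bb" for f c
      using a(1) bb by (simp add: diff_divide_distrib) (simp add: field_simps)
    then show "(h * \<Phi> w - sin (h * \<Phi> w)) / h + (sin (h * \<Phi> w) / h * ((b h t w - b0 t) * (1 / b h t w))) = P h t w"
      unfolding P_def bb_def S_def .
  qed
qed

text \<open>Adding \<open>\<alpha>\<close> removes the only contribution that does not vanish with \<open>h\<close>, and every other term contains a factor
  \<open>A b - b0\<close>, \<open>1 - cos (h \<Phi>)\<close> or \<open>sin (h \<Phi>)\<close>.\<close>

lemma lip_order_Q: "lip_order 1 (\<lambda>h t w. Q h t w + \<alpha>)"
proof -
  have 0: "lip_order 1 (\<lambda>h t w. A h w * b h t w - b0 t)"
  proof -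
    have "lip_order 1 (\<lambda>h t w. (A h w - 1) * b h t w)"
      by (rule lip_order_mult_eq[OF lip_order_weaken[OF lip_order_A_minus_1, of 1] lip_order_b]) auto
    from lip_order_add[OF this lip_order_b_minus] show ?thesis by (rule lip_order_cong) (simp add: algebra_simps)
  qed
  have 1: "lip_order 0 (\<lambda>h t w. 1 / (A h w * b h t w))"
    by (rule lip_order_inverse[OF lip_order_mult_eq[OF lip_order_A lip_order_b]]) (use Ab_bounds in auto)
  have 2: "lip_order 1 (\<lambda>h t w. \<alpha> * (1 - cos (h * \<Phi> w)) + \<beta> * sin (h * \<Phi> w))"
    by (rule lip_order_add[OF lip_order_cmult[OF lip_order_weaken[OF lip_order_cos]] lip_order_cmult[OF lip_order_sin[OF lip_order_h\<Phi>]]]) simp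
  have 3: "lip_order 1 (\<lambda>h t w. Y w * (A h w * b h t w - b0 t))" by (rule lip_order_mult_eq[OF lip_order_Y 0]) simp
  have 4: "lip_order 1 (\<lambda>h t w. b0 t * (\<alpha> * (1 - cos (h * \<Phi> w)) + \<beta> * sin (h * \<Phi> w)))"
    by (rule lip_order_mult_eq[OF lip_order_b0 2]) simp
  have "lip_order 1 (\<lambda>h t w. (Y w * (A h w * b h t w - b0 t) + \<alpha> * (A h w * b h t w - b0 t)
      + b0 t * (\<alpha> * (1 - cos (h * \<Phi> w)) + \<beta> * sin (h * \<Phi> w))) * (1 / (A h w * b h t w)))"
    by (rule lip_order_mult_eq[OF lip_order_add[OF lip_order_add[OF 3 lip_order_cmult[OF 0, of \<alpha>]] 4] 1]) simp
  then show ?thesis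
  proof (rule lip_order_cong)
    fix h t and w :: state assume a: "0 < h" "h \<le> h1" "t \<in> {0..r}" "norm w \<le> R"
    define D where "D = A h w * b h t w"
    have "1/4 \<le> D" unfolding D_def by (rule Ab_bounds[OF a])
    then have D: "D \<noteq> 0" by auto
    have "(y * (D - c) + \<alpha> * (D - c) + c * (\<alpha> * (1 - C) + \<beta> * S)) * (1 / D)
        = y - c * (y + \<alpha> * C - \<beta> * S) / D + \<alpha>" for y c C S
      using D by (simp add: field_simps)
    then show "(Y w * (A h w * b h t w - b0 t) + \<alpha> * (A h w * b h t w - b0 t)
      + b0 t * (\<alpha> * (1 - cos (h * \<Phi> w)) + \<beta> * sin (h * \<Phi> w))) * (1 / (A h w * b h t w)) = Q h t w + \<alpha>"
      unfolding Q_def D_def .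
  qed
qed

lemma lip_order_N3: "lip_order 1 N3"
proof -
  have 1: "lip_order 0 (\<lambda>h t w. 1 / A h w)"
    by (rule lip_order_inverse[OF lip_order_A]) (use A_bounds in force)
  have 2: "lip_order 1 (\<lambda>h t w. ((A h w - 1) + (1 - cos (h * \<Phi> w))) / h)"
    by (rule lip_order_div_h, rule lip_order_weaken[OF lip_order_add[OF lip_order_A_minus_1 lip_order_cos]]) simp
  have "lip_order 1 (\<lambda>h t w. ((A h w - 1) + (1 - cos (h * \<Phi> w))) / h * (1 / A h w))"
    by (rule lip_order_mult_eq[OF 2 1]) simp
  then show ?thesis
  proof (rule lip_order_cong)
    fix h t and w :: state assume a: "0 < h" "h \<le> h1" "t \<in> {0..r}" "norm w \<le> R"
    define AA where "AA = A h w"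
    have "AA \<noteq> 0" using A_bounds[OF a(1,2,4)] by (simp add: AA_def)
    then have "((AA - 1) + (1 - C)) / h * (1 / AA) = (1 - C / AA) / h" for C
      using a(1) by (simp add: field_simps)
    then show "((A h w - 1) + (1 - cos (h * \<Phi> w))) / h * (1 / A h w) = N3 h t w"
      unfolding N3_def AA_def .
  qed
qed

definition N1 where "N1 h t w = P h t w + Q h t w"
definition N2 where "N2 h t w = P h t w - Q h t w"

lemma nonlinearity_bounds:
  obtains h2 L where "0 < h2" "h2 \<le> h1" "2 * h2 \<le> r" "0 \<le> L" "14 * L \<le> 1"
    "\<And>N h t w. \<lbrakk>N \<in> {N1, N2, N3}; 0 < h; h \<le> h2; t \<in> {0..r}; norm w \<le> R\<rbrakk> \<Longrightarrow> \<bar>N h t w\<bar> \<le> \<alpha> + 1"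
    "\<And>N h t w w'. \<lbrakk>N \<in> {N1, N2, N3}; 0 < h; h \<le> h2; t \<in> {0..r}; norm w \<le> R; norm w' \<le> R\<rbrakk>
       \<Longrightarrow> \<bar>N h t w - N h t w'\<bar> \<le> L * dist w w'"
proof -
  obtain K1 where K1: "0 \<le> K1" "lip_bound K1 1 P" by (rule lip_orderE[OF lip_order_P])
  note K1 = K1(1) lip_boundD[OF K1(2), unfolded power_one_right]
  obtain K2 where K2: "0 \<le> K2" "lip_bound K2 1 (\<lambda>h t w. Q h t w + \<alpha>)" by (rule lip_orderE[OF lip_order_Q])
  note K2 = K2(1) lip_boundD[OF K2(2), unfolded power_one_right]
  obtain K3 where K3: "0 \<le> K3" "lip_bound K3 1 N3" by (rule lip_orderE[OF lip_order_N3])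
  note K3 = K3(1) lip_boundD[OF K3(2), unfolded power_one_right]
  define K where "K = 1 + K1 + K2 + K3"
  have K: "1 \<le> K" "K1 + K2 \<le> K" "K3 \<le> K" using K1(1) K2(1) K3(1) by (auto simp: K_def)
  define h2 where "h2 = min h1 (min (r / 2) (1 / (14 * K)))"
  have h2: "0 < h2" "h2 \<le> h1" "2 * h2 \<le> r" "h2 \<le> 1 / (14 * K)"
    using h1_bounds r_pos K by (auto simp: h2_def min_def)
  have Kh: "K * h \<le> 1/14" if "0 < h" "h \<le> h2" for h
  proof -
    have "K * h \<le> K * (1 / (14 * K))" using that h2(4) K by (intro mult_left_mono) auto
    then show ?thesis using K by simp
  qed
  show thesis
  proof (rule that[of h2 "1/14"])
    fix N h t and w :: state assume a: "N \<in> {N1, N2, N3}" "0 < h" "h \<le> h2" "t \<in> {0..r}" "norm w \<le> R"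
    have hh: "h \<le> h1" using a(3) h2(2) by simp
    have k: "K1 * h + K2 * h \<le> 1/14" "K3 * h \<le> 1/14"
      using Kh[OF a(2,3)] mult_right_mono[OF K(2) less_imp_le[OF a(2)]]
        mult_right_mono[OF K(3) less_imp_le[OF a(2)]] unfolding distrib_right by linarith+
    note B = K1(2)[OF a(2) hh a(4,5)] K2(2)[OF a(2) hh a(4,5)] K3(2)[OF a(2) hh a(4,5)]
    have "\<bar>N1 h t w\<bar> \<le> \<alpha> + 1" "\<bar>N2 h t w\<bar> \<le> \<alpha> + 1" "\<bar>N3 h t w\<bar> \<le> \<alpha> + 1"
      using B k alpha_pos unfolding N1_def N2_def by linarith+
    then show "\<bar>N h t w\<bar> \<le> \<alpha> + 1" using a(1) by blast
    fix w' :: state assume w': "norm w' \<le> R"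
    note D = K1(3)[OF a(2) hh a(4,5) w'] K2(3)[OF a(2) hh a(4,5) w'] K3(3)[OF a(2) hh a(4,5) w']
    have d: "(K1 * h + K2 * h) * dist w w' \<le> 1/14 * dist w w'" "K3 * h * dist w w' \<le> 1/14 * dist w w'"
      by (rule mult_right_mono[OF k(1) zero_le_dist], rule mult_right_mono[OF k(2) zero_le_dist])
    have "\<bar>N1 h t w - N1 h t w'\<bar> \<le> K1 * h * dist w w' + K2 * h * dist w w'"
      "\<bar>N2 h t w - N2 h t w'\<bar> \<le> K1 * h * dist w w' + K2 * h * dist w w'"
      using D unfolding N1_def N2_def by linarith+
    then have "\<bar>N1 h t w - N1 h t w'\<bar> \<le> 1/14 * dist w w'" "\<bar>N2 h t w - N2 h t w'\<bar> \<le> 1/14 * dist w w'"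
      using d by (auto simp: distrib_right)
    moreover have "\<bar>N3 h t w - N3 h t w'\<bar> \<le> 1/14 * dist w w'" using D d by linarith
    ultimately show "\<bar>N h t w - N h t w'\<bar> \<le> 1/14 * dist w w'" using a(1) by blast
  qed (use h2 in auto)
qed

end

section \<open>A continuous family of solutions\<close>

text \<open>Uniform continuity on the compact rectangle.\<close>

lemma vanishing_on_slice_small:
  fixes G :: "real \<times> real \<Rightarrow> real"
  assumes "continuous_on ({ha..hb} \<times> {0..r}) G" and "\<And>t. t \<in> {0..r} \<Longrightarrow> G (k, t) = 0"
    and "k \<in> {ha..hb}" "0 < e"
  obtains d where "0 < d" "\<And>h t. \<lbrakk>h \<in> {ha..hb}; t \<in> {0..r}; \<bar>h - k\<bar> < d\<rbrakk> \<Longrightarrow> \<bar>G (h, t)\<bar> < e"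
proof -
  have "uniformly_continuous_on ({ha..hb} \<times> {0..r}) G"
    by (intro compact_uniformly_continuous assms(1) compact_Times compact_Icc)
  then obtain d where d: "0 < d" "\<And>p p'. \<lbrakk>p \<in> {ha..hb} \<times> {0..r}; p' \<in> {ha..hb} \<times> {0..r}; dist p' p < d\<rbrakk> \<Longrightarrow> dist (G p') (G p) < e"
    using assms(4) unfolding uniformly_continuous_on_def by metis
  have "\<bar>G (h, t)\<bar> < e" if "h \<in> {ha..hb}" "t \<in> {0..r}" "\<bar>h - k\<bar> < d" for h t
  proof -
    have "dist (h, t) (k, t) < d" using that by (simp add: dist_Pair_Pair dist_real_def)
    then have "dist (G (h, t)) (G (k, t)) < e" using d(2)[of "(k, t)" "(h, t)"] that assms(3) by simp
    then show ?thesis using assms(2)[OF that(2)] by (simp add: dist_real_def)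
  qed
  with d(1) show thesis by (rule that)
qed

context scaled_system
begin

definition rate where "rate h t = 1 / (h * b0 t)"

abbreviation "solves_at h \<equiv> dichotomy.solves r (rate h)"

lemma dichotomy_rate:
  assumes "0 < h" "2 * h \<le> r"
  shows "dichotomy r (1 / (2 * h)) (rate h)"
proof -
  have nz: "b0 t > 0" if "t \<in> {0..r}" for t using b0_bounds[OF that] by linarith
  have cont: "continuous_on {0..r} (rate h)"
  proof -
    have "h * (1 - \<beta> * t) \<noteq> 0" if "t \<in> {0..r}" for t
      using nz[OF that] assms(1) by (simp add: b0_def)
    then show ?thesis unfolding rate_def b0_def by (intro continuous_intros) auto
  qed
  have low: "1 / (2 * h) \<le> rate h t" if t: "t \<in> {0..r}" for t
  proof -
    have "h * b0 t \<le> h * 2" using b0_bounds[OF t] assms(1) by (intro mult_left_mono) auto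
    then show ?thesis
      using nz[OF t] assms(1) unfolding rate_def by (intro divide_left_mono) (auto simp: mult.commute)
  qed
  show ?thesis
    by unfold_locales (use assms r_pos r_le_1 cont low in auto)
qed

lemma joint_continuity:
  assumes N: "N \<in> {N1, N2, N3}" and h: "0 < ha" "hb \<le> h1"
    and w: "continuous_on {0..r} w" "\<And>t. t \<in> {0..r} \<Longrightarrow> norm (w t) \<le> R"
  shows "continuous_on ({ha..hb} \<times> {0..r}) (\<lambda>p. N (fst p) (snd p) (w (snd p)))"
proof -
  let ?S = "{ha..hb} \<times> {0..r}"
  have wc: "continuous_on ?S (\<lambda>p. w (snd p))"
    by (rule continuous_on_compose2[OF w(1)]) (auto intro: continuous_intros)
  have Ac: "continuous_on ?S (\<lambda>p. A (fst p) (w (snd p)))"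
    unfolding A_def by (intro continuous_intros wc) auto
  have bc: "continuous_on ?S (\<lambda>p. b (fst p) (snd p) (w (snd p)))"
    unfolding b_def by (intro continuous_intros wc) auto
  have b0c: "continuous_on ?S (\<lambda>p. b0 (snd p))"
    unfolding b0_def by (intro continuous_intros)
  have nz: "fst p \<noteq> 0" "A (fst p) (w (snd p)) \<noteq> 0" "b (fst p) (snd p) (w (snd p)) \<noteq> 0" if p: "p \<in> ?S" for p
  proof -
    have p': "0 < fst p" "fst p \<le> h1" "snd p \<in> {0..r}" using p h by auto
    show "fst p \<noteq> 0" using p' by simp
    show "A (fst p) (w (snd p)) \<noteq> 0" using A_bounds[OF p'(1,2) w(2)[OF p'(3)]] by auto
    show "b (fst p) (snd p) (w (snd p)) \<noteq> 0" using b_bounds[OF p' w(2)[OF p'(3)]] by auto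
  qed
  have P: "continuous_on ?S (\<lambda>p. P (fst p) (snd p) (w (snd p)))"
    unfolding P_def by (intro continuous_intros wc bc b0c) (use nz in auto)
  have Q: "continuous_on ?S (\<lambda>p. Q (fst p) (snd p) (w (snd p)))"
    unfolding Q_def by (intro continuous_intros wc bc Ac b0c) (use nz in auto)
  have N3: "continuous_on ?S (\<lambda>p. N3 (fst p) (snd p) (w (snd p)))"
    unfolding N3_def by (intro continuous_intros wc Ac) (use nz in auto)
  show ?thesis using N continuous_on_add[OF P Q] continuous_on_diff[OF P Q] N3
    by (auto simp: N1_def[abs_def] N2_def[abs_def])
qed

text \<open>For continuity at \<open>k\<close>, the solution \<open>v\<close> at \<open>k\<close> is read as a solution of the linear problem at a nearby \<open>h\<close>, with
  sources \<open>F1\<close>, \<open>F2\<close>, \<open>F3\<close>.  They differ from the true sources at \<open>h\<close> by little, and the contraction estimate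
  turns this into closeness of the solutions.\<close>

lemma solution_family:
  obtains h0 w where "0 < h0" "h0 \<le> h1"
    "\<And>h t. \<lbrakk>0 < h; h \<le> h0; t \<in> {0..r}\<rbrakk> \<Longrightarrow> norm (w h t) \<le> R"
    "\<And>h. \<lbrakk>0 < h; h \<le> h0\<rbrakk> \<Longrightarrow>
       solves_at h (\<lambda>t. N1 h t (w h t)) (\<lambda>t. N2 h t (w h t)) (\<lambda>t. N3 h t (w h t)) (w h)"
    "continuous_on {0<..h0} (\<lambda>h. W (w h r))"
proof -
  obtain h0 L where h0: "0 < h0" "h0 \<le> h1" "2 * h0 \<le> r" and L: "0 \<le> L" "14 * L \<le> 1"
    and bound: "\<And>N h t w. \<lbrakk>N \<in> {N1, N2, N3}; 0 < h; h \<le> h0; t \<in> {0..r}; norm w \<le> R\<rbrakk> \<Longrightarrow> \<bar>N h t w\<bar> \<le> \<alpha> + 1"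
    and lip: "\<And>N h t w w'. \<lbrakk>N \<in> {N1, N2, N3}; 0 < h; h \<le> h0; t \<in> {0..r}; norm w \<le> R; norm w' \<le> R\<rbrakk>
       \<Longrightarrow> \<bar>N h t w - N h t w'\<bar> \<le> L * dist w w'"
    using nonlinearity_bounds by blast
  have single: "continuous_on {0..r} (\<lambda>t. N h t (w t))"
    if "N \<in> {N1, N2, N3}" "0 < h" "h \<le> h0" "continuous_on {0..r} w" "\<And>t. t \<in> {0..r} \<Longrightarrow> norm (w t) \<le> R" for N h w
  proof -
    have "continuous_on ({h..h} \<times> {0..r}) (\<lambda>p. N (fst p) (snd p) (w (snd p)))"
      using joint_continuity[OF that(1,2) _ that(4,5), of h] that(3) h0(2) by simp
    moreover have "continuous_on {0..r} (\<lambda>t. (h, t))" by (intro continuous_intros)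
    ultimately have "continuous_on {0..r} (\<lambda>t. N (fst (h, t)) (snd (h, t)) (w (snd (h, t))))"
      by (rule continuous_on_compose2) auto
    then show ?thesis by simp
  qed
  have "\<exists>w. (\<forall>t\<in>{0..r}. norm (w t) \<le> R) \<and>
      solves_at h (\<lambda>t. N1 h t (w t)) (\<lambda>t. N2 h t (w t)) (\<lambda>t. N3 h t (w t)) w" if h: "0 < h" "h \<le> h0" for h
  proof -
    interpret H: dichotomy r "1 / (2 * h)" "rate h" by (rule dichotomy_rate) (use h h0 in auto)
    show ?thesis
    proof (rule H.nonlinear_exists[where M = "\<alpha> + 1" and L = L])
      fix N and w :: "real \<Rightarrow> state" assume "N \<in> {N1 h, N2 h, N3 h}" "continuous_on {0..r} w" "\<And>t. t \<in> {0..r} \<Longrightarrow> norm (w t) \<le> R"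
      then show "continuous_on {0..r} (\<lambda>t. N t (w t))" using single[OF _ h] by blast
    next
      fix N t and w :: state assume "N \<in> {N1 h, N2 h, N3 h}" "t \<in> {0..r}" "norm w \<le> R"
      then show "\<bar>N t w\<bar> \<le> \<alpha> + 1" using bound[OF _ h] by blast
    next
      fix N t and w w' :: state assume "N \<in> {N1 h, N2 h, N3 h}" "t \<in> {0..r}" "norm w \<le> R" "norm w' \<le> R"
      then show "\<bar>N t w - N t w'\<bar> \<le> L * dist w w'" using lip[OF _ h] by blast
    qed (use L alpha_pos in \<open>auto simp: R_def\<close>)
  qed
  then obtain w where wR: "\<And>h t. \<lbrakk>0 < h; h \<le> h0; t \<in> {0..r}\<rbrakk> \<Longrightarrow> norm (w h t) \<le> R"
    and ws: "\<And>h. \<lbrakk>0 < h; h \<le> h0\<rbrakk> \<Longrightarrow>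
       solves_at h (\<lambda>t. N1 h t (w h t)) (\<lambda>t. N2 h t (w h t)) (\<lambda>t. N3 h t (w h t)) (w h)"
    by metis
  have "continuous_on {0<..h0} (\<lambda>h. W (w h r))"
    unfolding continuous_on_iff
  proof (intro ballI allI impI)
    fix k e :: real assume k: "k \<in> {0<..h0}" and e: "0 < e"
    then have k': "0 < k" "k \<le> h0" by auto
    interpret K: dichotomy r "1 / (2 * k)" "rate k" by (rule dichotomy_rate) (use k' h0 in auto)
    define v where "v = w k"
    have vs: "solves_at k (\<lambda>t. N1 k t (v t)) (\<lambda>t. N2 k t (v t)) (\<lambda>t. N3 k t (v t)) v"
      and vR: "\<And>t. t \<in> {0..r} \<Longrightarrow> norm (v t) \<le> R" using ws[OF k'] wR[OF k'] by (auto simp: v_def)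
    have vc: "continuous_on {0..r} v" by (rule K.solves_continuous[OF vs])
    have vc': "continuous_on ({k/2..h0} \<times> {0..r}) (\<lambda>p. v (snd p))"
      by (rule continuous_on_compose2[OF vc]) (auto intro: continuous_intros)
    \<comment> \<open>The factor \<open>fst p / k\<close> converts the rate at \<open>k\<close> into the rate at \<open>fst p\<close>.\<close>
    define F1 where "F1 p = fst (v (snd p)) + (fst p / k) * (- fst (v (snd p)) + N1 k (snd p) (v (snd p)))" for p
    define F2 where "F2 p = - fst (snd (v (snd p))) + (fst p / k) * (fst (snd (v (snd p))) + N2 k (snd p) (v (snd p)))" for p
    define F3 where "F3 p = N3 k (snd p) (v (snd p))" for p :: "real \<times> real"
    have Nk: "continuous_on ({k/2..h0} \<times> {0..r}) (\<lambda>p. N k (snd p) (v (snd p)))" if "N \<in> {N1, N2, N3}" for N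
      by (rule continuous_on_compose2[OF single[OF that k' vc vR]]) (auto intro: continuous_intros)
    have Fc: "continuous_on ({k/2..h0} \<times> {0..r}) F1" "continuous_on ({k/2..h0} \<times> {0..r}) F2"
       "continuous_on ({k/2..h0} \<times> {0..r}) F3"
      unfolding F1_def F2_def F3_def using k'
      by (intro continuous_intros vc' Nk; simp)+
    have Nc: "continuous_on ({k/2..h0} \<times> {0..r}) (\<lambda>p. N (fst p) (snd p) (v (snd p)))" if "N \<in> {N1, N2, N3}" for N
      by (rule joint_continuity[OF that _ _ vc vR]) (use k' h0 in auto)
    have G: "continuous_on ({k/2..h0} \<times> {0..r}) (\<lambda>p. N1 (fst p) (snd p) (v (snd p)) - F1 p)"
      "continuous_on ({k/2..h0} \<times> {0..r}) (\<lambda>p. N2 (fst p) (snd p) (v (snd p)) - F2 p)"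
      "continuous_on ({k/2..h0} \<times> {0..r}) (\<lambda>p. N3 (fst p) (snd p) (v (snd p)) - F3 p)"
      using Nc Fc by (auto intro!: continuous_on_diff)
    have e': "0 < e / 28" and kin: "k \<in> {k/2..h0}" using e k' by auto
    have z: "N1 k t (v t) - F1 (k, t) = 0" "N2 k t (v t) - F2 (k, t) = 0" "N3 k t (v t) - F3 (k, t) = 0" for t
      using k' by (simp_all add: F1_def F2_def F3_def)
    obtain d1 where d1: "0 < d1" "\<And>h t. \<lbrakk>h \<in> {k/2..h0}; t \<in> {0..r}; \<bar>h - k\<bar> < d1\<rbrakk> \<Longrightarrow> \<bar>N1 h t (v t) - F1 (h, t)\<bar> < e / 28"
      using vanishing_on_slice_small[OF G(1) _ kin e'] z by auto
    obtain d2 where d2: "0 < d2" "\<And>h t. \<lbrakk>h \<in> {k/2..h0}; t \<in> {0..r}; \<bar>h - k\<bar> < d2\<rbrakk> \<Longrightarrow> \<bar>N2 h t (v t) - F2 (h, t)\<bar> < e / 28"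
      using vanishing_on_slice_small[OF G(2) _ kin e'] z by auto
    obtain d3 where d3: "0 < d3" "\<And>h t. \<lbrakk>h \<in> {k/2..h0}; t \<in> {0..r}; \<bar>h - k\<bar> < d3\<rbrakk> \<Longrightarrow> \<bar>N3 h t (v t) - F3 (h, t)\<bar> < e / 28"
      using vanishing_on_slice_small[OF G(3) _ kin e'] z by auto
    define d where "d = min (k/2) (min d1 (min d2 d3))"
    have d: "0 < d" "d \<le> k/2" "d \<le> d1" "d \<le> d2" "d \<le> d3" using k' d1 d2 d3 by (auto simp: d_def)
    show "\<exists>d>0. \<forall>h\<in>{0<..h0}. dist h k < d \<longrightarrow> dist (W (w h r)) (W (w k r)) < e"
    proof (intro exI[of _ d] conjI ballI impI d(1))
      fix h assume "h \<in> {0<..h0}" "dist h k < d"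
      then have h: "0 < h" "h \<le> h0" "\<bar>h - k\<bar> < d" by (auto simp: dist_real_def)
      then have hin: "h \<in> {k/2..h0}" using d(2) by (auto simp: abs_less_iff)
      interpret H: dichotomy r "1 / (2 * h)" "rate h" by (rule dichotomy_rate) (use h h0 in auto)
      have rk: "rate k t = rate h t * (h / k)" for t using h k' by (simp add: rate_def)
      have "H.solves (\<lambda>t. F1 (h, t)) (\<lambda>t. F2 (h, t)) (\<lambda>t. F3 (h, t)) v"
        using vs unfolding H.solves_def K.solves_def by (simp add: F1_def F2_def F3_def rk mult.assoc)
      from H.solves_diff[OF ws[OF h(1,2)] this]
      have sd: "H.solves (\<lambda>t. N1 h t (w h t) - F1 (h, t)) (\<lambda>t. N2 h t (w h t) - F2 (h, t))
          (\<lambda>t. N3 h t (w h t) - F3 (h, t)) (\<lambda>t. w h t - v t)" .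
      obtain s where s: "s \<in> {0..r}" "\<And>t. t \<in> {0..r} \<Longrightarrow> norm (w h t - v t) \<le> norm (w h s - v s)"
        using continuous_attains_sup[OF compact_Icc _ continuous_on_norm[OF H.solves_continuous[OF sd]]] r_pos by auto
      \<comment> \<open>The largest distance between the two solutions.\<close>
      define D where "D = norm (w h s - v s)"
      have src: "\<bar>N h t (w h t) - Fv\<bar> \<le> L * D + e / 28"
        if "N \<in> {N1, N2, N3}" "t \<in> {0..r}" "\<bar>N h t (v t) - Fv\<bar> < e / 28" for N t Fv
      proof -
        have "\<bar>N h t (w h t) - N h t (v t)\<bar> \<le> L * dist (w h t) (v t)"
          by (rule lip[OF that(1) h(1,2) that(2) wR[OF h(1,2) that(2)] vR[OF that(2)]])
        also have "\<dots> \<le> L * D" using s(2)[OF that(2)] L(1) by (intro mult_left_mono) (auto simp: D_def dist_norm)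
        finally show ?thesis using that(3) by linarith
      qed
      have "norm (w h t - v t) \<le> 7 * (L * D + e / 28)" if "t \<in> {0..r}" for t
        by (rule H.solves_bound[OF sd _ that])
           (use src d1(2)[OF hin] d2(2)[OF hin] d3(2)[OF hin] h(3) d in auto)
      note nb = this
      have "14 * L * D \<le> 1 * D" using L(2) by (intro mult_right_mono) (auto simp: D_def)
      then have "D \<le> e / 2" using nb[OF s(1)] by (simp add: D_def[symmetric])
      moreover have "norm (w h r - v r) \<le> D" unfolding D_def by (rule s(2)) (use r_pos in auto)
      moreover have "\<bar>W (w h r - v r)\<bar> \<le> norm (w h r - v r)" by (rule component_bounds(3))
      ultimately show "dist (W (w h r)) (W (w k r)) < e" using e by (simp add: v_def dist_real_def)
    qed
  qed
  with h0(1,2) wR ws show thesis by (rule that)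
qed

end

section \<open>Normal geodesics and the reflected angle\<close>

lemma pos_of_nonzero_continuous:
  fixes f :: "real \<Rightarrow> real"
  assumes "continuous_on {0..r} f" "0 < f 0" "\<And>t. t \<in> {0..r} \<Longrightarrow> f t \<noteq> 0" "t \<in> {0..r}"
  shows "0 < f t"
proof (rule ccontr)
  assume "\<not> 0 < f t"
  then obtain s where "0 \<le> s" "s \<le> t" "f s = 0"
    using IVT2'[of f t 0 0] assms(2,4) continuous_on_subset[OF assms(1), of "{0..t}"] by auto
  then show False using assms(3)[of s] assms(4) by auto
qed

lemma sqrt_metric:
  "0 < 1 + \<alpha> * y \<Longrightarrow> sqrt (metric_a \<alpha> x y) = 1 + \<alpha> * y"
  "0 < 1 + \<beta> * x + \<gamma> * y \<Longrightarrow> sqrt (metric_c \<beta> \<gamma> x y) = 1 + \<beta> * x + \<gamma> * y"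
  by (simp_all add: metric_a_def metric_c_def)

lemma (in reflected_geodesic) is_normal_geodesic:
  "normal_geodesic \<alpha> \<beta> \<gamma> r lam x y z (\<lambda>t. pi + \<phi> t)" "first_return r y"
proof -
  show "first_return r y"
    using return y_neg by (force simp: first_return_def)
  show "normal_geodesic \<alpha> \<beta> \<gamma> r lam x y z (\<lambda>t. pi + \<phi> t)"
    unfolding normal_geodesic_def Let_def
  proof (intro conjI ballI start)
    fix t assume t: "t \<in> {0..r}"
    note sq = sqrt_metric(1)[OF A_pos[OF t], of "x t"] sqrt_metric(2)[OF b_pos[OF t]]
    show "0 < metric_a \<alpha> (x t) (y t)" "0 < metric_c \<beta> \<gamma> (x t) (y t)"
      using A_pos[OF t] b_pos[OF t] by (simp_all add: metric_a_def metric_c_def)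
    show "(x has_real_derivative cos (pi + \<phi> t) / sqrt (metric_a \<alpha> (x t) (y t))) (at t within {0..r})"
      unfolding sq using dx[OF t] by (simp add: cos_add)
    show "(y has_real_derivative sin (pi + \<phi> t) / sqrt (metric_c \<beta> \<gamma> (x t) (y t))) (at t within {0..r})"
      unfolding sq using dy[OF t] by (simp add: sin_add)
    show "(z has_real_derivative (y t)^2 / 2 * (cos (pi + \<phi> t) / sqrt (metric_a \<alpha> (x t) (y t)))) (at t within {0..r})"
      unfolding sq using dz[OF t] by (simp add: cos_add)
    have "((\<lambda>t. pi + \<phi> t) has_real_derivative 0 + - ((lam * y t + \<alpha> * cos (\<phi> t) - \<beta> * sin (\<phi> t)) / (A t * b t))) (at t within {0..r})"
      by (intro DERIV_add DERIV_const dphi[OF t])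
    then show "((\<lambda>t. pi + \<phi> t) has_real_derivative
        - (1 / (sqrt (metric_a \<alpha> (x t) (y t)) * sqrt (metric_c \<beta> \<gamma> (x t) (y t)))) *
         (lam * y t - \<alpha> * cos (pi + \<phi> t) + \<beta> * sin (pi + \<phi> t))) (at t within {0..r})"
      unfolding sq by (simp add: cos_add sin_add)
  qed
qed

text \<open>The coefficients \<open>A\<close> and \<open>b\<close> never vanish because the metric stays positive, and they equal \<open>1\<close> at the
  start, so they are the positive square roots of \<open>a\<close> and \<open>c\<close>.\<close>

lemma normal_geodesic_reflected:
  assumes ng: "normal_geodesic \<alpha> \<beta> \<gamma> r lam x y z \<theta>" and ret: "y r = 0"
    and pos: "\<alpha> > 0" "r > 0" "lam > 0"
    and close: "\<And>t. t \<in> {0..r} \<Longrightarrow> \<bar>\<theta> t - (pi + 2 * pi * of_int k)\<bar> < 1"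
  shows "reflected_geodesic \<alpha> \<beta> \<gamma> r lam x y z (\<lambda>t. \<theta> t - (pi + 2 * pi * of_int k))"
proof -
  define \<phi> where "\<phi> t = \<theta> t - (pi + 2 * pi * of_int k)" for t
  have th: "\<theta> t = pi + \<phi> t + 2 * pi * of_int k" for t by (simp add: \<phi>_def)
  have period: "cos (u + 2 * pi * of_int k) = cos u" "sin (u + 2 * pi * of_int k) = sin u" for u
    using cos_int_2pin[of k] sin_int_2pin[of k] by (simp_all add: cos_add sin_add)
  have tr: "cos (\<theta> t) = - cos (\<phi> t)" "sin (\<theta> t) = - sin (\<phi> t)" for t
    unfolding th period by (simp_all add: cos_add sin_add)
  define a c where "a t = metric_a \<alpha> (x t) (y t)" and "c t = metric_c \<beta> \<gamma> (x t) (y t)" for t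
  have start: "x 0 = 0" "y 0 = 0" "z 0 = 0" using ng by (auto simp: normal_geodesic_def)
  have D: "a t > 0" "c t > 0"
    "(x has_real_derivative cos (\<theta> t) / sqrt (a t)) (at t within {0..r})"
    "(y has_real_derivative sin (\<theta> t) / sqrt (c t)) (at t within {0..r})"
    "(z has_real_derivative (y t)^2 / 2 * (cos (\<theta> t) / sqrt (a t))) (at t within {0..r})"
    "(\<theta> has_real_derivative - (1 / (sqrt (a t) * sqrt (c t))) * (lam * y t - \<alpha> * cos (\<theta> t) + \<beta> * sin (\<theta> t))) (at t within {0..r})"
    if "t \<in> {0..r}" for t
    using ng that unfolding normal_geodesic_def Let_def a_def c_def by blast+
  have xc: "continuous_on {0..r} x" and yc: "continuous_on {0..r} y"
    by (auto intro: DERIV_continuous_on[OF D(3)] DERIV_continuous_on[OF D(4)])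
  have A: "0 < 1 + \<alpha> * y t" if t: "t \<in> {0..r}" for t
  proof (rule pos_of_nonzero_continuous[OF _ _ _ t])
    show "continuous_on {0..r} (\<lambda>t. 1 + \<alpha> * y t)" by (intro continuous_intros yc)
    show "1 + \<alpha> * y t \<noteq> 0" if "t \<in> {0..r}" for t using D(1)[OF that] by (auto simp: a_def metric_a_def)
  qed (simp add: start)
  have B: "0 < 1 + \<beta> * x t + \<gamma> * y t" if t: "t \<in> {0..r}" for t
  proof (rule pos_of_nonzero_continuous[OF _ _ _ t])
    show "continuous_on {0..r} (\<lambda>t. 1 + \<beta> * x t + \<gamma> * y t)" by (intro continuous_intros xc yc)
    show "1 + \<beta> * x t + \<gamma> * y t \<noteq> 0" if "t \<in> {0..r}" for t using D(2)[OF that] by (auto simp: c_def metric_c_def)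
  qed (simp add: start)
  have "reflected_geodesic \<alpha> \<beta> \<gamma> r lam x y z \<phi>"
  proof
    fix t assume t: "t \<in> {0..r}"
    have sq: "sqrt (a t) = 1 + \<alpha> * y t" "sqrt (c t) = 1 + \<beta> * x t + \<gamma> * y t"
      using sqrt_metric(1)[OF A[OF t]] sqrt_metric(2)[OF B[OF t]] by (simp_all add: a_def c_def)
    show "0 < 1 + \<alpha> * y t" "0 < 1 + \<beta> * x t + \<gamma> * y t" using A[OF t] B[OF t] .
    show "(x has_real_derivative - (cos (\<phi> t) / (1 + \<alpha> * y t))) (at t within {0..r})"
      "(y has_real_derivative - (sin (\<phi> t) / (1 + \<beta> * x t + \<gamma> * y t))) (at t within {0..r})"
      "(z has_real_derivative - ((y t)^2 / 2 * (cos (\<phi> t) / (1 + \<alpha> * y t)))) (at t within {0..r})"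
      using D(3-5)[OF t] unfolding sq tr by simp_all
    have "(\<phi> has_real_derivative - (1 / ((1 + \<alpha> * y t) * (1 + \<beta> * x t + \<gamma> * y t))) * (lam * y t - \<alpha> * - cos (\<phi> t) + \<beta> * - sin (\<phi> t)) - 0) (at t within {0..r})"
      using DERIV_diff[OF D(6)[OF t] DERIV_const] unfolding sq tr \<phi>_def[abs_def] by simp
    then show "(\<phi> has_real_derivative - ((lam * y t + \<alpha> * cos (\<phi> t) - \<beta> * sin (\<phi> t)) /
         ((1 + \<alpha> * y t) * (1 + \<beta> * x t + \<gamma> * y t)))) (at t within {0..r})"
      by simp
    show "\<bar>\<phi> t\<bar> < 1" using close[OF t] by (simp add: \<phi>_def)
  qed (use pos start ret in auto)
  then show ?thesis by (simp add: \<phi>_def[abs_def])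
qed

context scaled_system
begin

text \<open>Undoing the scaling \<open>y = h^2 Y\<close>, \<open>\<phi> = h \<Phi>\<close>, \<open>x = h W - t\<close>; the height \<open>z\<close> is a primitive.\<close>

lemma solution_is_geodesic:
  assumes h: "0 < h" "h \<le> h1" "2 * h \<le> r"
    and wR: "\<And>t. t \<in> {0..r} \<Longrightarrow> norm (w t) \<le> R"
    and ws: "solves_at h (\<lambda>t. N1 h t (w t)) (\<lambda>t. N2 h t (w t)) (\<lambda>t. N3 h t (w t)) w"
  obtains y z \<phi> where
    "thin_geodesic \<alpha> \<beta> \<gamma> r (1 / h^2) (\<lambda>t. h * W (w t) - t) y z \<phi> m h"
proof -
  interpret H: dichotomy r "1 / (2 * h)" "rate h" by (rule dichotomy_rate[OF h(1,3)])
  define x y \<phi> where "x t = h * W (w t) - t" and "y t = h^2 * Y (w t)" and "\<phi> t = h * \<Phi> (w t)" for t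
  have A: "A h (w t) = 1 + \<alpha> * y t" and B: "b h t (w t) = 1 + \<beta> * x t + \<gamma> * y t" for t
    by (simp_all add: A_def b_def x_def y_def)
  have S: "((\<lambda>t. fst (w t)) has_real_derivative rate h t * (- fst (w t) + N1 h t (w t))) (at t within {0..r})"
    "((\<lambda>t. fst (snd (w t))) has_real_derivative rate h t * (fst (snd (w t)) + N2 h t (w t))) (at t within {0..r})"
    "((\<lambda>t. W (w t)) has_real_derivative N3 h t (w t)) (at t within {0..r})" if "t \<in> {0..r}" for t
    using ws that unfolding H.solves_def by blast+
  have bc: "fst (w 0) + fst (snd (w 0)) = 0" "fst (w r) + fst (snd (w r)) = 0" "W (w 0) = 0"
    using ws unfolding H.solves_def by blast+
  have pos: "0 < 1 + \<alpha> * y t" "0 < 1 + \<beta> * x t + \<gamma> * y t" "0 < b0 t" if t: "t \<in> {0..r}" for t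
    using A_bounds[OF h(1,2) wR[OF t]] b_bounds[OF h(1,2) t wR[OF t]] b0_bounds[OF t] unfolding A B by linarith+
  have dx: "(x has_real_derivative - (cos (\<phi> t) / (1 + \<alpha> * y t))) (at t within {0..r})" if t: "t \<in> {0..r}" for t
  proof -
    have "(x has_real_derivative h * N3 h t (w t) - 1) (at t within {0..r})"
      unfolding x_def by (intro DERIV_diff DERIV_cmult S(3)[OF t] DERIV_ident)
    then show ?thesis using h(1) by (simp add: N3_def A \<phi>_def)
  qed
  have dy: "(y has_real_derivative - (sin (\<phi> t) / (1 + \<beta> * x t + \<gamma> * y t))) (at t within {0..r})" if t: "t \<in> {0..r}" for t
  proof -
    have "(y has_real_derivative h^2 * ((rate h t * (- fst (w t) + N1 h t (w t)) + rate h t * (fst (snd (w t)) + N2 h t (w t))) / 2)) (at t within {0..r})"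
      unfolding y_def by (intro DERIV_cmult DERIV_cdivide DERIV_add S[OF t])
    moreover have "(rate h t * (- fst (w t) + N1 h t (w t)) + rate h t * (fst (snd (w t)) + N2 h t (w t))) / 2
        = rate h t * (P h t (w t) - \<Phi> (w t))"
      by (simp add: N1_def N2_def field_simps)
    moreover have "P h t (w t) - \<Phi> (w t) = - (b0 t * (sin (\<phi> t) / h) / (1 + \<beta> * x t + \<gamma> * y t))"
      by (simp add: P_def B \<phi>_def)
    moreover have "h^2 * (rate h t * - (b0 t * (S / h) / b')) = - (S / b')" for S b'
      using h(1) pos(3)[OF t] by (simp add: rate_def power2_eq_square)
    ultimately show ?thesis by simp
  qed
  have dphi: "(\<phi> has_real_derivative - ((1 / h^2 * y t + \<alpha> * cos (\<phi> t) - \<beta> * sin (\<phi> t)) /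
         ((1 + \<alpha> * y t) * (1 + \<beta> * x t + \<gamma> * y t)))) (at t within {0..r})" if t: "t \<in> {0..r}" for t
  proof -
    have "(\<phi> has_real_derivative h * ((rate h t * (- fst (w t) + N1 h t (w t)) - rate h t * (fst (snd (w t)) + N2 h t (w t))) / 2)) (at t within {0..r})"
      unfolding \<phi>_def by (intro DERIV_cmult DERIV_cdivide DERIV_diff S[OF t])
    moreover have "(rate h t * (- fst (w t) + N1 h t (w t)) - rate h t * (fst (snd (w t)) + N2 h t (w t))) / 2
        = rate h t * (Q h t (w t) - Y (w t))"
      by (simp add: N1_def N2_def field_simps)
    moreover have "Q h t (w t) - Y (w t) = - (b0 t * (1 / h^2 * y t + \<alpha> * cos (\<phi> t) - \<beta> * sin (\<phi> t)) / ((1 + \<alpha> * y t) * (1 + \<beta> * x t + \<gamma> * y t)))"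
      unfolding Q_def A B \<phi>_def[symmetric] using h(1) by (simp add: y_def)
    moreover have "h * (rate h t * - (b0 t * V / D)) = - (V / D)" for V D
      using h(1) pos(3)[OF t] by (simp add: rate_def)
    ultimately show ?thesis by (simp only:)
  qed
  have cx: "continuous_on {0..r} y" "continuous_on {0..r} \<phi>"
    by (auto intro: DERIV_continuous_on[OF dy] DERIV_continuous_on[OF dphi])
  have "continuous_on {0..r} (\<lambda>t. - ((y t)^2 / 2 * (cos (\<phi> t) / (1 + \<alpha> * y t))))"
    using pos(1) by (intro continuous_intros cx) force+
  then obtain z where z: "z 0 = 0" "\<And>t. t \<in> {0..r} \<Longrightarrow>
      (z has_real_derivative - ((y t)^2 / 2 * (cos (\<phi> t) / (1 + \<alpha> * y t)))) (at t within {0..r})"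
    using antiderivative by blast
  have mhR: "m * h * (R + 1) \<le> 1/8"
    using mult_right_mono[OF mult_left_mono[OF h(2), of m], of "R + 1"] m_ge R_pos h1_bounds(3) by simp
  have hR: "h * R < 1"
  proof -
    have "1 * (h * R) \<le> m * (h * (R + 1))" using m_ge h(1) R_pos by (intro mult_mono) auto
    then show ?thesis using mhR unfolding mult.assoc by linarith
  qed
  have mh: "12 * m * h \<le> 1"
  proof -
    have "m * h * 8 \<le> m * h * (R + 1)" using R_pos m_ge h(1) by (intro mult_left_mono) auto
    then show ?thesis using mhR by linarith
  qed
  have small: "\<bar>\<phi> t\<bar> < 1" if t: "t \<in> {0..r}" for t
  proof -
    have "\<bar>\<phi> t\<bar> = h * \<bar>\<Phi> (w t)\<bar>" using h(1) by (simp add: \<phi>_def abs_mult)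
    also have "\<dots> \<le> h * R" using component_bounds(2)[of "w t"] wR[OF t] h(1) by (intro mult_left_mono) auto
    finally show ?thesis using hR by simp
  qed
  have "thin_geodesic \<alpha> \<beta> \<gamma> r (1 / h^2) x y z \<phi> m h"
    by unfold_locales
       (use alpha_pos r_pos h z pos dx dy dphi small bc mh m_def r_small in \<open>auto simp: x_def y_def\<close>)
  then show thesis using that by (simp add: x_def[abs_def])
qed

end

section \<open>The branch as a graph\<close>

context scaled_system
begin

text \<open>All geodesics at parameter \<open>h\<close> are admitted, not just the one found by contraction: the branch consists of
  every geodesic in the tube.\<close>

definition endpoint :: "real \<Rightarrow> real \<times> real \<Rightarrow> bool" where
  "endpoint h p \<longleftrightarrow> (\<exists>x y z \<phi>. thin_geodesic \<alpha> \<beta> \<gamma> r (1 / h^2) x y z \<phi> m h \<and> p = (x r, z r))"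

lemma endpoint_unique:
  assumes "endpoint h (x, z)" "endpoint k (x, z')"
  shows "z = z'"
  using assms endpoint_z_le unfolding endpoint_def by (metis order_antisym prod.inject)

lemma thin_geodesicI:
  assumes "reflected_geodesic \<alpha> \<beta> \<gamma> r (1 / h^2) x y z \<phi>" "0 < h" "12 * m * h \<le> 1"
  shows "thin_geodesic \<alpha> \<beta> \<gamma> r (1 / h^2) x y z \<phi> m h"
  by (intro thin_geodesic.intro assms(1) thin_geodesic_axioms.intro) (use assms m_def r_small in auto)

lemma branch_D1_endpoint:
  assumes "p \<in> branch_D1 \<alpha> \<beta> \<gamma> r \<delta> \<Lambda>" "\<delta> \<le> 1" "0 < k" "12 * m * k \<le> 1" "1 / k^2 \<le> \<Lambda>"
  obtains h where "0 < h" "h < k" "endpoint h p"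
proof -
  obtain lam x y z \<theta> j where ng: "normal_geodesic \<alpha> \<beta> \<gamma> r lam x y z \<theta>" and fr: "first_return r y"
    and lam: "lam > \<Lambda>" and close: "\<And>t. t \<in> {0..r} \<Longrightarrow> \<bar>\<theta> t - (pi + 2 * pi * of_int j)\<bar> < \<delta>"
    and p: "p = (x r, z r)"
    using assms(1) unfolding branch_D1_def by blast
  have k2: "0 < 1 / k^2" using assms(3) by simp
  then have lam0: "lam > 0" using lam assms(5) by linarith
  define h where "h = 1 / sqrt lam"
  have h: "0 < h" "1 / h^2 = lam" using lam0 by (simp_all add: h_def power_divide)
  have "1 / k^2 < 1 / h^2" using lam assms(5) h(2) by linarith
  then have "h^2 < k^2" using h(1) assms(3) by (simp add: frac_less2 divide_less_cancel field_simps)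
  then have hk: "h < k" using assms(3) by (simp add: power2_less_imp_less)
  have "12 * m * h \<le> 12 * m * k" using hk m_ge by (intro mult_left_mono) auto
  then have mh: "12 * m * h \<le> 1" using assms(4) by simp
  have "\<bar>\<theta> t - (pi + 2 * pi * of_int j)\<bar> < 1" if "t \<in> {0..r}" for t
    using close[OF that] assms(2) by linarith
  from normal_geodesic_reflected[OF ng _ alpha_pos r_pos lam0 this] fr
  have "reflected_geodesic \<alpha> \<beta> \<gamma> r lam x y z (\<lambda>t. \<theta> t - (pi + 2 * pi * of_int j))"
    by (simp add: first_return_def)
  then have "endpoint h p"
    unfolding endpoint_def p using thin_geodesicI[of h] h mh by metis
  with h(1) hk show thesis by (rule that)
qed

text \<open>The a priori bound on the angle puts the geodesic into any given tube once \<open>h\<close> is small.\<close>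

lemma endpoint_branch_D1:
  assumes "endpoint h p" "0 < h" "2 * \<alpha> * h < \<delta>" "\<Lambda> < 1 / h^2"
  shows "p \<in> branch_D1 \<alpha> \<beta> \<gamma> r \<delta> \<Lambda>"
proof -
  obtain x y z \<phi> where tg: "thin_geodesic \<alpha> \<beta> \<gamma> r (1 / h^2) x y z \<phi> m h" and p: "p = (x r, z r)"
    using assms(1) unfolding endpoint_def by blast
  interpret G: thin_geodesic \<alpha> \<beta> \<gamma> r "1 / h^2" x y z \<phi> m h by fact
  have "\<forall>t\<in>{0..r}. \<bar>(pi + \<phi> t) - (pi + 2 * pi * of_int 0)\<bar> < \<delta>"
    using G.abs_phi assms(3) by fastforce
  then show ?thesis
    unfolding branch_D1_def p using G.is_normal_geodesic assms(4) by blast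
qed

text \<open>Substituting \<open>X = - c h^2 + e\<close> with \<open>c = \<alpha>^2 / 2\<close> and \<open>e = O(h^3)\<close> into \<open>q X^2\<close>, with \<open>q = 2 / (r^2 \<alpha>^2)\<close>,
  cancels the leading term of \<open>Z\<close>, and \<open>h^2\<close> is comparable to \<open>- X\<close>.\<close>

lemma endpoint_estimates:
  obtains h3 K where "0 < h3" "0 \<le> K"
    "\<And>h X Z. \<lbrakk>0 < h; h \<le> h3; endpoint h (2 * r * X - r, r^3 * Z)\<rbrakk> \<Longrightarrow>
       \<alpha>^2 * h^2 / 4 \<le> - X \<and> - X \<le> \<alpha>^2 * h^2 \<and> \<bar>Z - (- 2 / (r^2 * \<alpha>^2)) * X^2\<bar> \<le> K * h * X^2"
proof -
  define c where "c = \<alpha>^2 / 2"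
  define K1 where "K1 = 42 * m^3 / r"
  define K2 where "K2 = 14 * m^3 / r^3"
  define q where "q = 2 / (r^2 * \<alpha>^2)"
  define K where "K = K2 + q * (2 * c * K1 + K1^2)"
  have c: "0 < c" using alpha_pos by (simp add: c_def)
  have K1: "0 < K1" "0 < K2" using m_ge r_pos by (simp_all add: K1_def K2_def)
  have q: "0 < q" using alpha_pos r_pos by (simp add: q_def)
  have K: "0 < K" using K1 q c by (auto simp: K_def intro!: add_pos_pos mult_pos_pos)
  define h3 where "h3 = min 1 (c / (2 * K1))"
  have h3: "0 < h3" using c K1 by (simp add: h3_def)
  show thesis
  proof (rule that[of h3 "4 * K / c^2"])
    fix h X Z assume h: "0 < h" "h \<le> h3" and ep: "endpoint h (2 * r * X - r, r^3 * Z)"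
    obtain x y z \<phi> where tg: "thin_geodesic \<alpha> \<beta> \<gamma> r (1 / h^2) x y z \<phi> m h"
      and p: "x r = 2 * r * X - r" "z r = r^3 * Z"
      using ep unfolding endpoint_def by auto
    interpret G: thin_geodesic \<alpha> \<beta> \<gamma> r "1 / h^2" x y z \<phi> m h by fact
    have h_le: "h \<le> 1" "K1 * h \<le> c / 2"
    proof -
      have "K1 * h \<le> K1 * (c / (2 * K1))" using h(2) K1 by (intro mult_left_mono) (auto simp: h3_def)
      then show "K1 * h \<le> c / 2" using K1 by simp
      show "h \<le> 1" using h(2) by (simp add: h3_def)
    qed
    define e where "e = X + c * h^2"
    have e: "\<bar>e\<bar> \<le> K1 * h^3"
    proof -
      have "\<bar>2 * r * e\<bar> \<le> 84 * (m * h)^3"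
        using G.endpoint_x_upper G.endpoint_x_lower unfolding p
        by (simp add: e_def c_def abs_le_iff algebra_simps)
      moreover have "\<bar>2 * r * e\<bar> = \<bar>e\<bar> * (2 * r)" using r_pos by (simp add: abs_mult)
      ultimately have "\<bar>e\<bar> * (2 * r) \<le> 84 * (m * h)^3" by (simp only:)
      moreover have "0 < 2 * r" using r_pos by simp
      ultimately have "\<bar>e\<bar> \<le> 84 * (m * h)^3 / (2 * r)" by (simp only: pos_le_divide_eq)
      also have "\<dots> = K1 * h^3" by (simp add: K1_def power_mult_distrib)
      finally show ?thesis .
    qed
    have "K1 * h^3 = (K1 * h) * h^2" by (simp add: power2_eq_square power3_eq_cube)
    also have "\<dots> \<le> (c / 2) * h^2" using h_le by (intro mult_right_mono) auto
    finally have X: "c / 2 * h^2 \<le> - X" "- X \<le> 2 * (c * h^2)"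
      using e c by (auto simp: e_def abs_le_iff)
    have zeq: "\<bar>Z + q * c^2 * h^4\<bar> \<le> K2 * h^5"
    proof -
      have qc: "r^3 * (q * c^2 * h^4) = \<alpha>^2 * h^4 * r / 2"
        using r_pos alpha_pos by (simp add: q_def c_def power2_eq_square power3_eq_cube field_simps)
      have "r^3 * \<bar>Z + q * c^2 * h^4\<bar> = \<bar>r^3 * Z + r^3 * (q * c^2 * h^4)\<bar>"
        using r_pos by (simp add: abs_mult distrib_left[symmetric])
      also have "\<dots> \<le> 14 * h^2 * (m * h)^3" unfolding qc using G.endpoint_z unfolding p .
      also have "\<dots> = 14 * m^3 * h^5" by (simp add: power_mult_distrib power_add[symmetric] mult_ac)
      finally have "\<bar>Z + q * c^2 * h^4\<bar> \<le> 14 * m^3 * h^5 / r^3" using r_pos by (simp add: pos_le_divide_eq mult.commute)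
      then show ?thesis by (simp add: K2_def)
    qed
    have "Z + q * X^2 = (Z + q * c^2 * h^4) + q * (e^2 - 2 * c * h^2 * e)"
    proof -
      have "Z + q * (u - c * h^2)^2 = (Z + q * c^2 * h^4) + q * (u^2 - 2 * c * h^2 * u)" for u
        by (simp add: power2_eq_square power4_eq_xxxx algebra_simps)
      from this[of e] show ?thesis by (simp add: e_def)
    qed
    then have "\<bar>Z + q * X^2\<bar> \<le> \<bar>Z + q * c^2 * h^4\<bar> + q * (\<bar>e\<bar>^2 + 2 * c * h^2 * \<bar>e\<bar>)"
    proof -
      assume eq: "Z + q * X^2 = (Z + q * c^2 * h^4) + q * (e^2 - 2 * c * h^2 * e)"
      have "\<bar>e^2 - 2 * c * h^2 * e\<bar> \<le> \<bar>e\<bar>^2 + 2 * c * h^2 * \<bar>e\<bar>"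
        using abs_triangle_ineq4[of "e^2" "2 * c * h^2 * e"] c by (simp add: abs_mult)
      then have "\<bar>q * (e^2 - 2 * c * h^2 * e)\<bar> \<le> q * (\<bar>e\<bar>^2 + 2 * c * h^2 * \<bar>e\<bar>)"
        using q by (simp add: abs_mult)
      then show ?thesis unfolding eq by (rule order_trans[OF abs_triangle_ineq add_left_mono])
    qed
    also have "\<dots> \<le> K2 * h^5 + q * ((K1 * h^3)^2 + 2 * c * h^2 * (K1 * h^3))"
      using zeq e q c by (intro add_mono mult_left_mono power_mono) auto
    also have "\<dots> = K2 * h^5 + q * (K1^2 * h^6 + 2 * c * K1 * h^5)"
      by (simp add: power_mult_distrib power_add[symmetric] power_mult[symmetric] mult_ac)
    also have "\<dots> \<le> K2 * h^5 + q * (K1^2 * h^5 + 2 * c * K1 * h^5)"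
      using q h h_le K1 c power_decreasing[of 5 6 h] by (intro add_mono mult_left_mono) auto
    also have "\<dots> = K * (h * h^4)" by (simp add: K_def algebra_simps power4_eq_xxxx eval_nat_numeral)
    also have "h^4 \<le> 4 / c^2 * X^2"
    proof -
      have "(c / 2 * h^2)^2 \<le> (- X)^2" using X(1) c by (intro power_mono) auto
      then have "c^2 / 4 * h^4 \<le> X^2" by (simp add: power_mult_distrib power_divide)
      then show ?thesis using c by (simp add: field_simps)
    qed
    finally have "\<bar>Z + q * X^2\<bar> \<le> K * (h * (4 / c^2 * X^2))" using K h by (simp add: mult_left_mono)
    then have "\<bar>Z - (- 2 / (r^2 * \<alpha>^2)) * X^2\<bar> \<le> 4 * K / c^2 * h * X^2"
      by (simp add: q_def mult_ac)
    with X show "\<alpha>^2 * h^2 / 4 \<le> - X \<and> - X \<le> \<alpha>^2 * h^2 \<and> \<bar>Z - (- 2 / (r^2 * \<alpha>^2)) * X^2\<bar> \<le> 4 * K / c^2 * h * X^2"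
      by (simp add: c_def)
  qed (use h3 K in auto)
qed

text \<open>Along the continuous family \<open>X\<close> is squeezed between \<open>- \<alpha>^2 h^2\<close> and \<open>- \<alpha>^2 h^2 / 4\<close>, so it takes every
  intermediate value.\<close>

lemma endpoint_exists:
  obtains h4 where "0 < h4"
    "\<And>k X. \<lbrakk>0 < k; k \<le> h4; - (\<alpha>^2 * k^2 / 4) < X; X < 0\<rbrakk> \<Longrightarrow>
       \<exists>h Z. 0 < h \<and> h \<le> k \<and> endpoint h (2 * r * X - r, r^3 * Z)"
proof -
  obtain h0 w where h0: "0 < h0" "h0 \<le> h1"
    and wR: "\<And>h t. \<lbrakk>0 < h; h \<le> h0; t \<in> {0..r}\<rbrakk> \<Longrightarrow> norm (w h t) \<le> R"
    and ws: "\<And>h. \<lbrakk>0 < h; h \<le> h0\<rbrakk> \<Longrightarrow>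
       solves_at h (\<lambda>t. N1 h t (w h t)) (\<lambda>t. N2 h t (w h t)) (\<lambda>t. N3 h t (w h t)) (w h)"
    and wc: "continuous_on {0<..h0} (\<lambda>h. W (w h r))"
    using solution_family by blast
  obtain h3 K where h3: "0 < h3" and est: "\<And>h X Z. \<lbrakk>0 < h; h \<le> h3; endpoint h (2 * r * X - r, r^3 * Z)\<rbrakk> \<Longrightarrow>
       \<alpha>^2 * h^2 / 4 \<le> - X \<and> - X \<le> \<alpha>^2 * h^2"
    using endpoint_estimates by metis
  define h4 where "h4 = min h0 (min h3 (r / 2))"
  have h4: "0 < h4" "h4 \<le> h0" "h4 \<le> h3" "2 * h4 \<le> r" using h0 h3 r_pos by (auto simp: h4_def min_def)
  \<comment> \<open>The value of \<open>X\<close> at the end of the solution at \<open>h\<close>.\<close>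
  define \<xi> where "\<xi> h = h * W (w h r) / (2 * r)" for h
  have ep: "\<exists>Z. endpoint h (2 * r * \<xi> h - r, r^3 * Z)" if h: "0 < h" "h \<le> h4" for h
  proof -
    have hh: "h \<le> h0" "h \<le> h1" "2 * h \<le> r" using h h4 h0 by auto
    obtain y z \<phi> where tg: "thin_geodesic \<alpha> \<beta> \<gamma> r (1 / h^2) (\<lambda>t. h * W (w h t) - t) y z \<phi> m h"
      using solution_is_geodesic[OF h(1) hh(2,3) wR[OF h(1) hh(1)] ws[OF h(1) hh(1)]] by blast
    have "2 * r * \<xi> h - r = h * W (w h r) - r" "r^3 * (z r / r^3) = z r" using r_pos by (simp_all add: \<xi>_def)
    with tg have "endpoint h (2 * r * \<xi> h - r, r^3 * (z r / r^3))" unfolding endpoint_def by metis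
    then show ?thesis by blast
  qed
  have bounds: "\<alpha>^2 * h^2 / 4 \<le> - \<xi> h" "- \<xi> h \<le> \<alpha>^2 * h^2" if h: "0 < h" "h \<le> h4" for h
    using est[OF h(1)] ep[OF h] h h4 by (meson order_trans)+
  show thesis
  proof (rule that[OF h4(1)])
    fix k X assume k: "0 < k" "k \<le> h4" and X: "- (\<alpha>^2 * k^2 / 4) < X" "X < 0"
    \<comment> \<open>So small that \<open>\<alpha>^2 l^2 \<le> - X / 4\<close>, which puts the value at \<open>l\<close> above \<open>X\<close>.\<close>
    define l where "l = min k (sqrt (- X) / (2 * \<alpha>))"
    have l: "0 < l" "l \<le> k" using k X alpha_pos by (auto simp: l_def)
    have "\<alpha> * l \<le> \<alpha> * (sqrt (- X) / (2 * \<alpha>))" using alpha_pos by (intro mult_left_mono) (auto simp: l_def)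
    then have "\<alpha> * l \<le> sqrt (- X) / 2" using alpha_pos by simp
    then have "(\<alpha> * l)^2 \<le> (sqrt (- X) / 2)^2" using alpha_pos l by (intro power_mono) auto
    then have "\<alpha>^2 * l^2 \<le> - X / 4" using X by (simp add: power_mult_distrib power_divide)
    then have lo: "X \<le> \<xi> l" using bounds(2)[of l] l k X by simp
    have hi: "\<xi> k \<le> X" using bounds(1)[OF k] X by simp
    have "continuous_on {l..k} \<xi>"
      unfolding \<xi>_def
      by (intro continuous_intros continuous_on_subset[OF wc]) (use l k h4 r_pos in auto)
    from IVT2'[OF hi lo l(2) this] obtain h where h: "l \<le> h" "h \<le> k" "\<xi> h = X" by blast
    then show "\<exists>h Z. 0 < h \<and> h \<le> k \<and> endpoint h (2 * r * X - r, r^3 * Z)"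
      using ep[of h] l k by (metis less_le_trans order_trans)
  qed
qed

end

theorem proposition4p16:
  fixes \<alpha> \<beta> \<gamma> :: real
  assumes "\<alpha> > 0"
  shows "\<exists>r0>0. \<forall>r. 0 < r \<and> r < r0 \<longrightarrow>
    (\<exists>f :: real \<Rightarrow> real.
       (\<lambda>X. f X - (- 2 / (r^2 * \<alpha>^2)) * X^2) \<in> o[at_left 0](\<lambda>X. X^2) \<and>
       (\<exists>\<delta>0>0. \<forall>\<delta>. 0 < \<delta> \<and> \<delta> \<le> \<delta>0 \<longrightarrow>
         (\<exists>\<Lambda>0. \<forall>\<Lambda>\<ge>\<Lambda>0. \<exists>\<epsilon>>0.
            {(X, Z). (X, Z) \<in> rescale r ` branch_D1 \<alpha> \<beta> \<gamma> r \<delta> \<Lambda> \<and> \<bar>X\<bar> < \<epsilon>}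
            = {(X, Z). - \<epsilon> < X \<and> X < 0 \<and> Z = f X})))"
proof -
  define m where "m = 1 + \<alpha> + \<bar>\<beta>\<bar> + \<bar>\<gamma>\<bar>"
  have m: "1 \<le> m" using assms by (simp add: m_def)
  show ?thesis
  proof (intro exI[of _ "1 / (64 * m)"] conjI allI impI)
    show "0 < 1 / (64 * m)" using m by simp
    fix r :: real assume r: "0 < r \<and> r < 1 / (64 * m)"
    then have r_small: "64 * m * r \<le> 1" using m by (simp add: field_simps)
    interpret scaled_system \<alpha> \<beta> \<gamma> r m
      by unfold_locales (use assms r m_def r_small in auto)
    define Br where "Br \<delta> \<Lambda> = rescale r ` branch_D1 \<alpha> \<beta> \<gamma> r \<delta> \<Lambda>" for \<delta> \<Lambda>
    have Br: "(X, Z) \<in> Br \<delta> \<Lambda> \<longleftrightarrow> (2 * r * X - r, r^3 * Z) \<in> branch_D1 \<alpha> \<beta> \<gamma> r \<delta> \<Lambda>" for X Z \<delta> \<Lambda>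
    proof
      assume "(X, Z) \<in> Br \<delta> \<Lambda>"
      then obtain u v where uv: "(u, v) \<in> branch_D1 \<alpha> \<beta> \<gamma> r \<delta> \<Lambda>" "X = (u + r) / (2 * r)" "Z = v / r^3"
        by (auto simp: Br_def rescale_def)
      then have "2 * r * X - r = u" "r^3 * Z = v" using r by simp_all
      with uv(1) show "(2 * r * X - r, r^3 * Z) \<in> branch_D1 \<alpha> \<beta> \<gamma> r \<delta> \<Lambda>" by simp
    next
      assume "(2 * r * X - r, r^3 * Z) \<in> branch_D1 \<alpha> \<beta> \<gamma> r \<delta> \<Lambda>"
      moreover have "rescale r (2 * r * X - r, r^3 * Z) = (X, Z)" using r by (simp add: rescale_def)
      ultimately show "(X, Z) \<in> Br \<delta> \<Lambda>" unfolding Br_def by (metis imageI)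
    qed
    have mono: "Br \<delta> \<Lambda> \<subseteq> Br \<delta>' \<Lambda>'" if "\<delta> \<le> \<delta>'" "\<Lambda>' \<le> \<Lambda>" for \<delta> \<delta>' \<Lambda> \<Lambda>'
    proof -
      have "branch_D1 \<alpha> \<beta> \<gamma> r \<delta> \<Lambda> \<subseteq> branch_D1 \<alpha> \<beta> \<gamma> r \<delta>' \<Lambda>'"
      proof
        fix p assume "p \<in> branch_D1 \<alpha> \<beta> \<gamma> r \<delta> \<Lambda>"
        then obtain pz x y z \<theta> j where g: "p = (x r, z r)" "normal_geodesic \<alpha> \<beta> \<gamma> r pz x y z \<theta>"
          "first_return r y" "pz > \<Lambda>" "\<forall>t\<in>{0..r}. \<bar>\<theta> t - (pi + 2 * pi * of_int j)\<bar> < \<delta>"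
          unfolding branch_D1_def by blast
        moreover have "pz > \<Lambda>'" "\<forall>t\<in>{0..r}. \<bar>\<theta> t - (pi + 2 * pi * of_int j)\<bar> < \<delta>'"
          using g(4,5) that by force+
        ultimately show "p \<in> branch_D1 \<alpha> \<beta> \<gamma> r \<delta>' \<Lambda>'" unfolding branch_D1_def by blast
      qed
      then show ?thesis unfolding Br_def by blast
    qed
    obtain h3 K where h3: "0 < h3" "0 \<le> K" and est: "\<And>h X Z. \<lbrakk>0 < h; h \<le> h3; endpoint h (2 * r * X - r, r^3 * Z)\<rbrakk> \<Longrightarrow>
       \<alpha>^2 * h^2 / 4 \<le> - X \<and> - X \<le> \<alpha>^2 * h^2 \<and> \<bar>Z - (- 2 / (r^2 * \<alpha>^2)) * X^2\<bar> \<le> K * h * X^2"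
      using endpoint_estimates by blast
    obtain h4 where h4: "0 < h4" and ex: "\<And>k X. \<lbrakk>0 < k; k \<le> h4; - (\<alpha>^2 * k^2 / 4) < X; X < 0\<rbrakk> \<Longrightarrow>
       \<exists>h Z. 0 < h \<and> h \<le> k \<and> endpoint h (2 * r * X - r, r^3 * Z)"
      using endpoint_exists by blast
    define k where "k = min h3 (min h4 (min (1 / (12 * m)) (1 / (4 * \<alpha>))))"
    have k: "0 < k" "k \<le> h3" "k \<le> h4" "k \<le> 1 / (12 * m)" "k \<le> 1 / (4 * \<alpha>)"
      using h3 h4 m assms by (auto simp: k_def)
    have mk: "12 * m * k \<le> 1" using k(4) m by (simp add: field_simps)
    \<comment> \<open>Multipliers above \<open>\<Lambda>1\<close> correspond to parameters below \<open>k\<close>, and \<open>f\<close> is read off the largest representative, with tube width \<open>1\<close>; all others are contained in it.\<close>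
    define \<Lambda>1 where "\<Lambda>1 = 1 / k^2"
    define f where "f X = (SOME Z. (X, Z) \<in> Br 1 \<Lambda>1)" for X
    have in_branch: "\<exists>h. 0 < h \<and> h < k \<and> endpoint h (2 * r * X - r, r^3 * Z)" if "(X, Z) \<in> Br 1 \<Lambda>1" for X Z
      using branch_D1_endpoint[OF that[unfolded Br] order_refl k(1) mk] unfolding \<Lambda>1_def by blast
    have unique: "Z = Z'" if u: "(X, Z) \<in> Br 1 \<Lambda>1" "(X, Z') \<in> Br 1 \<Lambda>1" for X Z Z'
    proof -
      obtain h h' where "endpoint h (2 * r * X - r, r^3 * Z)" "endpoint h' (2 * r * X - r, r^3 * Z')"
        using in_branch[OF u(1)] in_branch[OF u(2)] by blast
      then have "r^3 * Z = r^3 * Z'" by (rule endpoint_unique)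
      then show ?thesis using r by simp
    qed
    have f_eq: "f X = Z" if "(X, Z) \<in> Br 1 \<Lambda>1" for X Z
      using someI[of "\<lambda>Z. (X, Z) \<in> Br 1 \<Lambda>1", OF that] unique[OF _ that] by (simp add: f_def)
    have exist: "\<exists>h Z. 0 < h \<and> h \<le> l \<and> endpoint h (2 * r * X - r, r^3 * Z) \<and> (X, Z) \<in> Br \<delta> \<Lambda>"
      if l: "0 < l" "l \<le> k" "2 * \<alpha> * l < \<delta>" "\<Lambda> < 1 / l^2" and X: "- (\<alpha>^2 * l^2 / 4) < X" "X < 0" for l \<delta> \<Lambda> X
    proof -
      obtain h Z where h: "0 < h" "h \<le> l" "endpoint h (2 * r * X - r, r^3 * Z)"
        using ex[OF l(1) _ X] l(2) k(3) by auto
      have "2 * \<alpha> * h \<le> 2 * \<alpha> * l" using h assms by (intro mult_left_mono) auto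
      moreover have "1 / l^2 \<le> 1 / h^2" using h by (intro divide_left_mono power_mono) auto
      ultimately have "(X, Z) \<in> Br \<delta> \<Lambda>"
        unfolding Br using l by (intro endpoint_branch_D1[OF h(3,1)]) linarith+
      with h show ?thesis by blast
    qed
    show "\<exists>f. (\<lambda>X. f X - (- 2 / (r^2 * \<alpha>^2)) * X^2) \<in> o[at_left 0](\<lambda>X. X^2) \<and>
       (\<exists>\<delta>0>0. \<forall>\<delta>. 0 < \<delta> \<and> \<delta> \<le> \<delta>0 \<longrightarrow>
         (\<exists>\<Lambda>0. \<forall>\<Lambda>\<ge>\<Lambda>0. \<exists>\<epsilon>>0.
            {(X, Z). (X, Z) \<in> rescale r ` branch_D1 \<alpha> \<beta> \<gamma> r \<delta> \<Lambda> \<and> \<bar>X\<bar> < \<epsilon>}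
            = {(X, Z). - \<epsilon> < X \<and> X < 0 \<and> Z = f X}))"
      unfolding Br_def[symmetric]
    proof (rule exI[of _ f], rule conjI)
      show "(\<lambda>X. f X - (- 2 / (r^2 * \<alpha>^2)) * X^2) \<in> o[at_left 0](\<lambda>X. X^2)"
      proof (rule landau_o.smallI)
        fix c :: real assume c: "0 < c"
        \<comment> \<open>Half of \<open>k\<close>, so that the multipliers are strictly above \<open>\<Lambda>1\<close>.\<close>
        define l where "l = min (k / 2) (c / (K + 1))"
        have "0 < c / (K + 1)" using c h3 by simp
        then have "0 < l" using k(1) by (simp add: l_def)
        moreover have "l \<le> k / 2" "l \<le> c / (K + 1)"
          unfolding l_def by (rule min.cobounded1, rule min.cobounded2)
        ultimately have l: "0 < l" "l \<le> k" "l < k" "l \<le> c / (K + 1)" using k(1) by linarith+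
        have Kl: "K * l \<le> c"
        proof -
          have "(K + 1) * l \<le> c" using l(4) h3 by (simp add: field_simps)
          then show ?thesis using l(1) by (simp add: distrib_right)
        qed
        have al: "2 * \<alpha> * l < 1"
        proof -
          have "\<alpha> * k \<le> 1/4" using k(5) assms by (simp add: field_simps)
          moreover have "\<alpha> * l \<le> \<alpha> * k" using l assms by (intro mult_left_mono) auto
          ultimately show ?thesis by simp
        qed
        have Ll: "\<Lambda>1 < 1 / l^2"
          unfolding \<Lambda>1_def using l k(1) by (intro divide_strict_left_mono power_strict_mono) auto
        have "- (\<alpha>^2 * l^2 / 4) < (0::real)" using l(1) assms by simp
        moreover have "norm (f X - (- 2 / (r^2 * \<alpha>^2)) * X^2) \<le> c * norm (X^2)"
          if X: "- (\<alpha>^2 * l^2 / 4) < X" "X < 0" for X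
        proof -
          obtain h Z where h: "0 < h" "h \<le> l" "endpoint h (2 * r * X - r, r^3 * Z)" "(X, Z) \<in> Br 1 \<Lambda>1"
            using exist[OF l(1,2) al Ll X] by blast
          have "\<bar>Z - (- 2 / (r^2 * \<alpha>^2)) * X^2\<bar> \<le> K * h * X^2"
            using est[OF h(1) _ h(3)] h l k by simp
          also have "K * h * X^2 \<le> K * l * X^2" using h h3 by (intro mult_right_mono mult_left_mono) auto
          also have "\<dots> \<le> c * X^2" using Kl by (intro mult_right_mono) auto
          finally show ?thesis using f_eq[OF h(4)] by simp
        qed
        ultimately show "\<forall>\<^sub>F X in at_left 0. norm (f X - (- 2 / (r^2 * \<alpha>^2)) * X^2) \<le> c * norm (X^2)"
          unfolding eventually_at_left_field by blast
      qed
      show "\<exists>\<delta>0>0. \<forall>\<delta>. 0 < \<delta> \<and> \<delta> \<le> \<delta>0 \<longrightarrow>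
         (\<exists>\<Lambda>0. \<forall>\<Lambda>\<ge>\<Lambda>0. \<exists>\<epsilon>>0. {(X, Z). (X, Z) \<in> Br \<delta> \<Lambda> \<and> \<bar>X\<bar> < \<epsilon>} = {(X, Z). - \<epsilon> < X \<and> X < 0 \<and> Z = f X})"
      proof (rule exI[of _ 1], rule conjI, simp, intro allI impI)
        fix \<delta> :: real assume \<delta>: "0 < \<delta> \<and> \<delta> \<le> 1"
        show "\<exists>\<Lambda>0. \<forall>\<Lambda>\<ge>\<Lambda>0. \<exists>\<epsilon>>0. {(X, Z). (X, Z) \<in> Br \<delta> \<Lambda> \<and> \<bar>X\<bar> < \<epsilon>} = {(X, Z). - \<epsilon> < X \<and> X < 0 \<and> Z = f X}"
        proof (rule exI[of _ \<Lambda>1], intro allI impI)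
          fix \<Lambda> :: real assume \<Lambda>: "\<Lambda>1 \<le> \<Lambda>"
          have "0 < \<Lambda>1" using k(1) by (simp add: \<Lambda>1_def)
          then have L0: "0 < \<Lambda>" using \<Lambda> by simp
          \<comment> \<open>The last two bounds make the multiplier exceed \<open>\<Lambda>\<close> and the angle fit into the tube.\<close>
          define l where "l = min (k / 2) (min (1 / sqrt (2 * \<Lambda>)) (\<delta> / (4 * \<alpha>)))"
          have "0 < 1 / sqrt (2 * \<Lambda>)" "0 < \<delta> / (4 * \<alpha>)" using L0 \<delta> assms by simp_all
          then have "0 < l" "l \<le> k / 2" "l \<le> 1 / sqrt (2 * \<Lambda>)" "l \<le> \<delta> / (4 * \<alpha>)"
            using k(1) by (simp_all add: l_def)
          then have l: "0 < l" "l \<le> k" "l \<le> 1 / sqrt (2 * \<Lambda>)" "l \<le> \<delta> / (4 * \<alpha>)"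
            using k(1) by linarith+
          have al: "2 * \<alpha> * l < \<delta>"
          proof -
            have "\<alpha> * l \<le> \<alpha> * (\<delta> / (4 * \<alpha>))" using l assms by (intro mult_left_mono) auto
            then have "\<alpha> * l \<le> \<delta> / 4" using assms by simp
            then show ?thesis using \<delta> by linarith
          qed
          have Ll: "\<Lambda> < 1 / l^2"
          proof -
            have "l^2 \<le> (1 / sqrt (2 * \<Lambda>))^2" using l by (intro power_mono) auto
            then have "l^2 \<le> 1 / (2 * \<Lambda>)" using L0 by (simp add: power_divide)
            then have "\<Lambda> * l^2 \<le> 1/2" using L0 by (simp add: field_simps)
            then show ?thesis using l(1) by (simp add: field_simps)
          qed
          define \<epsilon> where "\<epsilon> = \<alpha>^2 * l^2 / 4"
          have sub: "Br \<delta> \<Lambda> \<subseteq> Br 1 \<Lambda>1" using \<delta> \<Lambda> by (intro mono) auto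
          have "(X, Z) \<in> Br \<delta> \<Lambda> \<and> \<bar>X\<bar> < \<epsilon> \<longleftrightarrow> - \<epsilon> < X \<and> X < 0 \<and> Z = f X" for X Z
          proof
            assume a: "(X, Z) \<in> Br \<delta> \<Lambda> \<and> \<bar>X\<bar> < \<epsilon>"
            then have in1: "(X, Z) \<in> Br 1 \<Lambda>1" using sub by blast
            obtain h where h: "0 < h" "h < k" "endpoint h (2 * r * X - r, r^3 * Z)"
              using in_branch in1 by blast
            have "0 < \<alpha>^2 * h^2 / 4" using h assms by simp
            then have "X < 0" using est[OF h(1) _ h(3)] h k by linarith
            then show "- \<epsilon> < X \<and> X < 0 \<and> Z = f X" using a f_eq[OF in1] by auto
          next
            assume a: "- \<epsilon> < X \<and> X < 0 \<and> Z = f X"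
            then obtain Z' where Z': "(X, Z') \<in> Br \<delta> \<Lambda>"
              using exist[OF l(1,2) al Ll, of X] by (auto simp: \<epsilon>_def)
            then have "f X = Z'" using sub f_eq by blast
            with Z' a show "(X, Z) \<in> Br \<delta> \<Lambda> \<and> \<bar>X\<bar> < \<epsilon>" by auto
          qed
          then show "\<exists>\<epsilon>>0. {(X, Z). (X, Z) \<in> Br \<delta> \<Lambda> \<and> \<bar>X\<bar> < \<epsilon>} = {(X, Z). - \<epsilon> < X \<and> X < 0 \<and> Z = f X}"
            using l(1) assms by (intro exI[of _ \<epsilon>]) (auto simp: \<epsilon>_def)
        qed
      qed
    qed
  qed
qed

end
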